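(* Let $p$ and $q$ be irreducible monic polynomials with degree $2$ over $\mathbb{F}$, and assume that they have the same splitting field $\mathbb{L}$ (in $\overline{\mathbb{F}}$). Assume further that $q$ is not a translation of $p$ over $\mathbb{F}$ and that $p$ is separable, and set $\delta:=\operatorname{tr}p-\operatorname{tr}q$. Denote by $x_1,x_2$ (respectively, by $y_1,y_2$) the roots of $p$ (respectively, of $q$) in $\mathbb{L}$. Let $u$ be an endomorphism of a finite-dimensional vector space $V$ over $\mathbb{F}$. Then, the following conditions are equivalent: (i) $u$ is a d-exceptional $(p,q)$-difference. (ii) The minimal polynomial of $u$ is the product of a power of $t^2-\delta t+N_{\mathbb{L}/\mathbb{F}}(x_1-y_1)$ with a power of $t^2-\delta t+N_{\mathbb{L}/\mathbb{F}}(x_1-y_2)$. Moreover, the invariant factors of $u$ read $r_1,r_2,\dots,r_{2k-1},r_{2k},\dots$ where, for every positive integer $k$, there are integers $a$ and $b$ in $\{0,1\}$ such that $$r_{2k-1}=r_{2k}\times\bigl(t^2-\delta t+N_{\mathbb{L}/\mathbb{F}}(x_1-y_1)\bigr)^a\bigl(t^2-\delta t+N_{\mathbb{L}/\mathbb{F}}(x_1-y_2)\bigr)^b.$$ (iii) In some basis of $V$, the endomorphism $u$ is represented by a block-diagonal matrix in which every diagonal block equals $$C\bigl((t^2-\delta t+N_{\mathbb{L}/\mathbb{F}}(x-y))^{k+\epsilon}\bigr)\oplus C\bigl((t^2-\delta t+N_{\mathbb{L}/\mathbb{F}}(x-y))^k\bigr)$$ for some root $x$ of $p$, some root $y$ of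 $q$, some integer $k\geq 0$ and some $\epsilon\in\{0,1\}$.
   Context: $\mathbb{F}$ is an arbitrary field with algebraic closure $\overline{\mathbb{F}}$. For a monic polynomial $p$ of degree $n\ge 1$, $\operatorname{tr}(p)$ is the opposite of the coefficient of $p$ on $t^{n-1}$, and $\operatorname{Root}(p)$ is its set of roots in $\overline{\mathbb{F}}$. One says that $q$ is a translation of $p$ (over $\mathbb{F}$) if $q(t)=p(t+d)$ for some $d\in\mathbb{F}$. $N_{\mathbb{L}/\mathbb{F}}$ is the norm of the quadratic extension $\mathbb{L}/\mathbb{F}$. An endomorphism $u$ of $V$ is a $(p,q)$-difference if $u=a-b$ for some endomorphisms $a,b$ of $V$ with $p(a)=0$ and $q(b)=0$. It is d-exceptional with respect to $(p,q)$ if all its eigenvalues in $\overline{\mathbb{F}}$ belong to $\operatorname{Root}(p)-\operatorname{Root}(q)=\{x-y: x\in\operatorname{Root}(p),\,y\in\operatorname{Root}(q)\}$; a d-exceptional $(p,q)$-difference is a $(p,q)$-difference that is d-exceptional with respect to $(p,q)$. $C(r)$ is the companion matrix of the monic polynomial $r$ ($C(1)$ is the $0\times0$ matrix), and $\oplus$ is block-diagonal sum. The invariant factors of $u$ are the monic polynomials $r_1,r_2,\dots$ with $r_{i+1}\mid r_i$ such that $u$ is represented in some basis by $C(r_1)\oplus C(r_2)\oplus\cdots$; the finite list of nonconstant ones is extended to an infinite sequence by $r_i=1$. *)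

theory Defs
  imports
    "HOL-Algebra.Algebraic_Closure_Type"
    "HOL-Algebra.Generated_Fields"
    "Jordan_Normal_Form.Determinant"
    "Jordan_Normal_Form.Char_Poly"
begin

section \<open>Polynomials over a field and their roots in its algebraic closure\<close>

definition tr :: "'a::field poly \<Rightarrow> 'a" where
  "tr p = - Polynomial.coeff p (Polynomial.degree p - 1)"

definition Root :: "'a::field poly \<Rightarrow> 'a alg_closure set" where
  "Root p = {x. poly (map_poly to_ac p) x = 0}"

text \<open>\<^const>\<open>rsquarefree\<close> says that a polynomial is nonzero and has no multiple root.\<close>

definition separable_poly :: "'a::field poly \<Rightarrow> bool" where
  "separable_poly p \<longleftrightarrow> rsquarefree (map_poly to_ac p)"

definition is_translation :: "'a::field poly \<Rightarrow> 'a poly \<Rightarrow> bool" where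
  "is_translation q p \<longleftrightarrow> (\<exists>d. q = pcompose p [:d, 1:])"

definition splitting_field :: "'a::field poly \<Rightarrow> 'a alg_closure set" where
  "splitting_field p = generate_field ring_of_type_algebra (range to_ac \<union> Root p)"


section \<open>Matrices\<close>

text \<open>For a monic polynomial of degree \<open>n\<close>: ones on the subdiagonal and the opposites of the
  coefficients of \<open>t\<^sup>0, \<dots>, t\<^sup>n\<^sup>-\<^sup>1\<close> in the last column.\<close>

definition companion :: "'a::field poly \<Rightarrow> 'a mat" where
  "companion r = (let n = Polynomial.degree r in
     mat n n (\<lambda>(i, j). if j = n - 1 then - Polynomial.coeff r i
                        else if i = j + 1 then 1 else 0))"


section \<open>Endomorphisms\<close>

context
  fixes scale :: "'a::field \<Rightarrow> 'b::ab_group_add \<Rightarrow> 'b"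
begin

definition poly_endo :: "'a poly \<Rightarrow> ('b \<Rightarrow> 'b) \<Rightarrow> 'b \<Rightarrow> 'b" where
  "poly_endo f u v = (\<Sum>i\<le>Polynomial.degree f. scale (Polynomial.coeff f i) ((u ^^ i) v))"

definition ordered_basis :: "'b set \<Rightarrow> 'b list \<Rightarrow> bool" where
  "ordered_basis W bs \<longleftrightarrow> distinct bs \<and>
     \<not> Modules.module.dependent scale (set bs) \<and> Modules.module.span scale (set bs) = W"

text \<open>The endomorphism that \<open>u\<close> induces on the subspace \<open>W\<close> is represented by \<open>A\<close> in some
  basis of \<open>W\<close>. The columns of \<open>A\<close> hold the coordinates of the images of the basis vectors.\<close>

definition represented_by :: "'b set \<Rightarrow> ('b \<Rightarrow> 'b) \<Rightarrow> 'a mat \<Rightarrow> bool" where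
  "represented_by W u A \<longleftrightarrow> (\<exists>bs. ordered_basis W bs \<and>
     A \<in> carrier_mat (length bs) (length bs) \<and>
     (\<forall>j<length bs. u (bs ! j) = (\<Sum>i<length bs. scale (A $$ (i, j)) (bs ! i))))"

definition is_minimal_polynomial :: "('b \<Rightarrow> 'b) \<Rightarrow> 'a poly \<Rightarrow> bool" where
  "is_minimal_polynomial u m \<longleftrightarrow> Polynomial.lead_coeff m = 1 \<and> (\<forall>v. poly_endo m u v = 0) \<and>
     (\<forall>f. (\<forall>v. poly_endo f u v = 0) \<longrightarrow> m dvd f)"

text \<open>The sequence is indexed from 1; the value \<open>r 0\<close> is irrelevant.\<close>

definition is_invariant_factors :: "('b \<Rightarrow> 'b) \<Rightarrow> (nat \<Rightarrow> 'a poly) \<Rightarrow> bool" where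
  "is_invariant_factors u r \<longleftrightarrow>
     (\<forall>i\<ge>1. Polynomial.lead_coeff (r i) = 1 \<and> r (i + 1) dvd r i) \<and>
     (\<exists>m. (\<forall>i>m. r i = 1) \<and>
          represented_by UNIV u (diag_block_mat (map (\<lambda>i. companion (r i)) [1..<m + 1])))"

text \<open>The eigenvalues in the algebraic closure, by extension of scalars of a matrix of \<open>u\<close>
  (the choice of the matrix does not matter).\<close>

definition ac_eigenvalues :: "('b \<Rightarrow> 'b) \<Rightarrow> 'a alg_closure set" where
  "ac_eigenvalues u =
     {l. \<exists>A. represented_by UNIV u A \<and> eigenvalue (map_mat to_ac A) l}"

definition d_exceptional :: "'a poly \<Rightarrow> 'a poly \<Rightarrow> ('b \<Rightarrow> 'b) \<Rightarrow> bool" where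
  "d_exceptional p q u \<longleftrightarrow> ac_eigenvalues u \<subseteq> {x - y | x y. x \<in> Root p \<and> y \<in> Root q}"

definition pq_difference :: "'a poly \<Rightarrow> 'a poly \<Rightarrow> ('b \<Rightarrow> 'b) \<Rightarrow> bool" where
  "pq_difference p q u \<longleftrightarrow>
     (\<exists>a b. Vector_Spaces.linear scale scale a \<and> Vector_Spaces.linear scale scale b \<and>
        (\<forall>v. poly_endo p a v = 0) \<and> (\<forall>v. poly_endo q b v = 0) \<and> (\<forall>v. u v = a v - b v))"

end


section \<open>The norm of a finite extension inside the algebraic closure\<close>

definition ac_scale :: "'a::field \<Rightarrow> 'a alg_closure \<Rightarrow> 'a alg_closure" where
  "ac_scale c x = to_ac c * x"

lemma vector_space_ac_scale: "vector_space ac_scale"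
  by unfold_locales (simp_all add: ac_scale_def algebra_simps)

text \<open>The norm of \<open>z \<in> L\<close> is the determinant of the multiplication by \<open>z\<close>, seen as an
  endomorphism of the vector space \<open>L\<close> over the base field.\<close>

definition field_norm :: "'a::field alg_closure set \<Rightarrow> 'a alg_closure \<Rightarrow> 'a" where
  "field_norm L z =
     (THE c. \<exists>A. represented_by ac_scale L (\<lambda>w. z * w) A \<and> c = Determinant.det A)"

end

theory Submission
  imports Defs
begin

text \<open>If \<open>u = a - b\<close> with \<open>p(a) = 0\<close> and \<open>q(b) = 0\<close>, then the commutator \<open>D = a b - b a\<close>
  satisfies \<open>D u = (\<delta> - u) D\<close> and \<open>D\<^sup>2 = P\<^sub>1(u) P\<^sub>2(u)\<close>, where \<open>P\<^sub>1\<close>, \<open>P\<^sub>2\<close> are the two quadratic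
  polynomials of the statement. Conversely, if \<open>2 u - \<delta>\<close> is invertible, such a \<open>D\<close> determines
  \<open>b = (2 u - \<delta>)\<^sup>-\<^sup>1 (D - u\<^sup>2 + tr(p) u + q(0) - p(0))\<close> and \<open>a = u + b\<close>.
  On the \<open>P\<close>-primary part of the space, \<open>P = P\<^sub>1\<close> or \<open>P = P\<^sub>2\<close>, the map \<open>D\<close> is a semilinear square root
  of \<open>P(u)\<close> up to a unit. The space is therefore a direct sum of
  uniserial pieces generated by some \<open>v\<close> under \<open>u\<close> and \<open>D\<close>, and in such a piece the annihilators of \<open>v\<close>
  and \<open>D v\<close> are \<open>P\<^sup>k\<^sup>+\<^sup>\<epsilon>\<close> and \<open>P\<^sup>k\<close> with \<open>\<epsilon> \<in> {0, 1}\<close>, which is the block form.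
  Sorting the exponents turns the blocks into invariant factors.\<close>

section \<open>Comaximal polynomials\<close>

text \<open>Write y1 = c + d x1 in the basis 1, x1 of the splitting field. Everything that has to be
  nonzero is controlled by d and by the discriminant \<Delta> of p: the constant terms of the two
  quadratics differ by d \<Delta>, and their discriminants are (1 - d)^2 \<Delta> and (1 + d)^2
  \<Delta>. Irreducibility of q gives d \<noteq> 0, the exclusion of translations gives d \<noteq> 1
  and d \<noteq> -1, separability gives \<Delta> \<noteq> 0. Hence the quadratics are distinct and
  irreducible, and 2 t - \<delta> is comaximal with both, in every characteristic. The obstacle is
  that D does not commute with u: it is semilinear for the substitution t -> \<delta> - t. The
  pieces are therefore built by hand, by lifting generators from the image of D and then adding
  pieces inside its kernel. Each condition is compared with \<open>paired\<close>, a decomposition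
  that no longer mentions D. Eigenvalues enter only through one fact: all of them are roots of P1 *
  P2 iff some power of P1 * P2 annihilates the space.\<close>

definition comaximal :: "'a::field poly \<Rightarrow> 'a poly \<Rightarrow> bool" where
  "comaximal f g \<longleftrightarrow> (\<exists>a b. a * f + b * g = 1)"

lemma comaximalI: "a * f + b * g = 1 \<Longrightarrow> comaximal f g"
  by (auto simp: comaximal_def)

lemma comaximal_sym: "comaximal f g \<Longrightarrow> comaximal g f"
  by (metis comaximal_def add.commute)

lemma comaximal_one_left [simp]: "comaximal 1 f"
  by (rule comaximalI[of 1 _ 0]) simp

lemma comaximal_one_right [simp]: "comaximal f 1"
  by (simp add: comaximal_sym)

lemma comaximal_mult_right:
  assumes "comaximal f g" "comaximal f h"
  shows "comaximal f (g * h)"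
proof -
  from assms obtain a b c d where *: "a * f + b * g = 1" "c * f + d * h = 1"
    by (auto simp: comaximal_def)
  have "(a * f + b * g) * (c * f + d * h) = 1" using * by simp
  then have "(a * c * f + a * d * h + b * g * c) * f + (b * d) * (g * h) = 1"
    by (simp add: algebra_simps)
  then show ?thesis by (rule comaximalI)
qed

lemma comaximal_power_right: "comaximal f g \<Longrightarrow> comaximal f (g ^ n)"
  by (induction n) (auto intro: comaximal_mult_right)

lemma comaximal_power: "comaximal f g \<Longrightarrow> comaximal (f ^ m) (g ^ n)"
  by (meson comaximal_power_right comaximal_sym)

lemma comaximal_dvd_mult:
  assumes "comaximal f g" "f dvd g * h"
  shows "f dvd h"
proof -
  from assms(1) obtain a b where "a * f + b * g = 1" by (auto simp: comaximal_def)
  then have "h = (a * f + b * g) * h" by simp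
  then have "h = f * (a * h) + b * (g * h)" by (simp add: algebra_simps)
  then show ?thesis using assms(2) by (metis dvd_add dvd_mult dvd_triv_left)
qed

lemma comaximal_mult_dvd:
  assumes "comaximal f g" "f dvd h" "g dvd h"
  shows "f * g dvd h"
proof -
  from assms(2) obtain k where k: "h = f * k" by (metis dvd_def)
  then have "g dvd f * k" using assms(3) by simp
  then have "g dvd k" by (rule comaximal_dvd_mult[OF comaximal_sym[OF assms(1)]])
  then show ?thesis by (simp add: k)
qed

lemma Bezout_poly:
  fixes f g :: "'a::field poly"
  shows "\<exists>a b. a * f + b * g dvd f \<and> a * f + b * g dvd g"
\<comment> \<open>The measure puts \<open>g = 0\<close> strictly below the nonzero constants, which
  the degree alone does not separate; so the Euclidean step also decreases it when the remainder is
  0.\<close>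
proof (induction "if g = 0 then 0 else Suc (Polynomial.degree g)" arbitrary: f g rule: less_induct)
  case less
  show ?case
  proof (cases "g = 0")
    case True
    then have "1 * f + 0 * g dvd f \<and> 1 * f + 0 * g dvd g" by simp
    then show ?thesis by blast
  next
    case False
    have "(if f mod g = 0 then 0 else Suc (Polynomial.degree (f mod g)))
       < (if g = 0 then 0 else Suc (Polynomial.degree g))"
      using False degree_mod_less[of g f] by auto
    from less[OF this] obtain a b where ab: "a * g + b * (f mod g) dvd g"
      "a * g + b * (f mod g) dvd f mod g" by blast
    have e: "a * g + b * (f mod g) = b * f + (a - b * (f div g)) * g"
      by (simp add: minus_div_mult_eq_mod[symmetric] algebra_simps)
    have "a * g + b * (f mod g) dvd f" using ab dvd_mod_iff by blast
    then show ?thesis using ab e by metis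
  qed
qed

text \<open>A common divisor of the form a f + b g either is a unit, and rescaling gives the Bezout
  identity, or is associated to f, which would then divide g.\<close>

lemma irreducible_comaximal:
  fixes f g :: "'a::field poly"
  assumes "Factorial_Ring.irreducible f" "\<not> f dvd g"
  shows "comaximal f g"
proof -
  obtain a b where ab: "a * f + b * g dvd f" "a * f + b * g dvd g"
    using Bezout_poly by blast
  let ?d = "a * f + b * g"
  have "is_unit ?d"
  proof (rule ccontr)
    assume "\<not> is_unit ?d"
    moreover from ab(1) obtain k where k: "f = ?d * k" by (metis dvd_def)
    ultimately have "is_unit k" using assms(1) Factorial_Ring.irreducibleD by blast
    then have "f dvd ?d" using k by (metis dvd_refl mult_unit_dvd_iff)
    then show False using ab(2) assms(2) dvd_trans by blast
  qed
  then obtain k where "1 = ?d * k" by (metis dvd_def)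
  then have "(k * a) * f + (k * b) * g = 1" by (simp add: algebra_simps)
  then show ?thesis by (rule comaximalI)
qed

lemma irreducible_factor_exists:
  fixes f :: "'a::field poly"
  assumes "f \<noteq> 0" "\<not> is_unit f"
  obtains g h where "Factorial_Ring.irreducible g" "f = g * h"
    "Polynomial.degree h < Polynomial.degree f"
proof -
  have "\<exists>g. Factorial_Ring.irreducible g \<and> g dvd f"
    using assms
  proof (induction "Polynomial.degree f" arbitrary: f rule: less_induct)
    case less
    show ?case
    proof (cases "Factorial_Ring.irreducible f")
      case False
      then obtain a b where ab: "f = a * b" "\<not> is_unit a" "\<not> is_unit b"
        using less.prems by (auto simp: Factorial_Ring.irreducible_def)
      then have nz: "a \<noteq> 0" "b \<noteq> 0" using less.prems by auto
      then have "Polynomial.degree a < Polynomial.degree f"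
        using ab by (auto simp: degree_mult_eq is_unit_iff_degree)
      from less.hyps[OF this nz(1) ab(2)] show ?thesis using ab(1) by auto
    qed auto
  qed
  then obtain g h where gh: "Factorial_Ring.irreducible g" "f = g * h" unfolding dvd_def by blast
  have "g \<noteq> 0" "h \<noteq> 0" "\<not> is_unit g" using gh assms by (auto simp: Factorial_Ring.irreducible_def)
  then have "Polynomial.degree h < Polynomial.degree f"
    by (auto simp: gh(2) degree_mult_eq is_unit_iff_degree)
  then show ?thesis using that gh by blast
qed

text \<open>Factors are removed one at a time: if P divides f, cancel it on both sides; otherwise f
  is comaximal with P and still divides the product with one P fewer. Being monic turns the final
  unit into 1. Invariant factors are recognized in this way from the minimal polynomial.\<close>

lemma monic_dvd_powers:
  fixes P Q :: "'a::field poly"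
  assumes "Factorial_Ring.irreducible P" "Factorial_Ring.irreducible Q"
    "Polynomial.lead_coeff P = 1" "Polynomial.lead_coeff Q = 1"
    "f dvd P ^ m * Q ^ n" "Polynomial.lead_coeff f = 1"
  shows "\<exists>i j. f = P ^ i * Q ^ j"
  using assms(5,6)
proof (induction "m + n" arbitrary: m n f)
  case 0
  then have "is_unit f" by simp
  then have "Polynomial.degree f = 0" using is_unit_iff_degree[of f] by fastforce
  then have "f = 1" using 0 by (metis monic_degree_0)
  then have "f = P ^ 0 * Q ^ 0" by simp
  then show ?case by blast
next
  case (Suc k)
  have PQ0: "P \<noteq> 0" "Q \<noteq> 0" using assms by auto
  consider "P dvd f" "m > 0" | "\<not> P dvd f" "m > 0" | "Q dvd f" "m = 0" "n > 0" | "\<not> Q dvd f" "m = 0" "n > 0"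
    using Suc(2) by fastforce
  then show ?case
  proof cases
    case 1
    then obtain h where h: "f = P * h" by (metis dvd_def)
    have "P * h dvd P * (P ^ (m - 1) * Q ^ n)" using Suc.prems h 1
      by (metis mult.assoc power_eq_if not_gr_zero)
    then have "h dvd P ^ (m - 1) * Q ^ n" using PQ0 by simp
    moreover have "Polynomial.lead_coeff h = 1" using Suc.prems(2) assms(3)
      by (simp add: h Polynomial.lead_coeff_mult)
    moreover have "k = (m - 1) + n" using Suc(2) 1 by simp
    ultimately obtain i j where "h = P ^ i * Q ^ j" using Suc(1) by blast
    then have "f = P ^ Suc i * Q ^ j" by (simp add: h mult.assoc)
    then show ?thesis by blast
  next
    case 2
    then have "comaximal f P" using irreducible_comaximal assms(1) comaximal_sym by blast
    moreover have "f dvd P * (P ^ (m - 1) * Q ^ n)" using Suc.prems 2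
      by (metis mult.assoc power_eq_if not_gr_zero)
    ultimately have "f dvd P ^ (m - 1) * Q ^ n" by (rule comaximal_dvd_mult)
    moreover have "k = (m - 1) + n" using Suc(2) 2 by simp
    ultimately show ?thesis using Suc by blast
  next
    case 3
    then obtain h where h: "f = Q * h" by (metis dvd_def)
    have "Q * h dvd Q * (Q ^ (n - 1))" using Suc.prems h 3
      by (metis mult_1 power_0 power_eq_if not_gr_zero)
    then have "h dvd P ^ 0 * Q ^ (n - 1)" using PQ0 by simp
    moreover have "Polynomial.lead_coeff h = 1" using Suc.prems(2) assms(4)
      by (simp add: h Polynomial.lead_coeff_mult)
    moreover have "k = 0 + (n - 1)" using Suc(2) 3 by simp
    ultimately obtain i j where "h = P ^ i * Q ^ j" using Suc(1) by blast
    then have "f = P ^ i * Q ^ Suc j" by (simp add: h ac_simps)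
    then show ?thesis by blast
  next
    case 4
    then have "comaximal f Q" using irreducible_comaximal assms(2) comaximal_sym by blast
    moreover have "f dvd Q * (P ^ 0 * Q ^ (n - 1))" using Suc.prems 4
      by (metis mult_1 power_0 power_eq_if not_gr_zero)
    ultimately have "f dvd P ^ 0 * Q ^ (n - 1)" by (rule comaximal_dvd_mult)
    moreover have "k = 0 + (n - 1)" using Suc(2) 4 by simp
    ultimately show ?thesis using Suc by blast
  qed
qed

section \<open>Polynomials in an endomorphism\<close>

locale endo = vector_space scale
  for scale :: "'a::field \<Rightarrow> 'b::ab_group_add \<Rightarrow> 'b" +
  fixes u :: "'b \<Rightarrow> 'b"
  assumes linear_u: "Vector_Spaces.linear scale scale u"
begin

sublocale u: Vector_Spaces.linear scale scale u
  by (rule linear_u)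

abbreviation act :: "'a poly \<Rightarrow> 'b \<Rightarrow> 'b" where
  "act f v \<equiv> poly_endo scale f u v"

lemma act_eq_sum:
  assumes "Polynomial.degree f \<le> n"
  shows "act f v = (\<Sum>i\<le>n. scale (Polynomial.coeff f i) ((u ^^ i) v))"
  unfolding poly_endo_def
  by (rule sum.mono_neutral_left) (use assms in \<open>auto simp: Polynomial.coeff_eq_0\<close>)

lemma act_0 [simp]: "act 0 v = 0"
  by (simp add: poly_endo_def)

lemma act_pCons [simp]: "act (pCons c f) v = scale c v + u (act f v)"
proof -
  have "act (pCons c f) v
      = (\<Sum>i\<le>Suc (Polynomial.degree f). scale (Polynomial.coeff (pCons c f) i) ((u ^^ i) v))"
    by (rule act_eq_sum) (rule degree_pCons_le)
  also have "\<dots> = scale c v + u (act f v)"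
    by (subst sum.atMost_Suc_shift) (simp add: poly_endo_def u.sum u.scale)
  finally show ?thesis .
qed

lemma act_1 [simp]: "act 1 v = v"
  by (simp add: one_pCons u.zero)

lemma act_add_left: "act (f + g) v = act f v + act g v"
proof -
  define n where "n = max (Polynomial.degree f) (Polynomial.degree g)"
  have "Polynomial.degree (f + g) \<le> n" by (simp add: n_def Polynomial.degree_add_le_max)
  then show ?thesis
    by (simp add: act_eq_sum[of _ n] n_def scale_left_distrib sum.distrib)
qed

lemma linear_act: "Vector_Spaces.linear scale scale (act f)"
  by (unfold_locales; induction f)
     (simp_all add: u.add u.scale u.zero scale_right_distrib mult.commute algebra_simps)

lemma act_add: "act f (v + w) = act f v + act f w"
  and act_scale: "act f (scale c v) = scale c (act f v)"
  and act_zero [simp]: "act f 0 = 0"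
  and act_diff: "act f (v - w) = act f v - act f w"
  and act_sum: "act f (sum h A) = (\<Sum>a\<in>A. act f (h a))"
proof -
  interpret l: Vector_Spaces.linear scale scale "act f" by (rule linear_act)
  show "act f (v + w) = act f v + act f w" by (rule l.add)
  show "act f (scale c v) = scale c (act f v)" by (rule l.scale)
  show "act f 0 = 0" by (rule l.zero)
  show "act f (v - w) = act f v - act f w" by (rule l.diff)
  show "act f (sum h A) = (\<Sum>a\<in>A. act f (h a))" by (rule l.sum)
qed

lemma act_smult: "act (Polynomial.smult c f) v = scale c (act f v)"
  by (induction f) (simp_all add: u.scale scale_right_distrib)

lemma act_uminus_left: "act (- f) v = - act f v"
  using act_smult[of "-1" f v] by simp

lemma act_diff_left: "act (f - g) v = act f v - act g v"
  using act_add_left[of f "- g" v] by (simp add: act_uminus_left)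

lemma act_mult: "act (f * g) v = act f (act g v)"
  by (induction f) (simp_all add: act_add_left act_smult)

lemma act_commute: "act f (act g v) = act g (act f v)"
  by (metis act_mult mult.commute)

lemma act_X: "act [:0, 1:] v = u v"
  by (simp add: u.zero)

lemma act_dvd: "f dvd g \<Longrightarrow> act f v = 0 \<Longrightarrow> act g v = 0"
  by (metis Rings.dvdE act_mult act_zero mult.commute)

text \<open>The Bezout identity applied to v. Comaximality is defined by such an identity so that it
  can be evaluated on vectors.\<close>

lemma act_comaximal:
  assumes "comaximal f g" "act f v = 0" "act g v = 0"
  shows "v = 0"
proof -
  from assms(1) obtain a b where "a * f + b * g = 1" by (auto simp: comaximal_def)
  then have "v = act (a * f + b * g) v" by simp
  then show ?thesis using assms by (simp add: act_add_left act_mult)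
qed

text \<open>A submodule for the action of the polynomials in u. Constant polynomials give the scalar
  multiples and the negatives, so every such set is also a subspace.\<close>

definition closed :: "'b set \<Rightarrow> bool" where
  "closed W \<longleftrightarrow> 0 \<in> W \<and> (\<forall>x\<in>W. \<forall>y\<in>W. x + y \<in> W) \<and> (\<forall>f. \<forall>x\<in>W. act f x \<in> W)"

lemma closed_zero: "closed W \<Longrightarrow> 0 \<in> W"
  and closed_add: "closed W \<Longrightarrow> x \<in> W \<Longrightarrow> y \<in> W \<Longrightarrow> x + y \<in> W"
  and closed_act: "closed W \<Longrightarrow> x \<in> W \<Longrightarrow> act f x \<in> W"
  by (auto simp: closed_def)

lemma closed_uminus: "closed W \<Longrightarrow> x \<in> W \<Longrightarrow> - x \<in> W"
  using closed_act[of W x "-1"] by (simp add: act_uminus_left)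

lemma closed_diff: "closed W \<Longrightarrow> x \<in> W \<Longrightarrow> y \<in> W \<Longrightarrow> x - y \<in> W"
  using closed_add[of W x "-y"] closed_uminus by simp

lemma closed_scale: "closed W \<Longrightarrow> x \<in> W \<Longrightarrow> scale c x \<in> W"
  using closed_act[of W x "[:c:]"] by (simp add: u.zero)

lemma closed_sum: "closed W \<Longrightarrow> (\<And>i. i \<in> I \<Longrightarrow> h i \<in> W) \<Longrightarrow> sum h I \<in> W"
  by (induction I rule: infinite_finite_induct) (auto simp: closed_zero closed_add)

lemma closed_subspace: "closed W \<Longrightarrow> subspace W"
  by (auto simp: subspace_def closed_zero closed_add closed_scale)

subsection \<open>Cyclic decompositions\<close>

text \<open>\<open>W\<close> is the internal direct sum of the \<open>F[u]\<close>-submodules generated by the \<open>v i\<close>, and the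
  annihilator of \<open>v i\<close> is generated by \<open>r i\<close>.\<close>

definition decomp :: "'i set \<Rightarrow> ('i \<Rightarrow> 'a poly) \<Rightarrow> ('i \<Rightarrow> 'b) \<Rightarrow> 'b set \<Rightarrow> bool" where
  "decomp I r v W \<longleftrightarrow> finite I \<and> W = range (\<lambda>f. \<Sum>i\<in>I. act (f i) (v i)) \<and>
     (\<forall>f. (\<Sum>i\<in>I. act (f i) (v i)) = 0 \<longleftrightarrow> (\<forall>i\<in>I. r i dvd f i))"

lemma decomp_finite: "decomp I r v W \<Longrightarrow> finite I"
  and decomp_zero_iff: "decomp I r v W \<Longrightarrow>
     (\<Sum>i\<in>I. act (f i) (v i)) = 0 \<longleftrightarrow> (\<forall>i\<in>I. r i dvd f i)"
  by (auto simp: decomp_def)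

lemma decompI:
  assumes "finite I" "\<And>f. (\<Sum>i\<in>I. act (f i) (v i)) \<in> W"
    "\<And>x. x \<in> W \<Longrightarrow> \<exists>f. x = (\<Sum>i\<in>I. act (f i) (v i))"
    "\<And>f i. (\<Sum>i\<in>I. act (f i) (v i)) = 0 \<Longrightarrow> i \<in> I \<Longrightarrow> r i dvd f i"
    "\<And>i. i \<in> I \<Longrightarrow> act (r i) (v i) = 0"
  shows "decomp I r v W"
  unfolding decomp_def
proof (intro conjI allI iffI)
  show "W = range (\<lambda>f. \<Sum>i\<in>I. act (f i) (v i))" using assms(2,3) by blast
  fix f assume "\<forall>i\<in>I. r i dvd f i"
  then have "\<And>i. i \<in> I \<Longrightarrow> act (f i) (v i) = 0" using assms(5) act_dvd by blast
  then show "(\<Sum>i\<in>I. act (f i) (v i)) = 0" by simp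
qed (use assms in auto)

lemma decomp_mem: "decomp I r v W \<Longrightarrow> (\<Sum>i\<in>I. act (f i) (v i)) \<in> W"
  by (auto simp: decomp_def)

lemma decomp_obtain:
  assumes "decomp I r v W" "x \<in> W"
  obtains f where "x = (\<Sum>i\<in>I. act (f i) (v i))"
  using assms by (auto simp: decomp_def)

lemma decomp_ann:
  assumes "decomp I r v W" "i \<in> I"
  shows "act f (v i) = 0 \<longleftrightarrow> r i dvd f"
proof -
  have "(\<Sum>j\<in>I. act ((if j = i then f else 0)) (v j)) = act f (v i)"
    using assms decomp_finite[OF assms(1)]
    by (subst sum.remove[of I i]) (auto intro!: sum.neutral)
  then show ?thesis using decomp_zero_iff[OF assms(1), of "\<lambda>j. if j = i then f else 0"] assms(2)
    by auto
qed

lemma decomp_gen: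
  assumes "decomp I r v W" "i \<in> I"
  shows "act f (v i) \<in> W"
proof -
  have "(\<Sum>j\<in>I. act ((if j = i then f else 0)) (v j)) = act f (v i)"
    using assms decomp_finite[OF assms(1)]
    by (subst sum.remove[of I i]) (auto intro!: sum.neutral)
  then show ?thesis using decomp_mem[OF assms(1)] by metis
qed

lemma decomp_closed:
  assumes "decomp I r v W" shows "closed W"
  unfolding closed_def
proof (intro conjI ballI allI)
  show "0 \<in> W" using decomp_mem[OF assms, of "\<lambda>_. 0"] by simp
  fix x assume "x \<in> W"
  then obtain f where f: "x = (\<Sum>i\<in>I. act (f i) (v i))" by (rule decomp_obtain[OF assms])
  { fix y assume "y \<in> W"
    then obtain g where g: "y = (\<Sum>i\<in>I. act (g i) (v i))" by (rule decomp_obtain[OF assms])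
    have "x + y = (\<Sum>i\<in>I. act (f i + g i) (v i))" by (simp add: f g act_add_left sum.distrib)
    then show "x + y \<in> W" using decomp_mem[OF assms] by metis }
  fix g
  have "act g x = (\<Sum>i\<in>I. act (g * f i) (v i))" by (simp add: f act_sum act_mult)
  then show "act g x \<in> W" using decomp_mem[OF assms] by metis
qed

lemma decomp_cong:
  assumes "decomp I r v W" "\<And>i. i \<in> I \<Longrightarrow> r i = r' i" "\<And>i. i \<in> I \<Longrightarrow> v i = v' i"
  shows "decomp I r' v' W"
  using assms unfolding decomp_def by (simp cong: sum.cong ball_cong)

lemma decomp_reindex:
  assumes "decomp I r v W" "bij_betw \<pi> J I"
  shows "decomp J (r \<circ> \<pi>) (v \<circ> \<pi>) W"
proof (rule decompI)
  show "finite J" using assms decomp_finite bij_betw_finite by blast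
  have *: "(\<Sum>j\<in>J. act (f j) ((v \<circ> \<pi>) j)) = (\<Sum>i\<in>I. act (f (the_inv_into J \<pi> i)) (v i))" for f
    by (rule sum.reindex_bij_witness[of _ "the_inv_into J \<pi>" \<pi>])
       (use assms(2) in \<open>auto simp: bij_betw_def the_inv_into_f_f the_inv_into_into f_the_inv_into_f\<close>)
  show "(\<Sum>j\<in>J. act (f j) ((v \<circ> \<pi>) j)) \<in> W" for f
    unfolding * by (rule decomp_mem[OF assms(1)])
  show "\<exists>f. x = (\<Sum>j\<in>J. act (f j) ((v \<circ> \<pi>) j))" if "x \<in> W" for x
  proof -
    obtain f where "x = (\<Sum>i\<in>I. act (f i) (v i))" by (rule decomp_obtain[OF assms(1) \<open>x \<in> W\<close>])
    also have "\<dots> = (\<Sum>j\<in>J. act ((f \<circ> \<pi>) j) ((v \<circ> \<pi>) j))"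
      using sum.reindex_bij_betw[OF assms(2), of "\<lambda>i. act (f i) (v i)"] by simp
    finally show ?thesis by blast
  qed
  show "(r \<circ> \<pi>) j dvd f j" if "(\<Sum>j\<in>J. act (f j) ((v \<circ> \<pi>) j)) = 0" "j \<in> J" for f j
  proof -
    have "\<forall>i\<in>I. r i dvd f (the_inv_into J \<pi> i)"
      using that(1) unfolding * by (simp add: decomp_zero_iff[OF assms(1)])
    moreover have "\<pi> j \<in> I" using assms(2) that(2) by (auto simp: bij_betw_def)
    ultimately have "r (\<pi> j) dvd f (the_inv_into J \<pi> (\<pi> j))" by blast
    then show ?thesis using assms(2) that(2)
      by (simp add: bij_betw_def the_inv_into_f_f)
  qed
  show "act ((r \<circ> \<pi>) j) ((v \<circ> \<pi>) j) = 0" if "j \<in> J" for j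
    using decomp_ann[OF assms(1), of "\<pi> j"] assms(2) that by (auto simp: bij_betw_def)
qed

lemma decomp_union:
  assumes I: "decomp I r v W1" and J: "decomp J r v W2" and "I \<inter> J = {}" "W1 \<inter> W2 = {0}"
  shows "decomp (I \<union> J) r v {x + y | x y. x \<in> W1 \<and> y \<in> W2}"
proof -
  have fin: "finite I" "finite J" using decomp_finite assms by auto
  note su = sum.union_disjoint[OF fin assms(3)]
  show ?thesis
  proof (rule decompI)
    show "finite (I \<union> J)" using fin by simp
    show "(\<Sum>i\<in>I \<union> J. act (f i) (v i)) \<in> {x + y | x y. x \<in> W1 \<and> y \<in> W2}" for f
      unfolding su using decomp_mem[OF I] decomp_mem[OF J] by blast
    show "\<exists>f. z = (\<Sum>i\<in>I \<union> J. act (f i) (v i))"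
      if "z \<in> {x + y | x y. x \<in> W1 \<and> y \<in> W2}" for z
    proof -
      from that obtain x y where xy: "z = x + y" "x \<in> W1" "y \<in> W2" by blast
      obtain f where f: "x = (\<Sum>i\<in>I. act (f i) (v i))" by (rule decomp_obtain[OF I xy(2)])
      obtain g where g: "y = (\<Sum>i\<in>J. act (g i) (v i))" by (rule decomp_obtain[OF J xy(3)])
      have "z = (\<Sum>i\<in>I \<union> J. act (if i \<in> I then f i else g i) (v i))"
        unfolding su xy f g using assms(3)
        by (intro arg_cong2[of _ _ _ _ "(+)"] sum.cong) auto
      then show ?thesis by (intro exI)
    qed
    show "r i dvd f i" if "(\<Sum>i\<in>I \<union> J. act (f i) (v i)) = 0" "i \<in> I \<union> J" for f i
    proof -
      let ?a = "\<Sum>i\<in>I. act (f i) (v i)" and ?b = "\<Sum>i\<in>J. act (f i) (v i)"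
      have ab: "?a + ?b = 0" using that(1) unfolding su .
      have "?a \<in> W1" "?b \<in> W2" by (rule decomp_mem[OF I], rule decomp_mem[OF J])
      moreover have "?a = - ?b" using ab by (simp add: eq_neg_iff_add_eq_0)
      ultimately have "?a \<in> W1 \<inter> W2" using closed_uminus[OF decomp_closed[OF J]] by simp
      then have "?a = 0" "?b = 0" using assms(4) ab by auto
      then show ?thesis using that(2) decomp_zero_iff[OF I] decomp_zero_iff[OF J] by auto
    qed
    show "act (r i) (v i) = 0" if "i \<in> I \<union> J" for i
      using that decomp_ann[OF I] decomp_ann[OF J] by auto
  qed
qed

text \<open>A generator 0 with annihilator 1 contributes nothing. Such padding gives index sets
  their uniform shape: a product with the two truth values, or an even number of invariant
  factors.\<close>

lemma decomp_extend_trivial: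
  assumes "decomp I r v W" "finite J" "I \<subseteq> J" "\<And>i. i \<in> J - I \<Longrightarrow> r i = 1 \<and> v i = 0"
  shows "decomp J r v W"
proof -
  have "(\<Sum>i\<in>J. act (f i) (v i)) = (\<Sum>i\<in>I. act (f i) (v i))" for f
    by (rule sum.mono_neutral_right) (use assms in auto)
  moreover have "(\<forall>i\<in>J. r i dvd f i) \<longleftrightarrow> (\<forall>i\<in>I. r i dvd f i)" for f
    using assms(3,4) by force
  ultimately show ?thesis using assms(1,2) by (simp add: decomp_def)
qed

lemma sum_Times_bool: "finite I \<Longrightarrow> (\<Sum>p\<in>I \<times> (UNIV :: bool set). h p) = (\<Sum>i\<in>I. h (i, False) + h (i, True))"
  using sum.cartesian_product[of "\<lambda>i b. h (i, b)" UNIV I] by (simp add: UNIV_bool add.commute)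

text \<open>Chinese remainder theorem on each summand: if v has annihilator f g, then g v has
  annihilator f, f v has annihilator g, and together they generate the same module as v. The index
  \<open>False\<close> carries the f-part, \<open>True\<close> the g-part.\<close>

lemma decomp_split:
  assumes d: "decomp I (\<lambda>i. f i * g i) v W" and c: "\<And>i. i \<in> I \<Longrightarrow> comaximal (f i) (g i)"
  shows "decomp (I \<times> UNIV) (\<lambda>(i, b). if b then g i else f i)
           (\<lambda>(i, b). act (if b then f i else g i) (v i)) W"
proof -
  have fin: "finite I" using decomp_finite d .
  have eq: "(\<Sum>p\<in>I \<times> UNIV. act (h p) (case p of (i, b) \<Rightarrow> act (if b then f i else g i) (v i)))
      = (\<Sum>i\<in>I. act (h (i, False) * g i + h (i, True) * f i) (v i))" for h
    by (simp add: sum_Times_bool[OF fin] act_add_left act_mult)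
  show ?thesis
  proof (rule decompI)
    show "finite (I \<times> (UNIV :: bool set))" using fin by simp
    show "(\<Sum>p\<in>I \<times> UNIV. act (h p) (case p of (i, b) \<Rightarrow> act (if b then f i else g i) (v i))) \<in> W" for h
      unfolding eq by (rule decomp_mem[OF d])
    show "\<exists>h. x = (\<Sum>p\<in>I \<times> UNIV. act (h p) (case p of (i, b) \<Rightarrow> act (if b then f i else g i) (v i)))"
      if "x \<in> W" for x
    proof -
      obtain k where k: "x = (\<Sum>i\<in>I. act (k i) (v i))" by (rule decomp_obtain[OF d \<open>x \<in> W\<close>])
      have "\<forall>i\<in>I. \<exists>p. fst p * f i + snd p * g i = 1"
        using c by (fastforce simp: comaximal_def)
      then obtain p where p: "\<And>i. i \<in> I \<Longrightarrow> fst (p i) * f i + snd (p i) * g i = 1" by metis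
      \<comment> \<open>From 1 = a f + b g, the coefficient k of v becomes k b on the generator g v
        and k a on the generator f v.\<close>
      define h where "h = (\<lambda>(i, b). k i * (if b then fst (p i) else snd (p i)))"
      have "h (i, False) * g i + h (i, True) * f i = k i" if "i \<in> I" for i
      proof -
        have "h (i, False) * g i + h (i, True) * f i = k i * (fst (p i) * f i + snd (p i) * g i)"
          by (simp add: h_def algebra_simps)
        then show ?thesis using p[OF that] by simp
      qed
      then have "x = (\<Sum>i\<in>I. act (h (i, False) * g i + h (i, True) * f i) (v i))"
        unfolding k by (intro sum.cong) simp_all
      then show ?thesis unfolding eq by blast
    qed
    show "(case p of (i, b) \<Rightarrow> if b then g i else f i) dvd h p"
      if "(\<Sum>p\<in>I \<times> UNIV. act (h p) (case p of (i, b) \<Rightarrow> act (if b then f i else g i) (v i))) = 0"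
        "p \<in> I \<times> UNIV" for h p
    proof -
      from that(2) obtain i b where p: "p = (i, b)" "i \<in> I" by auto
      have *: "f i * g i dvd h (i, False) * g i + h (i, True) * f i"
        using that(1) p(2) unfolding eq by (simp add: decomp_zero_iff[OF d])
      have "f i dvd h (i, False) * g i + h (i, True) * f i" using * dvd_mult_left by blast
      then have "f i dvd g i * h (i, False)"
        by (metis dvd_add_left_iff dvd_triv_right mult.commute)
      then have 1: "f i dvd h (i, False)" by (rule comaximal_dvd_mult[OF c[OF p(2)]])
      have "g i dvd h (i, False) * g i + h (i, True) * f i" using * dvd_mult_right by blast
      then have "g i dvd f i * h (i, True)"
        by (metis dvd_add_right_iff dvd_triv_right mult.commute)
      then have 2: "g i dvd h (i, True)" by (rule comaximal_dvd_mult[OF comaximal_sym[OF c[OF p(2)]]])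
      show ?thesis using 1 2 by (cases b) (simp_all add: p)
    qed
    show "act (case p of (i, b) \<Rightarrow> if b then g i else f i)
            (case p of (i, b) \<Rightarrow> act (if b then f i else g i) (v i)) = 0"
      if "p \<in> I \<times> UNIV" for p
      using that decomp_ann[OF d]
      by (auto simp: act_mult[symmetric] mult.commute split: prod.splits)
  qed
qed

text \<open>The sum of two generators with comaximal annihilators generates both summands, because
  one polynomial can have prescribed residues modulo f and modulo g. Invariant factors are assembled
  from their primary parts in this way.\<close>

lemma decomp_merge:
  assumes d: "decomp (I \<times> UNIV) (\<lambda>(i, b). if b then g i else f i) v W"
    and c: "\<And>i. i \<in> I \<Longrightarrow> comaximal (f i) (g i)"
  shows "decomp I (\<lambda>i. f i * g i) (\<lambda>i. v (i, False) + v (i, True)) W"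
proof -
  have fin: "finite I" using decomp_finite[OF d] by (auto dest: finite_cartesian_productD1)
  have eq: "(\<Sum>i\<in>I. act (h i) (v (i, False) + v (i, True))) = (\<Sum>p\<in>I \<times> UNIV. act (h (fst p)) (v p))" for h
    by (simp add: sum_Times_bool[OF fin] act_add)
  have ann: "act k (v (i, False)) = 0 \<longleftrightarrow> f i dvd k" "act k (v (i, True)) = 0 \<longleftrightarrow> g i dvd k"
    if "i \<in> I" for k i
    using decomp_ann[OF d, of "(i, False)"] decomp_ann[OF d, of "(i, True)"] that by auto
  show ?thesis
  proof (rule decompI)
    show "finite I" by (rule fin)
    show "(\<Sum>i\<in>I. act (h i) (v (i, False) + v (i, True))) \<in> W" for h
      unfolding eq by (rule decomp_mem[OF d])
    show "\<exists>h. x = (\<Sum>i\<in>I. act (h i) (v (i, False) + v (i, True)))" if "x \<in> W" for x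
    proof -
      obtain k where k: "x = (\<Sum>p\<in>I \<times> UNIV. act (k p) (v p))" by (rule decomp_obtain[OF d \<open>x \<in> W\<close>])
      have "\<forall>i\<in>I. \<exists>h. f i dvd h - k (i, False) \<and> g i dvd h - k (i, True)"
      proof
        fix i assume "i \<in> I"
        then obtain a b where ab: "a * f i + b * g i = 1" using c by (fastforce simp: comaximal_def)
        \<comment> \<open>b g is 1 modulo f and 0 modulo g, and a f is the other way round; so h has
          the prescribed residue modulo each.\<close>
        define h where "h = k (i, False) * (b * g i) + k (i, True) * (a * f i)"
        have "h - k (i, False) * (a * f i + b * g i) = f i * (a * (k (i, True) - k (i, False)))"
          "h - k (i, True) * (a * f i + b * g i) = g i * (b * (k (i, False) - k (i, True)))"
          by (simp_all add: h_def algebra_simps)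
        then show "\<exists>h. f i dvd h - k (i, False) \<and> g i dvd h - k (i, True)"
          unfolding ab by (metis dvd_triv_left mult.right_neutral)
      qed
      then obtain h where h: "\<And>i. i \<in> I \<Longrightarrow> f i dvd h i - k (i, False)"
        "\<And>i. i \<in> I \<Longrightarrow> g i dvd h i - k (i, True)" by metis
      have "act (h i) (v (i, False)) = act (k (i, False)) (v (i, False))"
        "act (h i) (v (i, True)) = act (k (i, True)) (v (i, True))" if "i \<in> I" for i
        using ann(1)[OF that, of "h i - k (i, False)"] ann(2)[OF that, of "h i - k (i, True)"] h[OF that]
        by (simp_all add: act_diff_left)
      then have "x = (\<Sum>i\<in>I. act (h i) (v (i, False) + v (i, True)))"
        unfolding k sum_Times_bool[OF fin] by (intro sum.cong) (simp_all add: act_add)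
      then show ?thesis by blast
    qed
    show "f i * g i dvd h i" if "(\<Sum>i\<in>I. act (h i) (v (i, False) + v (i, True))) = 0" "i \<in> I" for h i
    proof -
      have "\<forall>p\<in>I \<times> UNIV. (case p of (i, b) \<Rightarrow> if b then g i else f i) dvd h (fst p)"
        using that(1) unfolding eq by (simp only: decomp_zero_iff[OF d])
      from bspec[OF this, of "(i, False)"] bspec[OF this, of "(i, True)"]
      have "f i dvd h i" "g i dvd h i" using that(2) by auto
      then show ?thesis using c[OF that(2)] by (intro comaximal_mult_dvd)
    qed
    show "act (f i * g i) (v (i, False) + v (i, True)) = 0" if "i \<in> I" for i
      using ann[OF that, of "f i * g i"] by (simp add: act_add)
  qed
qed

end

subsection \<open>Block companion matrices\<close>

context endo
begin

definition comb :: "(nat \<Rightarrow> 'a) \<Rightarrow> 'b list \<Rightarrow> 'b" where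
  "comb c bs = (\<Sum>i<length bs. scale (c i) (bs ! i))"

text \<open>A basis indexed by list positions instead of by the set of its vectors: distinctness is
  then part of independence, and concatenation of lists matches direct sums.\<close>

definition basis_list :: "'b set \<Rightarrow> 'b list \<Rightarrow> bool" where
  "basis_list W bs \<longleftrightarrow> (\<forall>c. comb c bs = 0 \<longrightarrow> (\<forall>i<length bs. c i = 0)) \<and> W = range (\<lambda>c. comb c bs)"

lemma comb_eq_sum_set:
  assumes "distinct bs"
  shows "comb (\<lambda>i. h (bs ! i)) bs = (\<Sum>b\<in>set bs. scale (h b) b)"
  unfolding comb_def
  using sum.reindex_bij_betw[OF bij_betw_nth[OF assms refl refl], of "\<lambda>b. scale (h b) b"] .

lemma comb_set_ex:
  assumes "distinct bs"
  shows "\<exists>h. (\<forall>i<length bs. h (bs ! i) = c i) \<and> comb c bs = (\<Sum>b\<in>set bs. scale (h b) b)"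
proof -
  define h where "h b = c (the_inv_into {..<length bs} ((!) bs) b)" for b
  have h: "h (bs ! i) = c i" if "i < length bs" for i
    using that assms by (simp add: h_def the_inv_into_f_f inj_on_nth)
  then have "comb c bs = comb (\<lambda>i. h (bs ! i)) bs"
    by (simp add: comb_def)
  then show ?thesis using h comb_eq_sum_set[OF assms] by metis
qed

lemma comb_diff: "comb (\<lambda>i. c i - d i) bs = comb c bs - comb d bs"
  by (simp add: comb_def scale_left_diff_distrib sum_subtractf)

lemma comb_single: "i < length bs \<Longrightarrow> comb (\<lambda>j. if j = i then k else 0) bs = scale k (bs ! i)"
  unfolding comb_def by (subst sum.remove[of _ i]) (auto intro!: sum.neutral)

lemma ordered_basis_iff_basis_list: "ordered_basis scale W bs \<longleftrightarrow> basis_list W bs"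
proof
  assume "ordered_basis scale W bs"
  then have d: "distinct bs" and i: "\<not> dependent (set bs)" and s: "span (set bs) = W"
    by (auto simp: ordered_basis_def)
  show "basis_list W bs"
    unfolding basis_list_def
  proof (intro conjI allI impI)
    fix c i assume c: "comb c bs = 0" "i < length bs"
    obtain h where h: "\<forall>i<length bs. h (bs ! i) = c i" "comb c bs = (\<Sum>b\<in>set bs. scale (h b) b)"
      using comb_set_ex[OF d] by blast
    then have "(\<Sum>b\<in>set bs. scale (h b) b) = 0" using c by simp
    then have "\<forall>b\<in>set bs. h b = 0" using i unfolding dependent_finite[OF finite_set] by blast
    then show "c i = 0" using h c by simp
  next
    have "range (\<lambda>c. comb c bs) = range (\<lambda>h. \<Sum>b\<in>set bs. scale (h b) b)"
      using comb_set_ex[OF d] comb_eq_sum_set[OF d, symmetric] by (auto simp: image_iff) metis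
    then show "W = range (\<lambda>c. comb c bs)" using s by (simp add: span_finite)
  qed
next
  assume b: "basis_list W bs"
  have d: "distinct bs"
    unfolding distinct_conv_nth
  proof (intro allI impI notI)
    fix i j assume ij: "i < length bs" "j < length bs" "i \<noteq> j" "bs ! i = bs ! j"
    \<comment> \<open>A vector occurring at two positions i and j would satisfy the nontrivial
      relation with coefficient 1 at i and -1 at j.\<close>
    have "comb (\<lambda>k. (if k = i then 1 else 0) - (if k = j then 1 else 0)) bs = 0"
      using ij by (simp add: comb_diff comb_single)
    then have "\<forall>k<length bs. (if k = i then 1 else 0) - (if k = j then 1 else (0::'a)) = 0"
      using b unfolding basis_list_def by blast
    then show False using ij by auto
  qed
  have "h (bs ! i) = 0" if "(\<Sum>b\<in>set bs. scale (h b) b) = 0" "i < length bs" for h i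
    using b that unfolding comb_eq_sum_set[OF d, symmetric] basis_list_def by blast
  then have i: "\<not> dependent (set bs)"
    by (auto simp: dependent_finite in_set_conv_nth)
  have "range (\<lambda>c. comb c bs) = range (\<lambda>h. \<Sum>b\<in>set bs. scale (h b) b)"
    using comb_set_ex[OF d] comb_eq_sum_set[OF d, symmetric] by (auto simp: image_iff) metis
  then have "span (set bs) = W" using b by (simp add: span_finite basis_list_def)
  then show "ordered_basis scale W bs" using d i by (simp add: ordered_basis_def)
qed

lemma represented_by_iff:
  "represented_by scale W u A \<longleftrightarrow> (\<exists>bs. basis_list W bs \<and>
     A \<in> carrier_mat (length bs) (length bs) \<and>
     (\<forall>j<length bs. u (bs ! j) = comb (\<lambda>i. A $$ (i, j)) bs))"
  by (simp add: represented_by_def ordered_basis_iff_basis_list comb_def)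

lemma comb_append: "comb c (bs @ cs) = comb c bs + comb (\<lambda>i. c (length bs + i)) cs"
proof -
  have "{..<length bs + length cs} = {..<length bs} \<union> (\<lambda>i. length bs + i) ` {..<length cs}"
  proof (intro equalityI subsetI)
    fix x assume "x \<in> {..<length bs + length cs}"
    then have "x < length bs \<or> (x = length bs + (x - length bs) \<and> x - length bs < length cs)" by auto
    then show "x \<in> {..<length bs} \<union> (\<lambda>i. length bs + i) ` {..<length cs}" by blast
  qed auto
  then have "comb c (bs @ cs) = (\<Sum>i<length bs. scale (c i) ((bs @ cs) ! i))
      + (\<Sum>i\<in>(\<lambda>i. length bs + i) ` {..<length cs}. scale (c i) ((bs @ cs) ! i))"
    unfolding comb_def by (subst sum.union_disjoint[symmetric]) auto
  also have "(\<Sum>i\<in>(\<lambda>i. length bs + i) ` {..<length cs}. scale (c i) ((bs @ cs) ! i))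
      = comb (\<lambda>i. c (length bs + i)) cs"
    by (subst sum.reindex) (auto simp: comb_def)
  finally show ?thesis by (simp add: comb_def nth_append)
qed

lemma comb_cong: "(\<And>i. i < length bs \<Longrightarrow> c i = d i) \<Longrightarrow> comb c bs = comb d bs"
  by (simp add: comb_def)

lemma comb_0 [simp]: "comb (\<lambda>_. 0) bs = 0"
  by (simp add: comb_def)

lemma comb_append_left: "comb (\<lambda>i. if i < length bs then c i else 0) (bs @ cs) = comb c bs"
  by (simp add: comb_append cong: comb_cong)

lemma comb_append_right: "comb (\<lambda>i. if i < length bs then 0 else c (i - length bs)) (bs @ cs) = comb c cs"
  by (simp add: comb_append cong: comb_cong)

lemma basis_list_append:
  "basis_list W (bs @ cs) \<longleftrightarrow> (\<exists>W1 W2. basis_list W1 bs \<and> basis_list W2 cs \<and>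
     W1 \<inter> W2 = {0} \<and> W = {x + y | x y. x \<in> W1 \<and> y \<in> W2})"
proof
  assume b: "basis_list W (bs @ cs)"
  define W1 W2 where "W1 = range (\<lambda>c. comb c bs)" and "W2 = range (\<lambda>c. comb c cs)"
  have ind: "c i = 0" if "comb c (bs @ cs) = 0" "i < length bs + length cs" for c i
    using b that by (simp add: basis_list_def)
  have 1: "basis_list W1 bs"
    unfolding basis_list_def
  proof (intro conjI allI impI)
    fix c i assume "comb c bs = 0" "i < length bs"
    then show "c i = 0" using ind[of "\<lambda>i. if i < length bs then c i else 0" i]
      by (simp add: comb_append_left)
  qed (simp add: W1_def)
  have 2: "basis_list W2 cs"
    unfolding basis_list_def
  proof (intro conjI allI impI)
    fix c i assume "comb c cs = 0" "i < length cs"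
    then show "c i = 0"
      using ind[of "\<lambda>i. if i < length bs then 0 else c (i - length bs)" "length bs + i"]
      by (simp add: comb_append_right)
  qed (simp add: W2_def)
  have 3: "W1 \<inter> W2 = {0}"
  proof
    show "W1 \<inter> W2 \<subseteq> {0}"
    proof
      fix x assume "x \<in> W1 \<inter> W2"
      then obtain c d where cd: "x = comb c bs" "x = comb d cs" unfolding W1_def W2_def by blast
      \<comment> \<open>A vector common to both spans is a relation of the whole list, with
        coefficients c on the first part and - d on the second.\<close>
      have "comb (\<lambda>i. (if i < length bs then c i else 0)
            - (if i < length bs then 0 else d (i - length bs))) (bs @ cs) = 0"
        using cd unfolding comb_diff comb_append_left comb_append_right by simp
      note k = ind[OF this]
      have "c i = 0" if "i < length bs" for i
        using k[of i] that by simp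
      then show "x \<in> {0}" using cd by (simp cong: comb_cong)
    qed
    show "{0} \<subseteq> W1 \<inter> W2"
      unfolding W1_def W2_def by (auto intro!: image_eqI[of _ _ "\<lambda>_. 0"])
  qed
  have 4: "W = {x + y | x y. x \<in> W1 \<and> y \<in> W2}"
  proof
    show "W \<subseteq> {x + y | x y. x \<in> W1 \<and> y \<in> W2}"
      using b by (auto simp: basis_list_def W1_def W2_def comb_append)
    show "{x + y | x y. x \<in> W1 \<and> y \<in> W2} \<subseteq> W"
    proof
      fix z assume "z \<in> {x + y | x y. x \<in> W1 \<and> y \<in> W2}"
      then obtain c d where z: "z = comb c bs + comb d cs" by (auto simp: W1_def W2_def)
      have "z = comb (\<lambda>i. if i < length bs then c i else d (i - length bs)) (bs @ cs)"
        by (simp add: z comb_append cong: comb_cong)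
      then show "z \<in> W" using b by (simp add: basis_list_def)
    qed
  qed
  show "\<exists>W1 W2. basis_list W1 bs \<and> basis_list W2 cs \<and>
     W1 \<inter> W2 = {0} \<and> W = {x + y | x y. x \<in> W1 \<and> y \<in> W2}"
    using 1 2 3 4 by blast
next
  assume "\<exists>W1 W2. basis_list W1 bs \<and> basis_list W2 cs \<and>
     W1 \<inter> W2 = {0} \<and> W = {x + y | x y. x \<in> W1 \<and> y \<in> W2}"
  then obtain W1 W2 where b1: "basis_list W1 bs" and b2: "basis_list W2 cs"
    and i: "W1 \<inter> W2 = {0}" and W: "W = {x + y | x y. x \<in> W1 \<and> y \<in> W2}" by blast
  show "basis_list W (bs @ cs)"
    unfolding basis_list_def
  proof (intro conjI allI impI)
    fix c k assume c: "comb c (bs @ cs) = 0" and k: "k < length (bs @ cs)"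
    let ?c = "\<lambda>i. c (length bs + i)"
    have e: "comb c bs + comb ?c cs = 0" using c by (simp add: comb_append)
    have "comb c bs = comb (\<lambda>i. 0 - ?c i) cs"
      using e unfolding comb_diff by (simp add: eq_neg_iff_add_eq_0)
    then have "comb c bs \<in> W2" using b2 by (simp add: basis_list_def)
    moreover have "comb c bs \<in> W1" using b1 by (simp add: basis_list_def)
    ultimately have "comb c bs \<in> W1 \<inter> W2" by simp
    then have "comb c bs = 0" "comb ?c cs = 0" using i e by auto
    then have "\<forall>k<length bs. c k = 0" "\<forall>k<length cs. ?c k = 0"
      using b1 b2 unfolding basis_list_def by blast+
    then show "c k = 0" using k
      by (metis add_diff_inverse_nat add_less_cancel_left length_append)
  next
    show "W = range (\<lambda>c. comb c (bs @ cs))"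
    proof
      show "range (\<lambda>c. comb c (bs @ cs)) \<subseteq> W"
        using b1 b2 by (auto simp: basis_list_def W comb_append)
      show "W \<subseteq> range (\<lambda>c. comb c (bs @ cs))"
      proof
        fix z assume "z \<in> W"
        then obtain c d where z: "z = comb c bs + comb d cs"
          using b1 b2 by (auto simp: W basis_list_def)
        have "z = comb (\<lambda>i. if i < length bs then c i else d (i - length bs)) (bs @ cs)"
          by (simp add: z comb_append cong: comb_cong)
        then show "z \<in> range (\<lambda>c. comb c (bs @ cs))" by blast
      qed
    qed
  qed
qed

text \<open>The zero blocks say that u maps each basis vector into the span of its own part of the
  basis. Cutting the basis after n vectors therefore splits W, and the invariance of the two parts
  is contained in their being represented by A and B.\<close>

lemma represented_by_four_block:
  assumes A: "A \<in> carrier_mat n n" and B: "B \<in> carrier_mat m m"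
  shows "represented_by scale W u (four_block_mat A (0\<^sub>m n m) (0\<^sub>m m n) B) \<longleftrightarrow>
    (\<exists>W1 W2. represented_by scale W1 u A \<and> represented_by scale W2 u B \<and>
     W1 \<inter> W2 = {0} \<and> W = {x + y | x y. x \<in> W1 \<and> y \<in> W2})" (is "?l \<longleftrightarrow> ?r")
proof -
  let ?M = "four_block_mat A (0\<^sub>m n m) (0\<^sub>m m n) B"
  have M: "?M \<in> carrier_mat (n + m) (n + m)" using A B by simp
  have cb: "comb (\<lambda>i. ?M $$ (i, j)) (bs @ cs) =
      (if j < n then comb (\<lambda>i. A $$ (i, j)) bs else comb (\<lambda>i. B $$ (i, j - n)) cs)"
    if "length bs = n" "length cs = m" "j < n + m" for bs cs j
    using that A B by (auto simp: comb_append cong: comb_cong)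
  show ?thesis
  proof
    assume ?l
    then obtain bs where bs: "basis_list W bs" "?M \<in> carrier_mat (length bs) (length bs)"
      "\<forall>j<length bs. u (bs ! j) = comb (\<lambda>i. ?M $$ (i, j)) bs"
      unfolding represented_by_iff by blast
    have l: "length bs = n + m" using bs(2) M by (metis carrier_matD(1))
    define b1 b2 where "b1 = take n bs" and "b2 = drop n bs"
    have b12: "bs = b1 @ b2" "length b1 = n" "length b2 = m" by (simp_all add: b1_def b2_def l)
    obtain W1 W2 where W: "basis_list W1 b1" "basis_list W2 b2" "W1 \<inter> W2 = {0}"
      "W = {x + y | x y. x \<in> W1 \<and> y \<in> W2}"
      using bs(1) unfolding b12(1) basis_list_append by blast
    have "u (b1 ! j) = comb (\<lambda>i. A $$ (i, j)) b1" if "j < n" for j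
      using bs(3)[unfolded l, rule_format, of j] cb[OF b12(2,3), of j] that b12
      by (simp add: nth_append)
    moreover have "u (b2 ! j) = comb (\<lambda>i. B $$ (i, j)) b2" if "j < m" for j
      using bs(3)[unfolded l, rule_format, of "n + j"] cb[OF b12(2,3), of "n + j"] that b12
      by (simp add: nth_append)
    ultimately show ?r
      using W A B b12 unfolding represented_by_iff by blast
  next
    assume ?r
    then obtain W1 W2 b1 b2 where W: "basis_list W1 b1" "basis_list W2 b2" "W1 \<inter> W2 = {0}"
      "W = {x + y | x y. x \<in> W1 \<and> y \<in> W2}"
      and A': "A \<in> carrier_mat (length b1) (length b1)" and B': "B \<in> carrier_mat (length b2) (length b2)"
      and 1: "\<forall>j<length b1. u (b1 ! j) = comb (\<lambda>i. A $$ (i, j)) b1"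
      and 2: "\<forall>j<length b2. u (b2 ! j) = comb (\<lambda>i. B $$ (i, j)) b2"
      unfolding represented_by_iff by blast
    have l: "length b1 = n" "length b2 = m" using A A' B B' by auto
    have "basis_list W (b1 @ b2)" using W basis_list_append by blast
    moreover have "u ((b1 @ b2) ! j) = comb (\<lambda>i. ?M $$ (i, j)) (b1 @ b2)" if "j < n + m" for j
      unfolding cb[OF l that] using 1 2 that l by (simp add: nth_append)
    ultimately show ?l
      unfolding represented_by_iff using M l by (intro exI[of _ "b1 @ b2"]) simp
  qed
qed

end

section \<open>Companion matrices and cyclic submodules\<close>

context endo
begin

lemma act_eq_sum_less:
  assumes "\<And>i. i \<ge> n \<Longrightarrow> Polynomial.coeff f i = 0"
  shows "act f v = (\<Sum>i<n. scale (Polynomial.coeff f i) ((u ^^ i) v))"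
proof -
  have "act f v = (\<Sum>i\<le>max n (Polynomial.degree f). scale (Polynomial.coeff f i) ((u ^^ i) v))"
    by (rule act_eq_sum) simp
  also have "\<dots> = (\<Sum>i<n. scale (Polynomial.coeff f i) ((u ^^ i) v))"
    by (rule sum.mono_neutral_right) (auto simp: assms)
  finally show ?thesis .
qed

text \<open>Coordinates with respect to v, u v, u^2 v, ... are the coefficients of a polynomial
  acting on v, so relations between iterates become annihilating polynomials.\<close>

lemma comb_iterates:
  "comb c (map (\<lambda>j. (u ^^ j) v) [0..<n]) = act (Poly (map c [0..<n])) v"
proof -
  have "act (Poly (map c [0..<n])) v
      = (\<Sum>i<n. scale (Polynomial.coeff (Poly (map c [0..<n])) i) ((u ^^ i) v))"
    by (rule act_eq_sum_less) (simp add: nth_default_def)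
  also have "\<dots> = comb c (map (\<lambda>j. (u ^^ j) v) [0..<n])"
    by (simp add: comb_def nth_default_def)
  finally show ?thesis ..
qed

lemma act_monic:
  assumes "Polynomial.lead_coeff r = 1"
  shows "act r v = (\<Sum>i<Polynomial.degree r. scale (Polynomial.coeff r i) ((u ^^ i) v))
     + (u ^^ Polynomial.degree r) v"
  using assms by (simp add: poly_endo_def lessThan_Suc_atMost[symmetric])

lemma act_mod:
  assumes "act r v = 0" shows "act (f mod r) v = act f v"
proof -
  have "act f v = act (r * (f div r) + f mod r) v" by simp
  also have "\<dots> = act (f mod r) v"
    unfolding act_add_left by (simp add: act_mult act_commute[of r] assms)
  finally show ?thesis ..
qed

lemma coeff_mod_eq_0:
  fixes f r :: "'a poly"
  assumes "r \<noteq> 0" "i \<ge> Polynomial.degree r" shows "Polynomial.coeff (f mod r) i = 0"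
  using assms degree_mod_less[OF assms(1), of f] by (auto intro: Polynomial.coeff_eq_0)

lemma companion_entry:
  "j < Polynomial.degree r \<Longrightarrow> i < Polynomial.degree r \<Longrightarrow>
   companion r $$ (i, j) = (if j = Polynomial.degree r - 1 then - Polynomial.coeff r i
                        else if i = j + 1 then 1 else 0)"
  by (simp add: companion_def Let_def)

lemma companion_carrier [simp]:
  "companion r \<in> carrier_mat (Polynomial.degree r) (Polynomial.degree r)"
  by (simp add: companion_def Let_def)

text \<open>The basis is v, u v, ..., u^(n-1) v with n the degree of r. It is independent because a
  nonzero polynomial of degree less than n is no multiple of r, and it spans by division with
  remainder. The last column of the matrix is the relation r(u) v = 0 solved for u^n v.\<close>

lemma represented_by_companion:
  assumes r: "Polynomial.lead_coeff r = 1"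
  shows "represented_by scale W u (companion r) \<longleftrightarrow>
    (\<exists>v. W = range (\<lambda>f. act f v) \<and> (\<forall>f. act f v = 0 \<longleftrightarrow> r dvd f))" (is "?l \<longleftrightarrow> ?r")
proof
  let ?n = "Polynomial.degree r"
  have r0: "r \<noteq> 0" using r by auto
  { assume ?r
    then obtain v where W: "W = range (\<lambda>f. act f v)" and ann: "\<And>f. act f v = 0 \<longleftrightarrow> r dvd f" by blast
    define bs where "bs = map (\<lambda>j. (u ^^ j) v) [0..<?n]"
    have bs: "length bs = ?n" "\<And>j. j < ?n \<Longrightarrow> bs ! j = (u ^^ j) v" by (simp_all add: bs_def)
    have "basis_list W bs"
      unfolding basis_list_def
    proof (intro conjI allI impI)
      fix c i assume "comb c bs = 0" and i: "i < length bs"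
      define g where "g = Poly (map c [0..<?n])"
      have "r dvd g" using \<open>comb c bs = 0\<close> by (simp add: bs_def comb_iterates ann g_def)
      moreover have "g = 0 \<or> Polynomial.degree g < ?n"
      proof (rule disjCI)
        assume "\<not> Polynomial.degree g < ?n"
        then have "Polynomial.lead_coeff g = 0" by (simp add: g_def nth_default_def)
        then show "g = 0" by simp
      qed
      ultimately have "g = 0" using dvd_imp_degree_le by force
      then have "Polynomial.coeff g i = 0" by simp
      then show "c i = 0" using i by (simp add: g_def bs nth_default_def)
    next
      show "W = range (\<lambda>c. comb c bs)"
      proof
        show "range (\<lambda>c. comb c bs) \<subseteq> W" by (auto simp: bs_def comb_iterates W)
        show "W \<subseteq> range (\<lambda>c. comb c bs)"
        proof
          fix x assume "x \<in> W"
          then obtain f where x: "x = act f v" by (auto simp: W)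
          have "act r v = 0" using ann by simp
          then have "x = act (f mod r) v" by (simp add: x act_mod)
          also have "\<dots> = comb (Polynomial.coeff (f mod r)) bs"
            by (subst act_eq_sum_less[of ?n]) (auto simp: comb_def bs coeff_mod_eq_0 r0)
          finally show "x \<in> range (\<lambda>c. comb c bs)" by blast
        qed
      qed
    qed
    moreover have "u (bs ! j) = comb (\<lambda>i. companion r $$ (i, j)) bs" if "j < ?n" for j
    proof (cases "j = ?n - 1")
      case True
      have "act r v = 0" using ann by simp
      then have "(u ^^ ?n) v = - (\<Sum>i<?n. scale (Polynomial.coeff r i) ((u ^^ i) v))"
        unfolding act_monic[OF r] by (simp add: eq_neg_iff_add_eq_0 add.commute)
      also have "\<dots> = comb (\<lambda>i. companion r $$ (i, j)) bs"
        using that True by (simp add: comb_def bs companion_entry sum_negf)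
      finally have "(u ^^ ?n) v = comb (\<lambda>i. companion r $$ (i, j)) bs" .
      moreover have "(u ^^ Suc j) v = u (bs ! j)" using bs(2)[OF that] by simp
      moreover have "Suc j = ?n" using that True by simp
      ultimately show ?thesis by (simp only:)
    next
      case False
      then have j: "Suc j < ?n" using that by simp
      have "comb (\<lambda>i. companion r $$ (i, j)) bs = comb (\<lambda>i. if i = Suc j then 1 else 0) bs"
        by (rule comb_cong) (use that False bs in \<open>simp add: companion_entry\<close>)
      then show ?thesis using j bs by (simp add: comb_single)
    qed
    ultimately show ?l
      unfolding represented_by_iff using bs(1) by (intro exI[of _ bs]) simp }
  assume ?l
  then obtain bs where bs: "basis_list W bs" "companion r \<in> carrier_mat (length bs) (length bs)"
    "\<And>j. j < length bs \<Longrightarrow> u (bs ! j) = comb (\<lambda>i. companion r $$ (i, j)) bs"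
    unfolding represented_by_iff by blast
  have l: "length bs = ?n" using bs(2) companion_carrier[of r] by (metis carrier_matD(1))
  \<comment> \<open>For r = 1 the basis is empty, and 0 serves as the generator of the zero
    space.\<close>
  define v where "v = (if ?n = 0 then 0 else bs ! 0)"
  have it: "(u ^^ j) v = bs ! j" if "j < ?n" for j
    using that
  proof (induction j)
    case 0 then show ?case by (simp add: v_def)
  next
    case (Suc j)
    have "comb (\<lambda>i. companion r $$ (i, j)) bs = comb (\<lambda>i. if i = Suc j then 1 else 0) bs"
      by (rule comb_cong) (use Suc l in \<open>simp add: companion_entry\<close>)
    then have "u (bs ! j) = bs ! Suc j" using Suc bs(3)[of j] by (simp add: comb_single l)
    then show ?case using Suc by simp
  qed
  have "act r v = 0"
  proof (cases "?n = 0")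
    case True
    then show ?thesis by (simp add: v_def)
  next
    case False
    have "(u ^^ ?n) v = u (bs ! (?n - 1))"
    proof -
      have "(u ^^ Suc (?n - 1)) v = u ((u ^^ (?n - 1)) v)" by simp
      moreover have "(u ^^ (?n - 1)) v = bs ! (?n - 1)" using False by (intro it) simp
      moreover have "Suc (?n - 1) = ?n" using False by simp
      ultimately show ?thesis by (simp only:)
    qed
    also have "\<dots> = - (\<Sum>i<?n. scale (Polynomial.coeff r i) ((u ^^ i) v))"
      using False l bs(3)[of "?n - 1"] by (simp add: comb_def companion_entry it sum_negf)
    finally show ?thesis unfolding act_monic[OF r] by simp
  qed
  have modc: "act f v = comb (Polynomial.coeff (f mod r)) bs" for f
  proof -
    have "act f v = act (f mod r) v" using \<open>act r v = 0\<close> by (simp add: act_mod)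
    also have "\<dots> = comb (Polynomial.coeff (f mod r)) bs"
      by (subst act_eq_sum_less[of ?n]) (auto simp: comb_def it coeff_mod_eq_0 r0 l)
    finally show ?thesis .
  qed
  have "act f v = 0 \<longleftrightarrow> r dvd f" for f
  proof
    assume "act f v = 0"
    then have "\<forall>i<?n. Polynomial.coeff (f mod r) i = 0"
      using bs(1) unfolding modc basis_list_def l by blast
    then have "f mod r = 0"
      by (intro poly_eqI) (metis coeff_mod_eq_0 linorder_not_less Polynomial.coeff_0 r0)
    then show "r dvd f" by auto
  next
    assume "r dvd f"
    then show "act f v = 0" using \<open>act r v = 0\<close> act_dvd by blast
  qed
  moreover have "W = range (\<lambda>f. act f v)"
  proof
    show "range (\<lambda>f. act f v) \<subseteq> W" using bs(1) by (auto simp: modc basis_list_def)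
    show "W \<subseteq> range (\<lambda>f. act f v)"
    proof
      fix x assume "x \<in> W"
      then obtain c where "x = comb c bs" using bs(1) by (auto simp: basis_list_def)
      also have "bs = map (\<lambda>j. (u ^^ j) v) [0..<?n]"
        by (rule nth_equalityI) (simp_all add: l it)
      finally show "x \<in> range (\<lambda>f. act f v)" by (simp add: comb_iterates)
    qed
  qed
  ultimately show ?r by blast
qed

lemma decomp_singleton:
  "decomp {i} r v W \<longleftrightarrow> W = range (\<lambda>f. act f (v i)) \<and> (\<forall>f. act f (v i) = 0 \<longleftrightarrow> r i dvd f)"
proof -
  have "range (\<lambda>f. act (f i) (v i)) = range (\<lambda>f. act f (v i))" (is "?A = ?B")
  proof
    show "?B \<subseteq> ?A"
    proof
      fix x assume "x \<in> ?B"
      then obtain f where "x = act f (v i)" by blast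
      then show "x \<in> ?A" by (intro range_eqI[of _ _ "\<lambda>_. f"]) simp
    qed
  qed auto
  moreover have "(\<forall>f. act (f i) (v i) = 0 \<longleftrightarrow> r i dvd f i) \<longleftrightarrow> (\<forall>f. act f (v i) = 0 \<longleftrightarrow> r i dvd f)"
    (is "?C \<longleftrightarrow> ?D")
  proof
    assume ?C
    from spec[OF this, of "\<lambda>_. f" for f] show ?D by simp
  qed simp
  ultimately show ?thesis by (simp add: decomp_def)
qed

lemma decomp_subset:
  assumes d: "decomp I r v W" and "J \<subseteq> I"
  shows "decomp J r v (range (\<lambda>f. \<Sum>i\<in>J. act (f i) (v i)))"
proof -
  have fin: "finite I" "finite J" using decomp_finite[OF d] assms finite_subset by auto
  have "(\<Sum>i\<in>J. act (f i) (v i)) = 0 \<longleftrightarrow> (\<forall>i\<in>J. r i dvd f i)" for f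
  proof -
    have "(\<Sum>i\<in>I. act (if i \<in> J then f i else 0) (v i)) = (\<Sum>i\<in>J. act (f i) (v i))"
      by (rule sum.mono_neutral_cong_right) (use fin assms in auto)
    moreover have "(\<forall>i\<in>I. r i dvd (if i \<in> J then f i else 0)) \<longleftrightarrow> (\<forall>i\<in>J. r i dvd f i)"
      using assms(2) by auto
    ultimately show ?thesis
      using decomp_zero_iff[OF d, of "\<lambda>i. if i \<in> J then f i else 0"] by simp
  qed
  then show ?thesis using fin by (simp add: decomp_def)
qed

text \<open>Splits off one cyclic summand in the shape that matches the removal of the last diagonal
  block, which drives the induction from decompositions to matrices.\<close>

lemma decomp_insert:
  assumes d: "decomp (insert i I) r v W" and "i \<notin> I"
  obtains W1 where "decomp I r v W1" "decomp {i} r v (range (\<lambda>f. act f (v i)))"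
    "W1 \<inter> range (\<lambda>f. act f (v i)) = {0}" "W = {x + y | x y. x \<in> W1 \<and> y \<in> range (\<lambda>f. act f (v i))}"
proof
  define W1 where "W1 = range (\<lambda>f. \<Sum>i\<in>I. act (f i) (v i))"
  have fin: "finite I" using decomp_finite[OF d] by simp
  show 1: "decomp I r v W1" unfolding W1_def by (rule decomp_subset[OF d]) auto
  show 2: "decomp {i} r v (range (\<lambda>f. act f (v i)))"
    unfolding decomp_singleton using decomp_ann[OF d] by simp
  have s: "(\<Sum>j\<in>insert i I. act (if j = i then g else f j) (v j)) = act g (v i) + (\<Sum>j\<in>I. act (f j) (v j))"
    for f g
    using fin assms(2) by (auto intro!: sum.cong)
  show "W1 \<inter> range (\<lambda>f. act f (v i)) = {0}"
  proof
    show "W1 \<inter> range (\<lambda>f. act f (v i)) \<subseteq> {0}"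
    proof
      fix x assume "x \<in> W1 \<inter> range (\<lambda>f. act f (v i))"
      then obtain f g where x: "x = (\<Sum>j\<in>I. act (f j) (v j))" "x = act g (v i)"
        unfolding W1_def by blast
      have "(\<Sum>j\<in>insert i I. act (if j = i then - g else f j) (v j)) = 0"
        unfolding s using x by (simp add: act_uminus_left)
      then have "r i dvd - g" unfolding decomp_zero_iff[OF d] by simp
      then show "x \<in> {0}" using x decomp_ann[OF d, of i g] by simp
    qed
    show "{0} \<subseteq> W1 \<inter> range (\<lambda>f. act f (v i))"
      using closed_zero decomp_closed 1 2 by blast
  qed
  show "W = {x + y | x y. x \<in> W1 \<and> y \<in> range (\<lambda>f. act f (v i))}"
  proof
    show "W \<subseteq> {x + y | x y. x \<in> W1 \<and> y \<in> range (\<lambda>f. act f (v i))}"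
    proof
      fix x assume "x \<in> W"
      then obtain f where "x = (\<Sum>j\<in>insert i I. act (f j) (v j))" by (rule decomp_obtain[OF d])
      then have "x = (\<Sum>j\<in>I. act (f j) (v j)) + act (f i) (v i)"
        using fin assms(2) by (simp add: add.commute)
      then show "x \<in> {x + y | x y. x \<in> W1 \<and> y \<in> range (\<lambda>f. act f (v i))}"
        unfolding W1_def by blast
    qed
    show "{x + y | x y. x \<in> W1 \<and> y \<in> range (\<lambda>f. act f (v i))} \<subseteq> W"
    proof
      fix z assume "z \<in> {x + y | x y. x \<in> W1 \<and> y \<in> range (\<lambda>f. act f (v i))}"
      then obtain f g where "z = (\<Sum>j\<in>I. act (f j) (v j)) + act g (v i)" by (auto simp: W1_def)
      then have "z = (\<Sum>j\<in>insert i I. act (if j = i then g else f j) (v j))"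
        unfolding s by (simp add: add.commute)
      then show "z \<in> W" using decomp_mem[OF d] by metis
    qed
  qed
qed

lemma diag_companion_carrier:
  "diag_block_mat (map companion rs) \<in>
     carrier_mat (sum_list (map Polynomial.degree rs)) (sum_list (map Polynomial.degree rs))"
  by (rule carrier_matI) (simp_all add: dim_diag_block_mat comp_def companion_def Let_def)

lemma represented_by_zero_dim: "represented_by scale W u (0\<^sub>m 0 0) \<longleftrightarrow> W = {0}"
proof -
  have "represented_by scale W u (0\<^sub>m 0 0) \<longleftrightarrow> (\<exists>bs. basis_list W bs \<and> length bs = 0)"
    unfolding represented_by_iff by auto
  also have "\<dots> \<longleftrightarrow> W = {0}" by (auto simp: basis_list_def comb_def)
  finally show ?thesis .
qed

lemma represented_by_snoc:
  "represented_by scale W u (diag_block_mat (map companion (rs @ [r]))) \<longleftrightarrow>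
    (\<exists>W1 W2. represented_by scale W1 u (diag_block_mat (map companion rs)) \<and>
     represented_by scale W2 u (companion r) \<and>
     W1 \<inter> W2 = {0} \<and> W = {x + y | x y. x \<in> W1 \<and> y \<in> W2})"
proof -
  let ?A = "diag_block_mat (map companion rs)" and ?n = "sum_list (map Polynomial.degree rs)"
  let ?m = "Polynomial.degree r"
  have "dim_row ?A = ?n" "dim_col ?A = ?n" using diag_companion_carrier by blast+
  moreover have "dim_row (companion r) = ?m" "dim_col (companion r) = ?m"
    using companion_carrier by blast+
  ultimately show ?thesis
    unfolding map_append list.map diag_block_mat_last Let_def
    using represented_by_four_block[OF diag_companion_carrier companion_carrier] by simp
qed

lemma represented_by_imp_decomp:
  assumes "represented_by scale W u (diag_block_mat (map companion rs))"
    "\<And>r. r \<in> set rs \<Longrightarrow> Polynomial.lead_coeff r = 1"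
  shows "\<exists>v. decomp {..<length rs} ((!) rs) v W"
  using assms
proof (induction rs arbitrary: W rule: rev_induct)
  case Nil
  then show ?case by (simp add: represented_by_zero_dim decomp_def)
next
  case (snoc r rs)
  obtain W1 W2 where W: "represented_by scale W1 u (diag_block_mat (map companion rs))"
    "represented_by scale W2 u (companion r)"
    "W1 \<inter> W2 = {0}" "W = {x + y | x y. x \<in> W1 \<and> y \<in> W2}"
    using snoc.prems(1) unfolding represented_by_snoc by blast
  obtain v where v: "decomp {..<length rs} ((!) rs) v W1"
    using snoc.IH[OF W(1)] snoc.prems(2) by auto
  obtain w where w: "W2 = range (\<lambda>f. act f w)" "\<forall>f. act f w = 0 \<longleftrightarrow> r dvd f"
    using W(2) represented_by_companion snoc.prems(2) by auto
  let ?v = "v(length rs := w)"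
  have "decomp {..<length rs} ((!) (rs @ [r])) ?v W1"
    by (rule decomp_cong[OF v]) (auto simp: nth_append)
  moreover have "decomp {length rs} ((!) (rs @ [r])) ?v W2"
    unfolding decomp_singleton using w by simp
  ultimately have "decomp ({..<length rs} \<union> {length rs}) ((!) (rs @ [r])) ?v W"
    unfolding W(4) by (rule decomp_union) (use W(3) in auto)
  moreover have "{..<length rs} \<union> {length rs} = {..<length (rs @ [r])}" by auto
  ultimately show ?case by metis
qed

lemma decomp_imp_represented_by:
  assumes "decomp (set ks) r v W" "distinct ks"
    "\<And>i. i \<in> set ks \<Longrightarrow> Polynomial.lead_coeff (r i) = 1"
  shows "represented_by scale W u (diag_block_mat (map companion (map r ks)))"
  using assms
proof (induction ks arbitrary: W rule: rev_induct)
  case Nil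
  then show ?case by (simp add: represented_by_zero_dim decomp_def)
next
  case (snoc i ks)
  have i: "i \<notin> set ks" and d: "decomp (insert i (set ks)) r v W" using snoc.prems by auto
  obtain W1 where W1: "decomp (set ks) r v W1" "decomp {i} r v (range (\<lambda>f. act f (v i)))"
    "W1 \<inter> range (\<lambda>f. act f (v i)) = {0}" "W = {x + y | x y. x \<in> W1 \<and> y \<in> range (\<lambda>f. act f (v i))}"
    using decomp_insert[OF d i] .
  have 1: "represented_by scale W1 u (diag_block_mat (map companion (map r ks)))"
    using snoc.IH[OF W1(1)] snoc.prems by simp
  have 2: "represented_by scale (range (\<lambda>f. act f (v i))) u (companion (r i))"
    using W1(2) represented_by_companion[of "r i"] snoc.prems(3)[of i]
    unfolding decomp_singleton by auto
  have "represented_by scale W u (diag_block_mat (map companion (map r ks @ [r i])))"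
    unfolding represented_by_snoc using 1 2 W1(3,4) by blast
  then show ?case by simp
qed

end

section \<open>Differences of two quadratic endomorphisms\<close>

text \<open>Read p = t^2 - T t + n and q = t^2 - S t + m, with N1 and N2 the products (x1 - y1)(x2 -
  y2) and (x1 - y2)(x2 - y1). Only their symmetric functions are assumed. The product N1 N2 is the
  resultant of p and q, evaluated as the product of the values q - p = \<delta> x + m - n over the
  two roots x of p.\<close>

locale quadratic_pair = endo +
  fixes \<delta> T n S m N1 N2 :: 'a
  assumes delta: "\<delta> = T - S"
    and norm_add: "N1 + N2 = n + n + m + m - T * S"
    and norm_mult: "N1 * N2 = \<delta> * \<delta> * n + \<delta> * (m - n) * T + (m - n) * (m - n)"
begin

definition P1 :: "'a poly" where "P1 = [:N1, - \<delta>, 1:]"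
definition P2 :: "'a poly" where "P2 = [:N2, - \<delta>, 1:]"

text \<open>This substitution is a ring involution. It exchanges the two roots of each quadratic,
  whose sum is \<delta>, and it describes how D fails to commute with u.\<close>

definition refl :: "'a poly \<Rightarrow> 'a poly" where "refl f = pcompose f [:\<delta>, -1:]"

text \<open>The commutator of a pair \<open>(a, b)\<close> with \<open>u = a - b\<close> has this property.\<close>

definition twisted :: "('b \<Rightarrow> 'b) \<Rightarrow> bool" where
  "twisted D \<longleftrightarrow> Vector_Spaces.linear scale scale D \<and>
     (\<forall>v. D (u v) = scale \<delta> (D v) - u (D v)) \<and> (\<forall>v. D (D v) = act (P1 * P2) v)"

text \<open>With s = t^2 - \<delta> t the product is (s + N1)(s + N2), so it depends only on the sum
  and the product of the two norms, which are the known quantities.\<close>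

lemma P1_mult_P2:
  "P1 * P2 = [:0, - \<delta>, 1:] * [:0, - \<delta>, 1:] + Polynomial.smult (N1 + N2) [:0, - \<delta>, 1:] + [:N1 * N2:]"
  by (simp add: P1_def P2_def algebra_simps)

lemma twisted_commutator:
  assumes a: "Vector_Spaces.linear scale scale a" and b: "Vector_Spaces.linear scale scale b"
    and pa: "\<And>v. poly_endo scale [:n, - T, 1:] a v = 0" and qb: "\<And>v. poly_endo scale [:m, - S, 1:] b v = 0"
    and uab: "\<And>v. u v = a v - b v"
  shows "twisted (\<lambda>v. a (b v) - b (a v))"
proof -
  interpret a: Vector_Spaces.linear scale scale a by (rule a)
  interpret b: Vector_Spaces.linear scale scale b by (rule b)
  interpret ea: endo scale a by unfold_locales
  interpret eb: endo scale b by unfold_locales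
  have aa: "a (a v) = scale T (a v) - scale n v" for v
    using pa[of v] by (simp add: a.diff a.add a.scale a.zero a.neg algebra_simps)
  have bb: "b (b v) = scale S (b v) - scale m v" for v
    using qb[of v] by (simp add: b.diff b.add b.scale b.zero b.neg algebra_simps)
  note S = aa bb a.diff a.add a.scale a.neg b.diff b.add b.scale b.neg scale_right_distrib
    scale_right_diff_distrib scale_left_distrib scale_left_diff_distrib
  \<comment> \<open>On u this polynomial equals S a + T b - (a b + b a): the squares of a and b have
    disappeared. P1 * P2 is a quadratic polynomial in it, so both sides of the claim on D^2 can be
    compared as words in a and b, reduced by the two quadratic relations.\<close>
  let ?Y = "[:n + m, - \<delta>, 1:]"
  have Y: "act ?Y v = scale S (a v) + scale T (b v) - a (b v) - b (a v)" for v
    by (simp add: uab u.zero delta S a.zero b.zero)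
  have "P1 * P2 = ?Y * ?Y - Polynomial.smult (T * S) ?Y
      + [:S * S * n + T * T * m - (n * m + n * m + n * m + n * m):]"
    unfolding P1_mult_P2 norm_add norm_mult by (simp add: delta algebra_simps)
  then have PP: "act (P1 * P2) v = act ?Y (act ?Y v) - scale (T * S) (act ?Y v)
      + (scale (S * S * n) v + scale (T * T * m) v
         - (scale (n * m) v + scale (n * m) v + scale (n * m) v + scale (n * m) v))" for v
    by (simp only: act_add_left act_diff_left act_mult act_smult act_pCons[of _ 0] act_0 u.zero
        add_0_right scale_left_distrib scale_left_diff_distrib)
  have "a (b (u v)) - b (a (u v)) = scale \<delta> (a (b v) - b (a v)) - u (a (b v) - b (a v))" for v
    by (simp add: uab delta S)
  moreover have "a (b (a (b v) - b (a v))) - b (a (a (b v) - b (a v))) = act (P1 * P2) v" for v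
    unfolding PP Y by (simp add: S algebra_simps)
  moreover have "Vector_Spaces.linear scale scale (\<lambda>v. a (b v) - b (a v))"
    by unfold_locales (simp_all add: S)
  ultimately show ?thesis unfolding twisted_def by blast
qed

section \<open>The reflection of polynomials and the reconstruction of a and b\<close>

lemma refl_0 [simp]: "refl 0 = 0" and refl_1 [simp]: "refl 1 = 1"
  and refl_add: "refl (f + g) = refl f + refl g"
  and refl_diff: "refl (f - g) = refl f - refl g"
  and refl_mult: "refl (f * g) = refl f * refl g"
  and refl_pCons: "refl (pCons c f) = [:c:] + [:\<delta>, -1:] * refl f"
  by (simp_all add: refl_def pcompose_add pcompose_diff pcompose_mult pcompose_pCons)

lemma refl_power: "refl (f ^ k) = refl f ^ k"
  by (induction k) (simp_all add: refl_mult)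

lemma refl_refl [simp]: "refl (refl f) = f"
proof (induction f)
  case (pCons c f)
  have "refl (refl (pCons c f)) = refl [:c:] + refl [:\<delta>, -1:] * refl (refl f)"
    unfolding refl_pCons[of c f] refl_add refl_mult ..
  also have "\<dots> = [:c:] + [:0, 1:] * f"
    unfolding pCons.IH by (simp add: refl_pCons)
  finally show ?case by simp
qed simp

lemma refl_P1 [simp]: "refl P1 = P1" and refl_P2 [simp]: "refl P2 = P2"
  by (simp_all add: P1_def P2_def refl_pCons)

lemma refl_dvd: "f dvd g \<Longrightarrow> refl f dvd refl g"
  by (auto simp: dvd_def refl_mult)

lemma twisted_act:
  assumes "twisted D"
  shows "D (act f v) = act (refl f) (D v)"
proof -
  interpret D: Vector_Spaces.linear scale scale D using assms by (simp add: twisted_def)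
  have "D (u v) = act [:\<delta>, -1:] (D v)" for v
    using assms by (simp add: twisted_def u.zero u.neg)
  then show ?thesis
    by (induction f)
       (simp_all add: D.zero D.add D.scale refl_pCons act_add_left act_mult u.zero del: mult_pCons_left)
qed

text \<open>For u = a - b and D = a b - b a, subtracting q(b) = 0 from p(u + b) = 0 gives u b + b u
  - \<delta> b = g(u) with g = - t^2 + T t + m - n, and D = u b - b u. Adding the two yields (2 u -
  \<delta>) b = D + g(u). The proof takes this as the definition of b and checks both quadratic
  equations.\<close>

lemma twisted_imp_difference:
  assumes D: "twisted D" and inverse: "\<And>v. act s (act [:- \<delta>, 1 + 1:] v) = v"
  shows "pq_difference scale [:n, - T, 1:] [:m, - S, 1:] u"
proof -
  interpret D: Vector_Spaces.linear scale scale D using D by (simp add: twisted_def)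
  define g where "g = [:m - n, T, -1:]"
  define E where "E = [:- \<delta>, 1 + 1:]"
  define b where "b v = act s (D v + act g v)" for v
  define a where "a v = u v + b v" for v
  have se: "act E (act s v) = v" "act s (act E v) = v" for v
    using inverse act_commute unfolding E_def by metis+
  have inj: "v = w" if "act E v = act E w" for v w
    using se that by metis
  have eb: "act E (b v) = D v + act g v" for v
    by (simp only: b_def se)
  have lin_b: "Vector_Spaces.linear scale scale b"
    by unfold_locales (simp_all add: b_def D.add D.scale act_add act_scale scale_right_distrib)
  interpret b: Vector_Spaces.linear scale scale b by (rule lin_b)
  have lin_a: "Vector_Spaces.linear scale scale a"
    by unfold_locales (simp_all add: a_def b.add b.scale u.add u.scale scale_right_distrib)
  interpret a: Vector_Spaces.linear scale scale a by (rule lin_a)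
  interpret ea: endo scale a by unfold_locales
  interpret eb: endo scale b by unfold_locales
  \<comment> \<open>E changes sign under the reflection, so E(u) and D anticommute; this makes the
    products E^2 b^2 and E^2 a^2 computable.\<close>
  have re: "refl E = - E" by (simp add: E_def refl_pCons)
  have DD: "D (D v) = act (P1 * P2) v" for v using D by (simp add: twisted_def)
  have De: "act E (D v) = - D (act E v)" for v
    by (simp only: twisted_act[OF D] re act_uminus_left minus_minus)
  have eebb: "act E (act E (b (b v)))
      = act (g * g - P1 * P2) v + act (g - refl g) (D v)" for v
  proof -
    have "act E (act E (b (b v))) = act E (D (b v)) + act g (act E (b v))"
      unfolding eb act_add act_commute[of E g] ..
    also have "\<dots> = - D (D v + act g v) + act g (D v + act g v)"
      unfolding De eb ..
    also have "\<dots> = act (g * g - P1 * P2) v + act (g - refl g) (D v)"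
      by (simp add: D.add DD twisted_act[OF D] act_add act_diff_left act_mult)
    finally show ?thesis .
  qed
  \<comment> \<open>After multiplication by E^2, the equation for b separates into a polynomial in u
    times D and a polynomial in u alone. This identity and the next one say that the two polynomials
    vanish.\<close>
  have g1: "g - refl g - Polynomial.smult S E = 0"
  proof -
    have "refl g = [:m - n + T * \<delta> - \<delta> * \<delta>, \<delta> + \<delta> - T, -1:]"
      by (simp add: g_def refl_pCons algebra_simps)
    then show ?thesis by (simp add: E_def g_def delta algebra_simps)
  qed
  have g2: "g * g - P1 * P2 - Polynomial.smult S E * g + Polynomial.smult m (E * E) = 0"
    unfolding P1_mult_P2 norm_add norm_mult by (simp add: E_def g_def delta algebra_simps)
  have qb: "b (b v) - scale S (b v) + scale m v = 0" for v
  proof -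
    have "act E (act E (b (b v) - scale S (b v) + scale m v))
      = act E (act E (b (b v))) - scale S (act E (act E (b v))) + scale m (act E (act E v))"
      by (simp only: act_add act_diff act_scale)
    also have "\<dots> = act (g * g - P1 * P2 - Polynomial.smult S E * g + Polynomial.smult m (E * E)) v
        + act (g - refl g - Polynomial.smult S E) (D v)"
      unfolding eebb unfolding eb
      by (simp add: act_add act_add_left act_diff_left act_mult act_smult scale_right_distrib
        del: act_pCons mult_pCons_left mult_pCons_right smult_pCons)
    also have "\<dots> = act E (act E 0)" unfolding g1 g2 by simp
    finally show ?thesis using inj by metis
  qed
  \<comment> \<open>h is g + t E, because E(u) a = E(u) u + E(u) b.\<close>
  define h where "h = g + [:0, - \<delta>, 1 + 1:]"
  have ea: "act E (a v) = D v + act h v" for v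
  proof -
    have "[:0, - \<delta>, 1 + 1:] = E * [:0, 1:]" by (simp add: E_def)
    then have "act E (u v) = act [:0, - \<delta>, 1 + 1:] v" by (simp only: act_mult act_X)
    then show ?thesis unfolding a_def act_add eb h_def act_add_left by (simp add: del: act_pCons)
  qed
  have eeaa: "act E (act E (a (a v)))
      = act (h * h - P1 * P2) v + act (h - refl h) (D v)" for v
  proof -
    have "act E (act E (a (a v))) = act E (D (a v)) + act h (act E (a v))"
      unfolding ea act_add act_commute[of E h] ..
    also have "\<dots> = - D (D v + act h v) + act h (D v + act h v)"
      unfolding De ea ..
    also have "\<dots> = act (h * h - P1 * P2) v + act (h - refl h) (D v)"
      by (simp add: D.add DD twisted_act[OF D] act_add act_diff_left act_mult)
    finally show ?thesis .
  qed
  have h1: "h - refl h - Polynomial.smult T E = 0"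
  proof -
    have "refl h = [:m - n + T * \<delta>, - T - \<delta>, 1:]"
      by (simp add: h_def g_def refl_pCons algebra_simps)
    then show ?thesis by (simp add: E_def h_def g_def delta algebra_simps)
  qed
  have h2: "h * h - P1 * P2 - Polynomial.smult T E * h + Polynomial.smult n (E * E) = 0"
    unfolding P1_mult_P2 norm_add norm_mult by (simp add: E_def h_def g_def delta algebra_simps)
  have pa: "a (a v) - scale T (a v) + scale n v = 0" for v
  proof -
    have "act E (act E (a (a v) - scale T (a v) + scale n v))
      = act E (act E (a (a v))) - scale T (act E (act E (a v))) + scale n (act E (act E v))"
      by (simp only: act_add act_diff act_scale)
    also have "\<dots> = act (h * h - P1 * P2 - Polynomial.smult T E * h + Polynomial.smult n (E * E)) v
        + act (h - refl h - Polynomial.smult T E) (D v)"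
      unfolding eeaa unfolding ea
      by (simp add: act_add act_add_left act_diff_left act_mult act_smult scale_right_distrib
        del: act_pCons mult_pCons_left mult_pCons_right smult_pCons)
    also have "\<dots> = act E (act E 0)" unfolding h1 h2 by simp
    finally show ?thesis using inj by metis
  qed
  have "poly_endo scale [:n, - T, 1:] a v = 0" for v
    using pa[of v] by (simp add: a.zero a.diff a.add a.scale a.neg algebra_simps)
  moreover have "poly_endo scale [:m, - S, 1:] b v = 0" for v
    using qb[of v] by (simp add: b.zero b.diff b.add b.scale b.neg algebra_simps)
  moreover have "u v = a v - b v" for v by (simp add: a_def)
  ultimately show ?thesis unfolding pq_difference_def using lin_a lin_b by blast
qed

end

section \<open>Chain decompositions of twisted endomorphisms\<close>

lemma (in endo) closed_psubset_dim:
  assumes "finite_dimensional_vector_space scale Basis" "closed S" "closed W" "S \<subset> W"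
  shows "dim S < dim W"
proof -
  interpret fd: finite_dimensional_vector_space scale Basis by (rule assms(1))
  have "span S = S" "span W = W" using assms closed_subspace by (simp_all add: span_eq_iff)
  with fd.dim_psubset[of S W] assms(4) show ?thesis by argo
qed

text \<open>One of P1 and P2 plays the role of P and the other that of Q, so that one argument
  treats both primary parts.\<close>

locale twisted_primary = quadratic_pair +
  fixes D :: "'b \<Rightarrow> 'b" and P Q :: "'a poly" and N :: nat
  assumes tw: "twisted D"
    and irr: "Factorial_Ring.irreducible P"
    and refl_P [simp]: "refl P = P"
    and PQ: "P1 * P2 = P * Q"
    and PQ_comaximal: "comaximal P Q"
begin

sublocale D: Vector_Spaces.linear scale scale D
  using tw by (simp add: twisted_def)

lemma D_act: "D (act f v) = act (refl f) (D v)"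
  by (rule twisted_act[OF tw])

lemma D_D: "D (D v) = act (P * Q) v"
  using tw by (simp add: twisted_def PQ)

text \<open>The exponent is \<open>Suc N\<close> so that a Bezout identity for this power contains a
  factor P even for N = 0.\<close>

definition torsion :: "'b set" where
  "torsion = {x. act (P ^ Suc N) x = 0}"

lemma refl_P_power_dvd: "P ^ k dvd refl f \<longleftrightarrow> P ^ k dvd f"
  using refl_dvd[of "P ^ k" f] refl_dvd[of "P ^ k" "refl f"] by (auto simp: refl_power)

text \<open>On the torsion part Q acts invertibly, with an inverse \<kappa> that is a polynomial in
  u and comaximal with P. There D^2 equals P(u) up to an invertible factor.\<close>

lemma torsion_inverse:
  obtains \<kappa> where "comaximal P \<kappa>" "\<And>x. x \<in> torsion \<Longrightarrow> act (\<kappa> * Q) x = x"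
proof -
  have "comaximal (P ^ Suc N) Q"
    using comaximal_power[OF PQ_comaximal, of "Suc N" 1] by simp
  then obtain a \<kappa> where *: "a * P ^ Suc N + \<kappa> * Q = 1" by (auto simp: comaximal_def)
  have "comaximal P \<kappa>"
    by (rule comaximalI[of "a * P ^ N" _ Q]) (use * in \<open>simp add: algebra_simps\<close>)
  moreover have "act (\<kappa> * Q) x = x" if "x \<in> torsion" for x
  proof -
    have "x = act (a * P ^ Suc N + \<kappa> * Q) x" unfolding * by simp
    also have "\<dots> = act a (act (P ^ Suc N) x) + act (\<kappa> * Q) x"
      by (simp only: act_add_left act_mult[of a])
    finally show ?thesis using that by (simp add: torsion_def)
  qed
  ultimately show ?thesis using that by blast
qed

text \<open>Each piece has the generators \<open>v i\<close> and \<open>D (v i)\<close>, the latter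
  at index \<open>True\<close>. The bound \<open>0 < e i\<close> excludes zero pieces; lifting a
  piece along D uses it to extract a factor P.\<close>

definition chains :: "nat \<Rightarrow> (nat \<Rightarrow> 'b) \<Rightarrow> (nat \<Rightarrow> nat) \<Rightarrow> (nat \<Rightarrow> nat) \<Rightarrow> 'b set \<Rightarrow> bool" where
  "chains l v e k W \<longleftrightarrow> decomp ({..<l} \<times> UNIV) (\<lambda>(i, b). if b then P ^ k i else P ^ e i)
       (\<lambda>(i, b). if b then D (v i) else v i) W \<and>
     (\<forall>i<l. k i \<le> e i \<and> e i \<le> k i + 1 \<and> 0 < e i)"

lemma sum_chains:
  "(\<Sum>p\<in>{..<l::nat} \<times> UNIV. act (h p) (case p of (i, b) \<Rightarrow> if b then D (v i) else v i))
   = (\<Sum>i<l. act (h (i, False)) (v i) + act (h (i, True)) (D (v i)))"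
  by (subst sum_Times_bool) simp_all

lemma chains_zero_iff:
  assumes "chains l v e k W"
  shows "(\<Sum>i<l. act (f i) (v i) + act (g i) (D (v i))) = 0
    \<longleftrightarrow> (\<forall>i<l. P ^ e i dvd f i \<and> P ^ k i dvd g i)"
proof -
  let ?h = "\<lambda>(i, b). if b then g i else f i"
  have "(\<Sum>p\<in>{..<l} \<times> UNIV. act (?h p) (case p of (i, b) \<Rightarrow> if b then D (v i) else v i)) = 0
    \<longleftrightarrow> (\<forall>p\<in>{..<l} \<times> UNIV. (case p of (i, b) \<Rightarrow> if b then P ^ k i else P ^ e i) dvd ?h p)"
    using assms unfolding chains_def by (intro decomp_zero_iff) blast
  then show ?thesis unfolding sum_chains by (auto simp: UNIV_bool)
qed

lemma chains_obtain:
  assumes "chains l v e k W" "x \<in> W"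
  obtains f g where "x = (\<Sum>i<l. act (f i) (v i) + act (g i) (D (v i)))"
proof -
  obtain h where "x = (\<Sum>p\<in>{..<l} \<times> UNIV. act (h p) (case p of (i, b) \<Rightarrow> if b then D (v i) else v i))"
    using assms unfolding chains_def by (auto elim: decomp_obtain)
  then show ?thesis unfolding sum_chains by (rule that)
qed

lemma chains_kill:
  assumes "chains l v e k W" "i < l"
  shows "act (P ^ e i) (v i) = 0" "act (P ^ k i) (D (v i)) = 0"
proof -
  have d: "decomp ({..<l} \<times> UNIV) (\<lambda>(i, b). if b then P ^ k i else P ^ e i)
       (\<lambda>(i, b). if b then D (v i) else v i) W"
    using assms(1) by (simp add: chains_def)
  show "act (P ^ e i) (v i) = 0" using decomp_ann[OF d, of "(i, False)"] assms(2) by simp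
  show "act (P ^ k i) (D (v i)) = 0" using decomp_ann[OF d, of "(i, True)"] assms(2) by simp
qed

text \<open>Choose v with D v = x. Then P Q v = D x shows that the annihilator of v is P^(k+1),
  while that of D v = x is P^e. So the exponents (e, k) turn into (k + 1, e), and k \<le> e \<le> k
  + 1 becomes e \<le> k + 1 \<le> e + 1: the condition reproduces itself, which is the origin of
  \<epsilon> in {0, 1}.\<close>

lemma lift_chains:
  assumes c: "chains l x e k (D ` W)" and W: "closed W" "D ` W \<subseteq> W" "W \<subseteq> torsion"
  shows "\<exists>v U. chains l v (\<lambda>i. k i + 1) e U \<and> U \<subseteq> W \<and> D ` W \<subseteq> D ` U"
proof -
  have d: "decomp ({..<l} \<times> UNIV) (\<lambda>(i, b). if b then P ^ k i else P ^ e i)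
       (\<lambda>(i, b). if b then D (x i) else x i) (D ` W)"
    using c by (simp add: chains_def)
  have "x i \<in> D ` W" if "i < l" for i
    using decomp_gen[OF d, of "(i, False)" 1] that by simp
  then have "\<forall>i. \<exists>w. i < l \<longrightarrow> w \<in> W \<and> D w = x i" by (metis imageE)
  then obtain v where v: "\<And>i. i < l \<Longrightarrow> v i \<in> W" "\<And>i. i < l \<Longrightarrow> D (v i) = x i" by metis
  have Dx: "D (x i) = act (P * Q) (v i)" if "i < l" for i
    using D_D v(2)[OF that] by metis
  obtain \<kappa> where \<kappa>: "comaximal P \<kappa>" "\<And>x. x \<in> torsion \<Longrightarrow> act (\<kappa> * Q) x = x"
    using torsion_inverse by blast
  \<comment> \<open>\<kappa> Q is the identity on the torsion and P Q v = D x, hence P v = \<kappa>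
    D x: multiples of P send v into the chains already known.\<close>
  have Pv: "act (P * f) (v i) = act (\<kappa> * f) (D (x i))" if "i < l" for i f
  proof -
    have "act (P * f) (v i) = act (P * f) (act (\<kappa> * Q) (v i))"
      using \<kappa>(2)[of "v i"] v(1)[OF that] W(3) by auto
    also have "\<dots> = act (\<kappa> * f) (act (P * Q) (v i))"
      by (simp add: act_mult[symmetric] mult_ac)
    finally show ?thesis by (simp add: Dx[OF that])
  qed
  define U where "U = range (\<lambda>h. \<Sum>p\<in>{..<l} \<times> UNIV. act (h p) (case p of (i, b) \<Rightarrow> if b then D (v i) else v i))"
  have "decomp ({..<l} \<times> UNIV) (\<lambda>(i, b). if b then P ^ e i else P ^ (k i + 1))
       (\<lambda>(i, b). if b then D (v i) else v i) U"
  proof (rule decompI)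
    fix h p
    assume "(\<Sum>p\<in>{..<l} \<times> UNIV. act (h p) (case p of (i, b) \<Rightarrow> if b then D (v i) else v i)) = 0"
      and p: "p \<in> {..<l} \<times> (UNIV :: bool set)"
    then have z: "(\<Sum>i<l. act (h (i, False)) (v i) + act (h (i, True)) (x i)) = 0"
      unfolding sum_chains using v(2) by simp
    \<comment> \<open>D carries the relation into the given chains, reflecting the coefficients.
      This only shows that P^e divides the coefficient of v; but as e > 0 a factor P can be
      extracted, and then the original relation itself lies in the given chains.\<close>
    have "(\<Sum>i<l. act (refl (h (i, False))) (x i) + act (refl (h (i, True))) (D (x i)))
        = D (\<Sum>i<l. act (h (i, False)) (v i) + act (h (i, True)) (x i))"
      by (simp add: D.sum D.add D_act v(2))
    then have "(\<Sum>i<l. act (refl (h (i, False))) (x i) + act (refl (h (i, True))) (D (x i))) = 0"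
      unfolding z by (simp add: D.zero)
    then have "P ^ e i dvd h (i, False)" if "i < l" for i
      using that by (simp add: chains_zero_iff[OF c] refl_P_power_dvd)
    moreover have "P dvd P ^ e i" if "i < l" for i
      using c that by (auto simp: chains_def intro: dvd_power)
    ultimately have "\<forall>i. \<exists>f. i < l \<longrightarrow> h (i, False) = P * f"
      by (meson dvd_trans dvd_def)
    then obtain f where f: "\<And>i. i < l \<Longrightarrow> h (i, False) = P * f i" by metis
    have "(\<Sum>i<l. act (h (i, True)) (x i) + act (\<kappa> * f i) (D (x i))) = 0"
    proof -
      have "(\<Sum>i<l. act (h (i, True)) (x i) + act (\<kappa> * f i) (D (x i)))
        = (\<Sum>i<l. act (h (i, False)) (v i) + act (h (i, True)) (x i))"
        by (intro sum.cong) (auto simp: f Pv)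
      then show ?thesis unfolding z .
    qed
    then have e: "P ^ e i dvd h (i, True)" "P ^ k i dvd \<kappa> * f i" if "i < l" for i
      using that by (simp_all add: chains_zero_iff[OF c])
    have "P ^ k i dvd f i" if "i < l" for i
      using comaximal_dvd_mult[OF _ e(2)[OF that]] comaximal_power[OF \<kappa>(1), of "k i" 1] by simp
    then have "P ^ (k i + 1) dvd h (i, False)" if "i < l" for i
      using that by (simp add: f)
    then show "(case p of (i, b) \<Rightarrow> if b then P ^ e i else P ^ (k i + 1)) dvd h p"
      using e(1) p by auto
  next
    fix p assume "p \<in> {..<l} \<times> (UNIV :: bool set)"
    then obtain i b where p: "p = (i, b)" "i < l" by auto
    have "act (P * P ^ k i) (v i) = act \<kappa> (act (P ^ k i) (D (x i)))"
      unfolding Pv[OF p(2)] by (simp add: act_mult)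
    then have "act (P * P ^ k i) (v i) = 0" using chains_kill[OF c p(2)] by simp
    then show "act (case p of (i, b) \<Rightarrow> if b then P ^ e i else P ^ (k i + 1))
        (case p of (i, b) \<Rightarrow> if b then D (v i) else v i) = 0"
      using chains_kill[OF c p(2)] p v(2) by simp
  qed (auto simp: U_def)
  then have cS: "chains l v (\<lambda>i. k i + 1) e U"
    unfolding chains_def by (rule conjI) (use c in \<open>auto simp: chains_def\<close>)
  have "U \<subseteq> W"
  proof
    fix s assume "s \<in> U"
    then obtain f g where "s = (\<Sum>i<l. act (f i) (v i) + act (g i) (D (v i)))"
      by (rule chains_obtain[OF cS])
    then show "s \<in> W"
      using v(1) W(1,2) by (auto intro!: closed_sum closed_add closed_act)
  qed
  moreover have "D ` W \<subseteq> D ` U"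
  proof
    fix y assume "y \<in> D ` W"
    then obtain f g where y: "y = (\<Sum>i<l. act (f i) (x i) + act (g i) (D (x i)))"
      by (rule chains_obtain[OF c])
    define h where "h = (\<lambda>(i, b). if b then refl (g i) else refl (f i))"
    have "y = D (\<Sum>p\<in>{..<l} \<times> UNIV. act (h p) (case p of (i, b) \<Rightarrow> if b then D (v i) else v i))"
      unfolding sum_chains by (simp add: D.sum D.add D_act y h_def v(2))
    then show "y \<in> D ` U" unfolding U_def by blast
  qed
  ultimately show ?thesis using cS by blast
qed

text \<open>Since D W is contained in D U, a vector of W outside U can be corrected by an element of
  U so as to lie in the kernel of D. There P Q = D^2 = 0, so P kills it, and irreducibility of P
  forces its cyclic module to meet U in 0. It is added as a piece with exponents 1 and 0.\<close>

lemma extend_chains: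
  assumes fd: "finite_dimensional_vector_space scale Basis"
    and c: "chains l v e k U" and W: "closed W" "W \<subseteq> torsion" and U: "U \<subseteq> W" "D ` W \<subseteq> D ` U"
  shows "\<exists>l v e k. chains l v e k W"
  using c U
proof (induction "dim W - dim U" arbitrary: l v e k U rule: less_induct)
  case less
  show ?case
  proof (cases "U = W")
    case True
    then show ?thesis using less.prems by blast
  next
    case False
    have d: "decomp ({..<l} \<times> UNIV) (\<lambda>(i, b). if b then P ^ k i else P ^ e i)
         (\<lambda>(i, b). if b then D (v i) else v i) U"
      using less.prems(1) by (simp add: chains_def)
    have clS: "closed U" using decomp_closed[OF d] .
    obtain w where w: "w \<in> W" "w \<notin> U" using False less.prems(2) by blast
    obtain s where s: "s \<in> U" "D w = D s" using w less.prems(3) by blast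
    define y where "y = w - s"
    have y: "y \<in> W" "y \<notin> U"
    proof -
      show "y \<in> W" using w s less.prems(2) W(1) closed_diff by (auto simp: y_def)
      show "y \<notin> U"
      proof
        assume "y \<in> U"
        then have "y + s \<in> U" using s clS closed_add by blast
        then show False using w by (simp add: y_def)
      qed
    qed
    have Dy: "D y = 0" by (simp add: y_def D.diff s)
    have Py: "act P y = 0"
    proof -
      obtain \<kappa> where \<kappa>: "\<And>x. x \<in> torsion \<Longrightarrow> act (\<kappa> * Q) x = x"
        using torsion_inverse by blast
      have "act P y = act P (act (\<kappa> * Q) y)" using \<kappa>[of y] y W(2) by auto
      also have "\<dots> = act \<kappa> (act (P * Q) y)" by (simp add: act_mult[symmetric] mult_ac)
      also have "act (P * Q) y = 0" using D_D[of y] Dy by (simp add: D.zero)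
      finally show ?thesis by simp
    qed
    have Py_dvd: "P dvd f" if "act f y \<in> U" for f
    proof (rule ccontr)
      assume "\<not> P dvd f"
      then obtain a b where "a * P + b * f = 1"
        using irreducible_comaximal[OF irr] unfolding comaximal_def by blast
      then have "y = act (a * P + b * f) y" by simp
      also have "\<dots> = act b (act f y)" by (simp add: act_add_left act_mult Py)
      finally show False using closed_act[OF clS that, of b] y by simp
    qed
    define v' e' k' where "v' = v(l := y)" and "e' = e(l := 1)" and "k' = k(l := 0)"
    let ?r = "\<lambda>(i, b). if b then P ^ k' i else P ^ e' i"
    let ?v = "\<lambda>(i, b). if b then D (v' i) else v' i"
    let ?T = "range (\<lambda>f. act f y)"
    have 1: "decomp ({..<l} \<times> UNIV) ?r ?v U"
      by (rule decomp_cong[OF d]) (auto simp: v'_def e'_def k'_def)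
    have "decomp {(l, False)} ?r ?v ?T"
      unfolding decomp_singleton using Py Py_dvd closed_zero[OF clS]
      by (auto simp: v'_def e'_def act_dvd)
    then have 2: "decomp ({l} \<times> UNIV) ?r ?v ?T"
      by (rule decomp_extend_trivial) (auto simp: v'_def k'_def Dy)
    have 3: "U \<inter> ?T = {0}"
    proof
      show "U \<inter> ?T \<subseteq> {0}" using Py Py_dvd act_dvd by blast
      show "{0} \<subseteq> U \<inter> ?T" using clS closed_zero decomp_closed[OF 2] by blast
    qed
    let ?S = "{a + b | a b. a \<in> U \<and> b \<in> ?T}"
    have 4: "decomp ({..<l} \<times> UNIV \<union> {l} \<times> UNIV) ?r ?v ?S"
      by (rule decomp_union[OF 1 2 _ 3]) auto
    moreover have "{..<l} \<times> UNIV \<union> {l} \<times> (UNIV :: bool set) = {..<Suc l} \<times> UNIV" by auto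
    ultimately have "decomp ({..<Suc l} \<times> UNIV) ?r ?v ?S" by metis
    then have c': "chains (Suc l) v' e' k' ?S"
      unfolding chains_def
      by (rule conjI) (use less.prems(1) in \<open>auto simp: chains_def e'_def k'_def less_Suc_eq\<close>)
    have sub: "?S \<subseteq> W"
      using less.prems(2) y(1) W(1) by (auto intro!: closed_add closed_act)
    have T0: "0 \<in> ?T" using closed_zero[OF decomp_closed[OF 2]] .
    have "s \<in> ?S" if "s \<in> U" for s
      by (intro CollectI exI conjI) (rule add_0_right[symmetric], rule that, rule T0)
    then have SS: "U \<subseteq> ?S" by blast
    have yT: "y \<in> ?T" by (rule range_eqI[of _ _ 1]) simp
    have "y \<in> ?S"
      by (intro CollectI exI conjI) (rule add_0_left[symmetric], rule closed_zero[OF clS], rule yT)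
    then have "U \<subset> ?S" using SS y by blast
    then have "dim U < dim ?S" by (rule closed_psubset_dim[OF fd clS decomp_closed[OF 4]])
    \<comment> \<open>Needed because the subtraction of natural numbers is truncated: the
      codimension must be positive in order to decrease.\<close>
    moreover have "dim U < dim W"
      by (rule closed_psubset_dim[OF fd clS W(1)]) (use False less.prems in auto)
    ultimately have "dim W - dim ?S < dim W - dim U" by simp
    then show ?thesis
      by (rule less.hyps[OF _ c' sub order_trans[OF less.prems(3) image_mono[OF SS]]])
  qed
qed

text \<open>D is nilpotent on the torsion, because D^(2 (N + 1)) = (P Q)^(N + 1) kills it. So D W is
  smaller than W unless W = 0, and induction on the dimension applies: lift the chains of D W, then
  fill up with pieces from the kernel.\<close>

lemma chains_exist:
  assumes fd: "finite_dimensional_vector_space scale Basis"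
    and "closed W" "D ` W \<subseteq> W" "W \<subseteq> torsion"
  shows "\<exists>l v e k. chains l v e k W"
  using assms(2-)
proof (induction "dim W" arbitrary: W rule: less_induct)
  case less
  have cl: "closed (D ` W)"
    unfolding closed_def
  proof (intro conjI ballI allI)
    show "0 \<in> D ` W" using closed_zero[OF less.prems(1)] D.zero by force
    fix x assume "x \<in> D ` W"
    then obtain x' where x: "x = D x'" "x' \<in> W" by blast
    { fix y assume "y \<in> D ` W"
      then obtain y' where y: "y = D y'" "y' \<in> W" by blast
      show "x + y \<in> D ` W" using x y closed_add[OF less.prems(1)] by (metis D.add imageI) }
    fix f
    \<comment> \<open>The image of a semilinear map is a submodule because the reflection is
      invertible.\<close>
    have "act f x = D (act (refl f) x')" by (simp add: D_act x)
    then show "act f x \<in> D ` W" using closed_act[OF less.prems(1) x(2)] by blast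
  qed
  show ?case
  proof (cases "D ` W = W")
    case True
    have "W \<subseteq> {0}"
    proof
      fix x assume "x \<in> W"
      have "(D ^^ j) ` W = W" for j
      proof (induction j)
        case (Suc j)
        have "(D ^^ Suc j) ` W = D ` (D ^^ j) ` W" by (simp add: image_comp)
        then show ?case by (simp only: Suc True)
      qed simp
      then obtain y where y: "y \<in> W" "x = (D ^^ (2 * Suc N)) y" using \<open>x \<in> W\<close> by blast
      have "(D ^^ (2 * j)) y = act ((P * Q) ^ j) y" for j
      proof (induction j)
        case (Suc j)
        have "(D ^^ (2 * Suc j)) y = D (D ((D ^^ (2 * j)) y))" by simp
        also have "\<dots> = act ((P * Q) ^ Suc j) y" unfolding Suc D_D by (simp add: act_mult)
        finally show ?case .
      qed simp
      then have "x = act ((P * Q) ^ Suc N) y" using y by metis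
      also have "\<dots> = act (Q ^ Suc N) (act (P ^ Suc N) y)"
        by (simp only: power_mult_distrib act_mult act_commute[of "P ^ Suc N"])
      also have "\<dots> = 0" using y less.prems(3) by (auto simp: torsion_def simp del: power_Suc)
      finally show "x \<in> {0}" by simp
    qed
    then have W0: "W = {0}" using closed_zero less.prems(1) by blast
    have "decomp ({..<0::nat} \<times> UNIV) (\<lambda>(i, b). if b then P ^ 0 else P ^ 0)
       (\<lambda>(i, b). if b then D 0 else 0) W"
      by (simp add: W0 decomp_def)
    then have "chains 0 (\<lambda>_. 0) (\<lambda>_. 0) (\<lambda>_. 0) W"
      unfolding chains_def by simp
    then show ?thesis by blast
  next
    case False
    then have "D ` W \<subset> W" using less.prems by blast
    then have "dim (D ` W) < dim W" by (rule closed_psubset_dim[OF fd cl less.prems(1)])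
    from less.hyps[OF this cl] obtain l x e k where "chains l x e k (D ` W)"
      using less.prems by blast
    from lift_chains[OF this less.prems] obtain v U where
      "chains l v (\<lambda>i. k i + 1) e U" "U \<subseteq> W" "D ` W \<subseteq> D ` U" by blast
    from extend_chains[OF fd this(1) less.prems(1,3) this(2,3)] show ?thesis .
  qed
qed

end

section \<open>Primary decomposition and the paired normal form\<close>

locale irreducible_pair = quadratic_pair +
  assumes irr1: "Factorial_Ring.irreducible P1" and irr2: "Factorial_Ring.irreducible P2"
    and N1_neq_N2: "N1 \<noteq> N2"
    and disc1: "\<delta> * \<delta> - 4 * N1 \<noteq> 0" and disc2: "\<delta> * \<delta> - 4 * N2 \<noteq> 0"
begin

lemma P1_P2_comaximal: "comaximal P1 P2"
proof -
  have "[:1 / (N1 - N2):] * P1 + (- [:1 / (N1 - N2):]) * P2 = [:1 / (N1 - N2):] * (P1 - P2)"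
    by (simp only: right_diff_distrib mult_minus_left add_uminus_conv_diff)
  also have "\<dots> = 1"
    using N1_neq_N2 by (simp add: P1_def P2_def one_pCons)
  finally show ?thesis by (rule comaximalI)
qed

text \<open>Completing the square: (2 t - \<delta>)^2 - 4 (t^2 - \<delta> t + N) is the
  discriminant, a nonzero constant. The identity holds in characteristic 2 as well, and it is the
  source of the inverse of 2 u - \<delta>.\<close>

lemma derivative_comaximal:
  assumes "\<delta> * \<delta> - 4 * N \<noteq> 0"
  shows "comaximal [:N, - \<delta>, 1:] [:- \<delta>, 1 + 1:]"
proof -
  let ?d = "\<delta> * \<delta> - 4 * N"
  have "[:- 4:] * [:N, - \<delta>, 1:] + [:- \<delta>, 1 + 1:] * [:- \<delta>, 1 + 1:] = [:?d:]"
    by (simp add: algebra_simps)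
  then have "[:1 / ?d:] * ([:- 4:] * [:N, - \<delta>, 1:] + [:- \<delta>, 1 + 1:] * [:- \<delta>, 1 + 1:]) = 1"
    using assms by (simp add: one_pCons)
  then have "([:1 / ?d:] * [:- 4:]) * [:N, - \<delta>, 1:] + ([:1 / ?d:] * [:- \<delta>, 1 + 1:]) * [:- \<delta>, 1 + 1:] = 1"
    by (simp only: distrib_left mult.assoc)
  then show ?thesis by (rule comaximalI)
qed

text \<open>The common normal form behind the three conditions: each index i gives two cyclic
  summands for the same quadratic \<open>R i\<close>, with exponent \<open>e i\<close> at
  \<open>False\<close> and \<open>k i\<close> at \<open>True\<close>. The map D is forgotten, and
  zero summands are allowed.\<close>

definition paired ::
  "nat \<Rightarrow> (nat \<Rightarrow> 'a poly) \<Rightarrow> (nat \<Rightarrow> nat) \<Rightarrow> (nat \<Rightarrow> nat) \<Rightarrow> (nat \<times> bool \<Rightarrow> 'b) \<Rightarrow> bool" where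
  "paired l R k e v \<longleftrightarrow>
     decomp ({..<l} \<times> UNIV) (\<lambda>(i, b). R i ^ (if b then k i else e i)) v UNIV \<and>
     (\<forall>i<l. R i \<in> {P1, P2} \<and> k i \<le> e i \<and> e i \<le> k i + 1)"

lemma twisted_imp_paired:
  assumes D: "twisted D" and fd: "finite_dimensional_vector_space scale Basis"
    and ann: "\<And>v. act ((P1 * P2) ^ N) v = 0"
  shows "\<exists>l R k e v. paired l R k e v"
proof -
  interpret t1: twisted_primary scale u \<delta> T n S m N1 N2 D P1 P2 N
    by unfold_locales (simp_all add: D irr1 P1_P2_comaximal)
  interpret t2: twisted_primary scale u \<delta> T n S m N1 N2 D P2 P1 N
    by unfold_locales (simp_all add: D irr2 P1_P2_comaximal comaximal_sym)
  have cl: "closed {x. act f x = 0}" for f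
    by (auto simp: closed_def act_add act_commute[of f])
  have "D ` t1.torsion \<subseteq> t1.torsion" "D ` t2.torsion \<subseteq> t2.torsion"
    using t1.D_act[of "P1 ^ Suc N", symmetric] t1.D_act[of "P2 ^ Suc N", symmetric]
    by (auto simp: t1.torsion_def t2.torsion_def refl_power t1.D.zero simp del: power_Suc)
  with cl obtain l1 v1 e1 k1 l2 v2 e2 k2
    where c1: "t1.chains l1 v1 e1 k1 t1.torsion" and c2: "t2.chains l2 v2 e2 k2 t2.torsion"
    using t1.chains_exist[OF fd, of t1.torsion] t2.chains_exist[OF fd, of t2.torsion]
    unfolding t1.torsion_def t2.torsion_def by blast
  define R where "R i = (if i < l1 then P1 else P2)" for i
  define k where "k i = (if i < l1 then k1 i else k2 (i - l1))" for i
  define e where "e i = (if i < l1 then e1 i else e2 (i - l1))" for i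
  define v where "v = (\<lambda>(i, b). if i < l1 then (if b then D (v1 i) else v1 i)
      else (if b then D (v2 (i - l1)) else v2 (i - l1)))"
  let ?r = "\<lambda>(i, b). R i ^ (if b then k i else e i)"
  have 1: "decomp ({..<l1} \<times> UNIV) ?r v t1.torsion"
    by (rule decomp_cong[OF conjunct1[OF c1[unfolded t1.chains_def]]])
       (auto simp: R_def k_def e_def v_def)
  have bij: "bij_betw (\<lambda>(i, b). (i - l1, b)) ({l1..<l1 + l2} \<times> (UNIV :: bool set)) ({..<l2} \<times> UNIV)"
    by (rule bij_betwI[of _ _ _ "\<lambda>(i, b). (i + l1, b)"]) auto
  have 2: "decomp ({l1..<l1 + l2} \<times> UNIV) ?r v t2.torsion"
    by (rule decomp_cong[OF decomp_reindex[OF conjunct1[OF c2[unfolded t2.chains_def]] bij]])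
       (auto simp: R_def k_def e_def v_def)
  have co: "comaximal (P1 ^ Suc N) (P2 ^ Suc N)"
    by (rule comaximal_power[OF P1_P2_comaximal])
  have 3: "t1.torsion \<inter> t2.torsion = {0}"
    using act_comaximal[OF co] by (auto simp: t1.torsion_def t2.torsion_def simp del: power_Suc)
  have "decomp ({..<l1} \<times> UNIV \<union> {l1..<l1 + l2} \<times> UNIV) ?r v
      {x + y | x y. x \<in> t1.torsion \<and> y \<in> t2.torsion}"
    by (rule decomp_union[OF 1 2 _ 3]) auto
  moreover have "{..<l1} \<times> UNIV \<union> {l1..<l1 + l2} \<times> (UNIV :: bool set) = {..<l1 + l2} \<times> UNIV"
    by auto
  moreover have "{x + y | x y. x \<in> t1.torsion \<and> y \<in> t2.torsion} = UNIV"
  proof -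
    have "\<exists>x y. z = x + y \<and> x \<in> t1.torsion \<and> y \<in> t2.torsion" for z
    proof -
      obtain a b where ab: "a * P1 ^ Suc N + b * P2 ^ Suc N = 1"
        using co unfolding comaximal_def by blast
      \<comment> \<open>Applying the hypothesis to a multiple of (P1 * P2) z raises the exponent
        from N to N + 1, the one used by the torsion parts.\<close>
      have kill: "act (f * (P1 ^ Suc N * P2 ^ Suc N)) z = 0" for f
        using ann[of "act (f * (P1 * P2)) z"]
        by (simp add: act_mult[symmetric] power_mult_distrib mult_ac)
      have "z = act (b * P2 ^ Suc N) z + act (a * P1 ^ Suc N) z"
        using ab by (metis act_1 act_add_left add.commute)
      moreover have "act (P1 ^ Suc N) (act (b * P2 ^ Suc N) z) = 0"
        using kill[of b] by (simp only: act_mult[symmetric] mult_ac)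
      moreover have "act (P2 ^ Suc N) (act (a * P1 ^ Suc N) z) = 0"
        using kill[of a] by (simp only: act_mult[symmetric] mult_ac)
      ultimately show ?thesis unfolding t1.torsion_def t2.torsion_def by blast
    qed
    then show ?thesis by blast
  qed
  ultimately have "decomp ({..<l1 + l2} \<times> UNIV) ?r v UNIV" by simp
  moreover have "\<forall>i<l1 + l2. R i \<in> {P1, P2} \<and> k i \<le> e i \<and> e i \<le> k i + 1"
    using c1 c2 by (auto simp: t1.chains_def t2.chains_def R_def k_def e_def)
  ultimately show ?thesis unfolding paired_def by blast
qed

text \<open>The universal property of a direct sum of cyclic modules, twisted by the reflection: the
  images of the generators may be prescribed subject to the reflected annihilators. The coefficients
  representing x are not unique, but two choices differ by multiples of \<open>r i\<close>, whose
  reflections kill \<open>w i\<close>.\<close>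

lemma semilinear_extension:
  assumes d: "decomp I r v UNIV" and w: "\<And>i. i \<in> I \<Longrightarrow> act (refl (r i)) (w i) = 0"
  shows "\<exists>D. Vector_Spaces.linear scale scale D \<and> (\<forall>f x. D (act f x) = act (refl f) (D x)) \<and>
    (\<forall>i\<in>I. D (v i) = w i)"
proof -
  have "\<forall>x. \<exists>f. x = (\<Sum>i\<in>I. act (f i) (v i))" using d unfolding decomp_def by blast
  then obtain F where F: "\<And>x. x = (\<Sum>i\<in>I. act (F x i) (v i))" by metis
  define D where "D x = (\<Sum>i\<in>I. act (refl (F x i)) (w i))" for x
  have D: "D x = (\<Sum>i\<in>I. act (refl (f i)) (w i))" if "x = (\<Sum>i\<in>I. act (f i) (v i))" for f x
  proof -
    have "(\<Sum>i\<in>I. act (F x i - f i) (v i)) = 0"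
      using F[of x] that by (simp add: act_diff_left sum_subtractf)
    then have "r i dvd F x i - f i" if "i \<in> I" for i
      using that by (simp only: decomp_zero_iff[OF d])
    then have "act (refl (F x i) - refl (f i)) (w i) = 0" if "i \<in> I" for i
      using that w refl_dvd act_dvd refl_diff by metis
    then show ?thesis unfolding D_def by (intro sum.cong) (simp_all add: act_diff_left)
  qed
  have act: "D (act f x) = act (refl f) (D x)" for f x
  proof -
    have "act f x = (\<Sum>i\<in>I. act (f * F x i) (v i))"
      by (subst F[of x]) (simp only: act_sum act_mult)
    from D[OF this] show ?thesis by (simp add: D_def refl_mult act_sum act_mult)
  qed
  have add: "D (x + y) = D x + D y" for x y
  proof -
    have "x + y = (\<Sum>i\<in>I. act (F x i + F y i) (v i))"
      using F[of x] F[of y] by (simp add: act_add_left sum.distrib)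
    from D[OF this] show ?thesis by (simp add: D_def refl_add act_add_left sum.distrib)
  qed
  have scale: "D (scale c x) = scale c (D x)" for c x
    using act[of "[:c:]" x] by (simp add: refl_pCons u.zero)
  have gen: "D (v i) = w i" if "i \<in> I" for i
  proof -
    have "v i = (\<Sum>j\<in>I. act (if j = i then 1 else 0) (v j))"
      using that decomp_finite[OF d] by (subst sum.remove[of I i]) (auto intro!: sum.neutral)
    from D[OF this] have "D (v i) = (\<Sum>j\<in>I. act (refl (if j = i then 1 else 0)) (w j))" .
    also have "\<dots> = w i"
      using that decomp_finite[OF d] by (subst sum.remove[of I i]) (auto intro!: sum.neutral)
    finally show ?thesis .
  qed
  have "Vector_Spaces.linear scale scale D"
    by unfold_locales (simp_all add: add scale)
  then show ?thesis using act gen by blast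
qed

text \<open>Inside each pair let D send the first generator to the second; then D^2 = P1 P2 forces D
  to send the second to P1 P2 times the first. The first image respects the annihilators because k
  \<le> e, the second because e \<le> k + 1.\<close>

lemma paired_imp_twisted:
  assumes p: "paired l R k e v"
  shows "\<exists>D. twisted D"
proof -
  have d: "decomp ({..<l} \<times> UNIV) (\<lambda>(i, b). R i ^ (if b then k i else e i)) v UNIV"
    and R: "\<And>i. i < l \<Longrightarrow> R i \<in> {P1, P2}" "\<And>i. i < l \<Longrightarrow> k i \<le> e i" "\<And>i. i < l \<Longrightarrow> e i \<le> k i + 1"
    using p by (auto simp: paired_def)
  define w where "w = (\<lambda>(i, b). if b then act (P1 * P2) (v (i, False)) else v (i, True))"
  have ann: "act f (v (i, b)) = 0" if "i < l" "R i ^ (if b then k i else e i) dvd f" for i b f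
    using decomp_ann[OF d, of "(i, b)" f] that by simp
  have refl_R: "refl (R i) = R i" if "i < l" for i using R(1)[OF that] by auto
  have "act (refl (case p of (i, b) \<Rightarrow> R i ^ (if b then k i else e i))) (w p) = 0"
    if "p \<in> {..<l} \<times> UNIV" for p
  proof -
    obtain i b where pi: "p = (i, b)" "i < l" using \<open>p \<in> _\<close> by auto
    show ?thesis
    proof (cases b)
      case True
      have "R i dvd P1 * P2" using R(1)[OF pi(2)] by auto
      then have "R i ^ k i * R i dvd R i ^ k i * (P1 * P2)" by (rule mult_dvd_mono[OF dvd_refl])
      moreover have "R i ^ e i dvd R i ^ k i * R i"
        using le_imp_power_dvd[OF R(3)[OF pi(2)], of "R i"] by (simp add: mult.commute)
      ultimately have "R i ^ e i dvd R i ^ k i * (P1 * P2)" using dvd_trans by blast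
      then have "act (R i ^ k i * (P1 * P2)) (v (i, False)) = 0"
        using ann[of i False] pi by simp
      then show ?thesis using True pi by (simp add: w_def refl_power refl_R act_mult)
    next
      case False
      have "act (R i ^ e i) (v (i, True)) = 0"
        using ann[of i True] le_imp_power_dvd[OF R(2)[OF pi(2)], of "R i"] pi by simp
      then show ?thesis using False pi by (simp add: w_def refl_power refl_R)
    qed
  qed
  from semilinear_extension[OF d this] obtain D where
    D: "Vector_Spaces.linear scale scale D" "\<And>f x. D (act f x) = act (refl f) (D x)"
    "\<And>p. p \<in> {..<l} \<times> UNIV \<Longrightarrow> D (v p) = w p" by blast
  interpret D: Vector_Spaces.linear scale scale D by (rule D(1))
  have "D (u x) = scale \<delta> (D x) - u (D x)" for x
    using D(2)[of "[:0, 1:]" x] by (simp add: refl_pCons u.zero u.neg)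
  moreover have "D (D x) = act (P1 * P2) x" for x
  proof -
    obtain f where x: "x = (\<Sum>p\<in>{..<l} \<times> UNIV. act (f p) (v p))"
      using decomp_obtain[OF d UNIV_I] by blast
    have "D (D (v p)) = act (P1 * P2) (v p)" if "p \<in> {..<l} \<times> UNIV" for p
      using that D(3)[OF that] by (auto simp: w_def D(2) D(3) refl_mult split: if_splits)
    then show ?thesis
      unfolding x by (simp add: D.sum D(2) act_sum act_commute[of "P1 * P2"] cong: sum.cong)
  qed
  ultimately have "twisted D" using D(1) by (simp add: twisted_def)
  then show ?thesis by blast
qed

lemma paired_imp_annihilated:
  assumes p: "paired l R k e v"
  shows "\<exists>N. \<forall>x. act ((P1 * P2) ^ N) x = 0"
proof -
  have d: "decomp ({..<l} \<times> UNIV) (\<lambda>(i, b). R i ^ (if b then k i else e i)) v UNIV"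
    and R: "\<And>i. i < l \<Longrightarrow> R i \<in> {P1, P2}" "\<And>i. i < l \<Longrightarrow> k i \<le> e i"
    using p by (auto simp: paired_def)
  define N where "N = (\<Sum>i<l. e i)"
  have "R i ^ (if b then k i else e i) dvd (P1 * P2) ^ N" if "i < l" for i b
  proof -
    have "e i \<le> N" unfolding N_def using that by (intro member_le_sum) auto
    then have "(if b then k i else e i) \<le> N" using R(2)[OF that] by auto
    moreover have "R i dvd P1 * P2" using R(1)[OF that] by auto
    ultimately show ?thesis by (meson dvd_power_same dvd_trans le_imp_power_dvd)
  qed
  then have z: "act ((P1 * P2) ^ N) (v p) = 0" if "p \<in> {..<l} \<times> UNIV" for p
    using decomp_ann[OF d that] that by auto
  have "act ((P1 * P2) ^ N) x = 0" for x
  proof -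
    obtain f where x: "x = (\<Sum>p\<in>{..<l} \<times> UNIV. act (f p) (v p))"
      using decomp_obtain[OF d UNIV_I] by blast
    show ?thesis unfolding x act_sum by (rule sum.neutral) (metis act_commute act_zero z)
  qed
  then show ?thesis by blast
qed

theorem difference_iff_paired:
  assumes fd: "finite_dimensional_vector_space scale Basis"
  shows "pq_difference scale [:n, - T, 1:] [:m, - S, 1:] u \<and> (\<exists>N. \<forall>x. act ((P1 * P2) ^ N) x = 0)
    \<longleftrightarrow> (\<exists>l R k e v. paired l R k e v)"
proof
  assume l: "pq_difference scale [:n, - T, 1:] [:m, - S, 1:] u \<and> (\<exists>N. \<forall>x. act ((P1 * P2) ^ N) x = 0)"
  then obtain a b where "Vector_Spaces.linear scale scale a" "Vector_Spaces.linear scale scale b"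
    "\<And>v. poly_endo scale [:n, - T, 1:] a v = 0" "\<And>v. poly_endo scale [:m, - S, 1:] b v = 0"
    "\<And>v. u v = a v - b v" unfolding pq_difference_def by blast
  from twisted_imp_paired[OF twisted_commutator[OF this] fd] l
  show "\<exists>l R k e v. paired l R k e v" by blast
next
  assume "\<exists>l R k e v. paired l R k e v"
  then obtain l R k e v where p: "paired l R k e v" by blast
  then obtain N where N: "\<And>x. act ((P1 * P2) ^ N) x = 0" using paired_imp_annihilated by blast
  \<comment> \<open>2 t - \<delta> is comaximal with both quadratics, hence with the power that
    kills the space; its Bezout coefficient s then acts as the inverse of 2 u - \<delta>.\<close>
  have "comaximal ((P1 * P2) ^ N) [:- \<delta>, 1 + 1:]"
    unfolding P1_def P2_def
    using comaximal_power[where m = N and n = 1] comaximal_mult_right comaximal_sym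
      derivative_comaximal[OF disc1] derivative_comaximal[OF disc2]
    by (metis power_one_right)
  then obtain a s where as: "a * (P1 * P2) ^ N + s * [:- \<delta>, 1 + 1:] = 1"
    unfolding comaximal_def by blast
  have "act s (act [:- \<delta>, 1 + 1:] x) = x" for x
  proof -
    have "x = act (a * (P1 * P2) ^ N + s * [:- \<delta>, 1 + 1:]) x" unfolding as by simp
    also have "\<dots> = act a (act ((P1 * P2) ^ N) x) + act s (act [:- \<delta>, 1 + 1:] x)"
      by (simp only: act_add_left act_mult)
    finally show ?thesis by (simp only: N act_zero add_0_left)
  qed
  moreover obtain D where "twisted D" using paired_imp_twisted[OF p] by blast
  ultimately have "pq_difference scale [:n, - T, 1:] [:m, - S, 1:] u"
    using twisted_imp_difference by blast
  then show "pq_difference scale [:n, - T, 1:] [:m, - S, 1:] u \<and> (\<exists>N. \<forall>x. act ((P1 * P2) ^ N) x = 0)"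
    using N by blast
qed

end

section \<open>Invariant factors and block forms\<close>

lemma antitone_enumeration:
  fixes \<alpha> :: "'i \<Rightarrow> nat"
  assumes "finite J"
  shows "\<exists>\<sigma>. bij_betw \<sigma> {..<card J} J \<and> (\<forall>i j. i \<le> j \<longrightarrow> j < card J \<longrightarrow> \<alpha> (\<sigma> j) \<le> \<alpha> (\<sigma> i))"
proof -
  obtain xs where xs: "set xs = J" "distinct xs" using finite_distinct_list[OF assms] by blast
  \<comment> \<open>Sorting is ascending, so the key is negated, and for that purpose it takes
    integer values.\<close>
  define ys where "ys = sort_key (\<lambda>x. - int (\<alpha> x)) xs"
  have ys: "set ys = J" "distinct ys" "length ys = card J"
    using xs distinct_card[of xs] by (simp_all add: ys_def)
  have "sorted (map (\<lambda>x. - int (\<alpha> x)) ys)" by (simp add: ys_def)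
  then have "\<alpha> (ys ! j) \<le> \<alpha> (ys ! i)" if "i \<le> j" "j < card J" for i j
    using sorted_nth_mono[of "map (\<lambda>x. - int (\<alpha> x)) ys" i j] that ys by simp
  then show ?thesis using bij_betw_nth[OF ys(2) refl, of J] ys by (intro exI[of _ "(!) ys"]) auto
qed

text \<open>If the gap were at least 2, then the sets \<open>{p. \<alpha> p \<ge> c}\<close> and \<open>{p. \<alpha> p \<ge> c + 1}\<close> would both
  have the odd cardinality \<open>2 j + 1\<close>, so \<open>\<alpha>\<close> would omit \<open>c\<close> and the first set would be
  a union of pairs.\<close>

lemma paired_enumeration_gap:
  fixes \<alpha> :: "nat \<times> bool \<Rightarrow> nat"
  assumes pair: "\<And>i. i < l \<Longrightarrow> \<alpha> (i, True) \<le> \<alpha> (i, False) \<and> \<alpha> (i, False) \<le> \<alpha> (i, True) + 1"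
    and \<sigma>: "bij_betw \<sigma> {..<2 * l} ({..<l} \<times> UNIV)"
    and anti: "\<And>i j. i \<le> j \<Longrightarrow> j < 2 * l \<Longrightarrow> \<alpha> (\<sigma> j) \<le> \<alpha> (\<sigma> i)"
    and j: "j < l"
  shows "\<alpha> (\<sigma> (2 * j)) \<le> \<alpha> (\<sigma> (2 * j + 1)) + 1"
proof (rule ccontr)
  assume gap: "\<not> \<alpha> (\<sigma> (2 * j)) \<le> \<alpha> (\<sigma> (2 * j + 1)) + 1"
  define c where "c = \<alpha> (\<sigma> (2 * j + 1)) + 1"
  let ?J = "{..<l} \<times> (UNIV :: bool set)"
  have card: "card {p \<in> ?J. d \<le> \<alpha> p} = 2 * j + 1" if "d \<in> {c, c + 1}" for d
  proof -
    have s: "{i \<in> {..<2 * l}. d \<le> \<alpha> (\<sigma> i)} = {..<2 * j + 1}"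
    proof (intro equalityI subsetI)
      fix i assume i: "i \<in> {i \<in> {..<2 * l}. d \<le> \<alpha> (\<sigma> i)}"
      show "i \<in> {..<2 * j + 1}"
      proof (rule ccontr)
        assume "i \<notin> {..<2 * j + 1}"
        then have "\<alpha> (\<sigma> i) \<le> \<alpha> (\<sigma> (2 * j + 1))" using i by (intro anti) auto
        then show False using i that by (auto simp: c_def)
      qed
    next
      fix i assume i: "i \<in> {..<2 * j + 1}"
      then have "\<alpha> (\<sigma> (2 * j)) \<le> \<alpha> (\<sigma> i)" using j by (intro anti) auto
      then show "i \<in> {i \<in> {..<2 * l}. d \<le> \<alpha> (\<sigma> i)}" using i j gap that by (auto simp: c_def)
    qed
    have b: "bij_betw \<sigma> {i \<in> {..<2 * l}. d \<le> \<alpha> (\<sigma> i)} {p \<in> ?J. d \<le> \<alpha> p}"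
      unfolding bij_betw_def
    proof
      show "inj_on \<sigma> {i \<in> {..<2 * l}. d \<le> \<alpha> (\<sigma> i)}"
        by (rule inj_on_subset[OF bij_betw_imp_inj_on[OF \<sigma>]]) auto
      have J: "\<sigma> ` {..<2 * l} = ?J" using \<sigma> by (simp add: bij_betw_def)
      show "\<sigma> ` {i \<in> {..<2 * l}. d \<le> \<alpha> (\<sigma> i)} = {p \<in> ?J. d \<le> \<alpha> p}"
        unfolding J[symmetric] by (rule Compr_image_eq[symmetric])
    qed
    show ?thesis using bij_betw_same_card[OF b] unfolding s by simp
  qed
  have "{p \<in> ?J. c + 1 \<le> \<alpha> p} = {p \<in> ?J. c \<le> \<alpha> p}"
  proof (rule card_subset_eq)
    show "card {p \<in> ?J. c + 1 \<le> \<alpha> p} = card {p \<in> ?J. c \<le> \<alpha> p}"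
      using card[of c] card[of "c + 1"] by simp
    show "finite {p \<in> ?J. c \<le> \<alpha> p}" by (rule finite_subset[of _ ?J]) auto
  qed auto
  then have omit: "c + 1 \<le> \<alpha> p" if "p \<in> ?J" "c \<le> \<alpha> p" for p using that by blast
  \<comment> \<open>Within a pair the values differ by at most 1. If they lay on different sides of
    the threshold c, the larger one would be c itself, which is omitted.\<close>
  have "c \<le> \<alpha> (i, False) \<longleftrightarrow> c \<le> \<alpha> (i, True)" if "i < l" for i
    using pair[OF that] omit[of "(i, False)"] that by auto
  then have eq: "c \<le> \<alpha> (i, b) \<longleftrightarrow> c \<le> \<alpha> (i, True)" if "i < l" for i b
    using that by (cases b) auto
  then have "{p \<in> ?J. c \<le> \<alpha> p} = {i \<in> {..<l}. c \<le> \<alpha> (i, True)} \<times> UNIV" by auto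
  then have "even (card {p \<in> ?J. c \<le> \<alpha> p})" by (simp add: card_cartesian_product)
  then show False by (simp add: card)
qed

lemma diag_block_mat_concat:
  "diag_block_mat (concat Ass) = diag_block_mat (map diag_block_mat Ass)"
  by (induction Ass) (simp_all add: diag_block_mat_append Let_def)

section \<open>Block matrices and invariant factors of a paired decomposition\<close>

context irreducible_pair
begin

lemma monic_P1: "Polynomial.lead_coeff P1 = 1" and monic_P2: "Polynomial.lead_coeff P2 = 1"
  by (simp_all add: P1_def P2_def)

lemma monic_power_mult: "Polynomial.lead_coeff (P1 ^ i * P2 ^ j) = 1"
  by (simp add: lead_coeff_mult lead_coeff_power monic_P1 monic_P2)

lemma P1_neq_P2: "P1 \<noteq> P2"
  using N1_neq_N2 by (simp add: P1_def P2_def)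

text \<open>In this order the two members of a pair are adjacent, so the companion matrices of a
  paired decomposition group themselves into the blocks of the third condition.\<close>

definition pair_index :: "nat \<Rightarrow> (nat \<times> bool) list" where
  "pair_index l = concat (map (\<lambda>i. [(i, False), (i, True)]) [0..<l])"

lemma pair_index_Suc: "pair_index (Suc l) = pair_index l @ [(l, False), (l, True)]"
  by (simp add: pair_index_def)

lemma set_pair_index: "set (pair_index l) = {..<l} \<times> UNIV"
proof (rule Set.set_eqI)
  show "p \<in> set (pair_index l) \<longleftrightarrow> p \<in> {..<l} \<times> UNIV" for p
    by (cases p; cases "snd p") (auto simp: pair_index_def)
qed

lemma distinct_pair_index: "distinct (pair_index l)"
proof (induction l)
  case (Suc l)
  then show ?case by (simp add: pair_index_Suc set_pair_index)
qed (simp add: pair_index_def)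

lemma diag_pair_index:
  "diag_block_mat (map companion (map r (pair_index l)))
   = diag_block_mat (map (\<lambda>i. diag_block_mat [companion (r (i, False)), companion (r (i, True))]) [0..<l])"
proof -
  have "map companion (map r (pair_index l))
      = concat (map (\<lambda>i. [companion (r (i, False)), companion (r (i, True))]) [0..<l])"
    by (simp add: pair_index_def map_concat comp_def)
  then show ?thesis by (simp only: diag_block_mat_concat map_map comp_def)
qed

theorem paired_iff_blocks:
  "(\<exists>l R k e v. paired l R k e v) \<longleftrightarrow>
   (\<exists>Bs. represented_by scale UNIV u (diag_block_mat Bs) \<and>
     (\<forall>B\<in>set Bs. \<exists>R\<in>{P1, P2}. \<exists>k. \<exists>e\<in>{0, 1}.
        B = diag_block_mat [companion (R ^ (k + e)), companion (R ^ k)]))"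
proof
  assume "\<exists>l R k e v. paired l R k e v"
  then obtain l R k e v where p: "paired l R k e v" by blast
  let ?r = "\<lambda>(i, b). R i ^ (if b then k i else e i)"
  let ?B = "\<lambda>i. diag_block_mat [companion (R i ^ e i), companion (R i ^ k i)]"
  have "Polynomial.lead_coeff (?r p) = 1" if "p \<in> set (pair_index l)" for p
    using p that by (auto simp: paired_def set_pair_index lead_coeff_power monic_P1 monic_P2)
  then have "represented_by scale UNIV u (diag_block_mat (map companion (map ?r (pair_index l))))"
    by (intro decomp_imp_represented_by[of _ _ v])
       (use p in \<open>auto simp: paired_def set_pair_index distinct_pair_index\<close>)
  then have "represented_by scale UNIV u (diag_block_mat (map ?B [0..<l]))"
    unfolding diag_pair_index by simp
  moreover have "\<exists>R\<in>{P1, P2}. \<exists>k. \<exists>e\<in>{0, 1}.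
      B = diag_block_mat [companion (R ^ (k + e)), companion (R ^ k)]" if "B \<in> set (map ?B [0..<l])" for B
  proof -
    from that obtain i where i: "i < l" "B = ?B i" by (auto simp del: diag_block_mat.simps)
    then have "R i \<in> {P1, P2}" "e i = k i + (e i - k i)" "e i - k i \<in> {0, 1}"
      using p by (auto simp: paired_def)
    then show ?thesis using i(2) by metis
  qed
  ultimately show "\<exists>Bs. represented_by scale UNIV u (diag_block_mat Bs) \<and>
     (\<forall>B\<in>set Bs. \<exists>R\<in>{P1, P2}. \<exists>k. \<exists>e\<in>{0, 1}.
        B = diag_block_mat [companion (R ^ (k + e)), companion (R ^ k)])" by blast
next
  assume "\<exists>Bs. represented_by scale UNIV u (diag_block_mat Bs) \<and>
     (\<forall>B\<in>set Bs. \<exists>R\<in>{P1, P2}. \<exists>k. \<exists>e\<in>{0, 1}.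
        B = diag_block_mat [companion (R ^ (k + e)), companion (R ^ k)])"
  then obtain Bs where rep: "represented_by scale UNIV u (diag_block_mat Bs)"
    and B: "\<forall>B\<in>set Bs. \<exists>R\<in>{P1, P2}. \<exists>k. \<exists>e\<in>{0, 1}.
        B = diag_block_mat [companion (R ^ (k + e)), companion (R ^ k)]" by blast
  define l where "l = length Bs"
  have "\<forall>i. \<exists>R k e. i < l \<longrightarrow> R \<in> {P1, P2} \<and> e \<in> {0, 1} \<and>
      Bs ! i = diag_block_mat [companion (R ^ (k + e)), companion (R ^ k)]"
    using B unfolding l_def by (meson nth_mem)
  then obtain R k e where Rke: "\<And>i. i < l \<Longrightarrow> R i \<in> {P1, P2}" "\<And>i. i < l \<Longrightarrow> e i \<in> {0, 1 :: nat}"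
      "\<And>i. i < l \<Longrightarrow> Bs ! i = diag_block_mat [companion (R i ^ (k i + e i)), companion (R i ^ k i)]"
    by metis
  let ?r = "\<lambda>(i, b). R i ^ (if b then k i else k i + e i)"
  have "Bs = map (\<lambda>i. diag_block_mat [companion (?r (i, False)), companion (?r (i, True))]) [0..<l]"
    by (rule nth_equalityI) (simp_all add: l_def[symmetric] Rke)
  then have rep': "represented_by scale UNIV u (diag_block_mat (map companion (map ?r (pair_index l))))"
    using rep unfolding diag_pair_index by metis
  have "Polynomial.lead_coeff q = 1" if "q \<in> set (map ?r (pair_index l))" for q
  proof -
    from that obtain i b where i: "i < l" "q = R i ^ (if b then k i else k i + e i)"
      by (auto simp: set_pair_index)
    have "Polynomial.lead_coeff (R i) = 1" using Rke(1)[OF i(1)] monic_P1 monic_P2 by auto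
    then show ?thesis by (simp add: i lead_coeff_power)
  qed
  with represented_by_imp_decomp[OF rep']
  obtain v where d: "decomp {..<length (map ?r (pair_index l))} ((!) (map ?r (pair_index l))) v UNIV"
    by blast
  \<comment> \<open>The decomposition read off from the matrix is indexed by list positions; \<pi>
    sends a pair to its position.\<close>
  define \<pi> where "\<pi> = the_inv_into {..<length (pair_index l)} ((!) (pair_index l))"
  have b: "bij_betw ((!) (pair_index l)) {..<length (pair_index l)} ({..<l} \<times> UNIV)"
    by (rule bij_betw_nth) (simp_all add: distinct_pair_index set_pair_index)
  then have \<pi>: "bij_betw \<pi> ({..<l} \<times> UNIV) {..<length (pair_index l)}"
    unfolding \<pi>_def by (rule bij_betw_the_inv_into)
  have \<pi>_nth: "\<pi> p < length (pair_index l)" "pair_index l ! \<pi> p = p" if "p \<in> {..<l} \<times> UNIV" for p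
    using \<pi> that f_the_inv_into_f_bij_betw[OF b, of p] by (auto simp: bij_betw_def \<pi>_def)
  have "decomp ({..<l} \<times> UNIV) ((!) (map ?r (pair_index l)) \<circ> \<pi>) (v \<circ> \<pi>) UNIV"
    by (rule decomp_reindex[OF d]) (simp add: \<pi>)
  then have "decomp ({..<l} \<times> UNIV) ?r (v \<circ> \<pi>) UNIV"
    by (rule decomp_cong) (simp_all only: comp_apply nth_map \<pi>_nth)
  then have "paired l R k (\<lambda>i. k i + e i) (v \<circ> \<pi>)"
    using Rke(1,2) unfolding paired_def by fastforce
  then show "\<exists>l R k e v. paired l R k e v" by blast
qed

text \<open>The passage from elementary divisors to invariant factors. Every summand receives an
  exponent for P1 and one for P2, at least one of them 0; the two families are sorted in decreasing
  order independently and multiplied term by term. The bound on the drop between positions 2 j and 2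
  j + 1 provides a and b.\<close>

lemma paired_imp_invariant_factors:
  assumes p: "paired l R k e v"
  shows "\<exists>r. is_invariant_factors scale u r \<and>
      (\<forall>k\<ge>1. \<exists>a\<in>{0, 1}. \<exists>b\<in>{0, 1}. r (2 * k - 1) = r (2 * k) * (P1 ^ a * P2 ^ b)) \<and>
      (\<exists>m n. r 1 = P1 ^ m * P2 ^ n) \<and> is_minimal_polynomial scale u (r 1)"
proof -
  let ?J = "{..<l} \<times> (UNIV :: bool set)"
  have d: "decomp ?J (\<lambda>(i, b). R i ^ (if b then k i else e i)) v UNIV"
    and R: "\<And>i. i < l \<Longrightarrow> R i \<in> {P1, P2}" "\<And>i. i < l \<Longrightarrow> k i \<le> e i \<and> e i \<le> k i + 1"
    using p by (auto simp: paired_def)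
  define \<alpha> where "\<alpha> P = (\<lambda>(i, b). if R i = P then (if b then k i else e i) else 0)" for P
  have "decomp ?J (\<lambda>p. P1 ^ \<alpha> P1 p * P2 ^ \<alpha> P2 p) v UNIV"
    by (rule decomp_cong[OF d]) (use R(1) P1_neq_P2 in \<open>fastforce simp: \<alpha>_def\<close>)+
  from decomp_split[OF this comaximal_power[OF P1_P2_comaximal]]
  obtain v' where d1: "decomp (?J \<times> UNIV) (\<lambda>(p, b). if b then P2 ^ \<alpha> P2 p else P1 ^ \<alpha> P1 p) v' UNIV"
    by blast
  have fin: "finite ?J" and cJ: "card ?J = 2 * l" by (simp_all add: card_cartesian_product)
  obtain \<sigma>1 where s1: "bij_betw \<sigma>1 {..<2 * l} ?J"
    "\<And>i j. i \<le> j \<Longrightarrow> j < 2 * l \<Longrightarrow> \<alpha> P1 (\<sigma>1 j) \<le> \<alpha> P1 (\<sigma>1 i)"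
    using antitone_enumeration[OF fin, of "\<alpha> P1"] unfolding cJ by blast
  obtain \<sigma>2 where s2: "bij_betw \<sigma>2 {..<2 * l} ?J"
    "\<And>i j. i \<le> j \<Longrightarrow> j < 2 * l \<Longrightarrow> \<alpha> P2 (\<sigma>2 j) \<le> \<alpha> P2 (\<sigma>2 i)"
    using antitone_enumeration[OF fin, of "\<alpha> P2"] unfolding cJ by blast
  define x y where "x i = \<alpha> P1 (\<sigma>1 i)" and "y i = \<alpha> P2 (\<sigma>2 i)" for i
  have \<alpha>: "\<alpha> P (i, True) \<le> \<alpha> P (i, False) \<and> \<alpha> P (i, False) \<le> \<alpha> P (i, True) + 1" if "i < l" for P i
    using R(2)[OF that] by (auto simp: \<alpha>_def)
  have gap: "x (2 * j) \<le> x (2 * j + 1) + 1" "y (2 * j) \<le> y (2 * j + 1) + 1" if "j < l" for j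
    unfolding x_def y_def
    using paired_enumeration_gap[OF \<alpha> s1 that] paired_enumeration_gap[OF \<alpha> s2 that] by simp_all
  have anti: "x j \<le> x i" "y j \<le> y i" if "i \<le> j" "j < 2 * l" for i j
    using s1(2)[OF that] s2(2)[OF that] by (simp_all add: x_def y_def)
  \<comment> \<open>The sorting enumerations for P1 and for P2 are applied separately, to the two
    halves of the split decomposition.\<close>
  define \<tau> where "\<tau> = (\<lambda>(i, b). (if b then \<sigma>2 i else \<sigma>1 i, b))"
  have "bij_betw \<tau> ({..<2 * l} \<times> UNIV) (?J \<times> UNIV)"
    unfolding bij_betw_def
  proof
    show "inj_on \<tau> ({..<2 * l} \<times> UNIV)"
      using s1(1) s2(1) by (auto simp: inj_on_def \<tau>_def bij_betw_def split: if_splits)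
    show "\<tau> ` ({..<2 * l} \<times> UNIV) = ?J \<times> UNIV"
    proof (intro equalityI subsetI)
      fix p assume "p \<in> ?J \<times> (UNIV :: bool set)"
      then obtain q b where p: "p = (q, b)" "q \<in> ?J" by auto
      obtain i1 i2 where "i1 < 2 * l" "q = \<sigma>1 i1" "i2 < 2 * l" "q = \<sigma>2 i2"
        using s1(1) s2(1) p(2) unfolding bij_betw_def by blast
      then have "p = \<tau> (if b then i2 else i1, b)" "(if b then i2 else i1, b) \<in> {..<2 * l} \<times> UNIV"
        using p by (auto simp: \<tau>_def)
      then show "p \<in> \<tau> ` ({..<2 * l} \<times> UNIV)" by blast
    next
      fix p assume "p \<in> \<tau> ` ({..<2 * l} \<times> UNIV)"
      then show "p \<in> ?J \<times> (UNIV :: bool set)"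
        using bij_betwE[OF s1(1)] bij_betwE[OF s2(1)] by (auto simp: \<tau>_def split: if_splits)
    qed
  qed
  from decomp_reindex[OF d1 this]
  have "decomp ({..<2 * l} \<times> UNIV) (\<lambda>(i, b). if b then P2 ^ y i else P1 ^ x i) (v' \<circ> \<tau>) UNIV"
    by (rule decomp_cong) (auto simp: \<tau>_def x_def y_def)
  from decomp_merge[OF this comaximal_power[OF P1_P2_comaximal]]
  obtain w where d2: "decomp {..<2 * l} (\<lambda>i. P1 ^ x i * P2 ^ y i) w UNIV" by blast
  define r where "r i = (if 1 \<le> i \<and> i \<le> 2 * l then P1 ^ x (i - 1) * P2 ^ y (i - 1) else 1)" for i
  have monic: "Polynomial.lead_coeff (r i) = 1" for i
    unfolding r_def using monic_power_mult by simp
  have dvd: "r (i + 1) dvd r i" if "i \<ge> 1" for i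
  proof (cases "i + 1 \<le> 2 * l")
    case True
    then have "x i \<le> x (i - 1)" "y i \<le> y (i - 1)" using anti[of "i - 1" i] by auto
    then have "P1 ^ x i * P2 ^ y i dvd P1 ^ x (i - 1) * P2 ^ y (i - 1)"
      by (intro mult_dvd_mono le_imp_power_dvd)
    then show ?thesis using True that by (simp add: r_def)
  qed (simp add: r_def)
  have "represented_by scale UNIV u
      (diag_block_mat (map companion (map (\<lambda>i. P1 ^ x i * P2 ^ y i) [0..<2 * l])))"
    by (rule decomp_imp_represented_by[of _ _ w])
       (use d2 in \<open>auto simp: monic_power_mult lessThan_atLeast0\<close>)
  moreover have "map companion (map (\<lambda>i. P1 ^ x i * P2 ^ y i) [0..<2 * l])
      = map (\<lambda>i. companion (r i)) [1..<2 * l + 1]"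
    by (rule nth_equalityI) (auto simp: r_def simp del: upt_Suc)
  ultimately have "represented_by scale UNIV u (diag_block_mat (map (\<lambda>i. companion (r i)) [1..<2 * l + 1]))"
    by simp
  moreover have "\<forall>i>2 * l. r i = 1" by (simp add: r_def)
  ultimately have inv: "is_invariant_factors scale u r"
    unfolding is_invariant_factors_def using monic dvd by blast
  have "\<exists>a\<in>{0, 1}. \<exists>b\<in>{0, 1}. r (2 * j - 1) = r (2 * j) * (P1 ^ a * P2 ^ b)" if "j \<ge> 1" for j
  proof (cases "j \<le> l")
    case True
    define i where "i = j - 1"
    have i: "j = i + 1" "i < l" using that True by (simp_all add: i_def)
    have "x (2 * i) = x (2 * i + 1) + (x (2 * i) - x (2 * i + 1))"
      "y (2 * i) = y (2 * i + 1) + (y (2 * i) - y (2 * i + 1))"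
      "x (2 * i) - x (2 * i + 1) \<in> {0, 1}" "y (2 * i) - y (2 * i + 1) \<in> {0, 1}"
      using gap[OF i(2)] anti[of "2 * i" "2 * i + 1"] i(2) by auto
    moreover have "r (2 * j - 1) = P1 ^ x (2 * i) * P2 ^ y (2 * i)"
      "r (2 * j) = P1 ^ x (2 * i + 1) * P2 ^ y (2 * i + 1)"
      using i by (simp_all add: r_def)
    moreover have "P1 ^ (a + b) * P2 ^ (c + d) = (P1 ^ a * P2 ^ c) * (P1 ^ b * P2 ^ d)" for a b c d
      by (simp add: power_add mult_ac)
    ultimately show ?thesis by metis
  next
    case False
    then have "2 * l < 2 * j - 1" "2 * l < 2 * j" by linarith+
    then have "r (2 * j - 1) = r (2 * j) * (P1 ^ 0 * P2 ^ 0)" by (simp add: r_def)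
    then show ?thesis by blast
  qed
  moreover have "\<exists>m n. r 1 = P1 ^ m * P2 ^ n"
  proof (cases "l = 0")
    case True
    then have "r 1 = P1 ^ 0 * P2 ^ 0" by (simp add: r_def)
    then show ?thesis by blast
  qed (auto simp: r_def)
  \<comment> \<open>\<open>r 1\<close> kills every generator because the other factors divide it,
    and it is the exact annihilator of \<open>w 0\<close>. For l = 0 the space is zero and
    \<open>r 1\<close> is 1.\<close>
  moreover have "is_minimal_polynomial scale u (r 1)"
    unfolding is_minimal_polynomial_def
  proof (intro conjI allI impI)
    show "Polynomial.lead_coeff (r 1) = 1" by (rule monic)
    fix z
    obtain f where z: "z = (\<Sum>i<2 * l. act (f i) (w i))" using decomp_obtain[OF d2 UNIV_I] by blast
    have w: "act (r 1) (w i) = 0" if "i < 2 * l" for i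
    proof -
      have "P1 ^ x i * P2 ^ y i dvd r 1"
        using that anti[of 0 i] by (auto simp: r_def intro!: mult_dvd_mono le_imp_power_dvd)
      then show ?thesis using decomp_ann[OF d2, of i] that by simp
    qed
    show "act (r 1) z = 0"
      unfolding z act_sum by (rule sum.neutral) (metis act_commute act_zero lessThan_iff w)
  next
    fix f assume f: "\<forall>v. act f v = 0"
    show "r 1 dvd f"
    proof (cases "l = 0")
      case False
      then have "P1 ^ x 0 * P2 ^ y 0 dvd f" using decomp_ann[OF d2, of 0 f] f by simp
      then show ?thesis using False by (simp add: r_def)
    qed (simp add: r_def)
  qed
  ultimately show ?thesis using inv by blast
qed

text \<open>All invariant factors divide the minimal polynomial, so they are products of powers of
  P1 and P2. Splitting two consecutive factors into primary parts yields one pair for P1, with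
  exponent difference a, and one for P2, with difference b. The pairs for P2 are numbered from M
  on.\<close>

lemma invariant_factors_imp_paired:
  assumes mp: "is_minimal_polynomial scale u (P1 ^ a0 * P2 ^ b0)"
    and inv: "is_invariant_factors scale u r"
    and r: "\<And>k. k \<ge> 1 \<Longrightarrow> \<exists>a\<in>{0, 1}. \<exists>b\<in>{0, 1}. r (2 * k - 1) = r (2 * k) * (P1 ^ a * P2 ^ b)"
  shows "\<exists>l R k e v. paired l R k e v"
proof -
  obtain M where M: "\<And>i. i > M \<Longrightarrow> r i = 1"
    "represented_by scale UNIV u (diag_block_mat (map (\<lambda>i. companion (r i)) [1..<M + 1]))"
    and monic: "\<And>i. i \<ge> 1 \<Longrightarrow> Polynomial.lead_coeff (r i) = 1"
    using inv unfolding is_invariant_factors_def by blast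
  have eq: "map (\<lambda>i. companion (r i)) [1..<M + 1] = map companion (map r [1..<M + 1])" by simp
  have "Polynomial.lead_coeff q = 1" if "q \<in> set (map r [1..<M + 1])" for q
    using that monic by auto
  with represented_by_imp_decomp[OF M(2)[unfolded eq]] obtain v where
    d: "decomp {..<length (map r [1..<M + 1])} ((!) (map r [1..<M + 1])) v UNIV" by blast
  \<comment> \<open>The index range is going to be doubled, so that it is a union of consecutive
    pairs even when M is odd; from M on the generators are 0 and the factors are 1.\<close>
  define v1 where "v1 i = (if i < M then v i else 0)" for i
  have "decomp {..<length (map r [1..<M + 1])} (\<lambda>i. r (i + 1)) v1 UNIV"
    by (rule decomp_cong[OF d]) (auto simp: v1_def nth_append simp del: upt_Suc)
  then have d1: "decomp {..<2 * M} (\<lambda>i. r (i + 1)) v1 UNIV"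
    by (rule decomp_extend_trivial) (auto simp: v1_def M(1))
  have dv: "r (i + 1) dvd P1 ^ a0 * P2 ^ b0" if "i < 2 * M" for i
    using decomp_ann[OF d1, of i "P1 ^ a0 * P2 ^ b0"] that mp by (simp add: is_minimal_polynomial_def)
  have "\<forall>i. \<exists>A B a b. i < M \<longrightarrow> a \<in> {0, 1 :: nat} \<and> b \<in> {0, 1 :: nat} \<and> r (2 * i + 2) = P1 ^ A * P2 ^ B \<and>
      r (2 * i + 1) = P1 ^ (A + a) * P2 ^ (B + b)"
  proof
    fix i
    show "\<exists>A B a b. i < M \<longrightarrow> a \<in> {0, 1 :: nat} \<and> b \<in> {0, 1 :: nat} \<and> r (2 * i + 2) = P1 ^ A * P2 ^ B \<and>
      r (2 * i + 1) = P1 ^ (A + a) * P2 ^ (B + b)"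
    proof (cases "i < M")
      case True
      have "r (2 * i + 2) dvd P1 ^ a0 * P2 ^ b0" using dv[of "2 * i + 1"] True by simp
      then obtain A B where AB: "r (2 * i + 2) = P1 ^ A * P2 ^ B"
        using monic_dvd_powers[OF irr1 irr2 monic_P1 monic_P2] monic[of "2 * i + 2"] by fastforce
      obtain a b where ab: "a \<in> {0, 1}" "b \<in> {0, 1}"
        "r (2 * (i + 1) - 1) = r (2 * (i + 1)) * (P1 ^ a * P2 ^ b)"
        using r[OF le_add2[of 1 i]] by blast
      then have "r (2 * i + 1) = P1 ^ (A + a) * P2 ^ (B + b)"
        using AB by (simp add: power_add mult_ac)
      then show ?thesis using AB ab by blast
    qed simp
  qed
  then obtain A B a b where AB: "\<And>i. i < M \<Longrightarrow> a i \<in> {0, 1 :: nat}" "\<And>i. i < M \<Longrightarrow> b i \<in> {0, 1 :: nat}"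
    "\<And>i. i < M \<Longrightarrow> r (2 * i + 2) = P1 ^ A i * P2 ^ B i"
    "\<And>i. i < M \<Longrightarrow> r (2 * i + 1) = P1 ^ (A i + a i) * P2 ^ (B i + b i)" by metis
  \<comment> \<open>\<open>False\<close> goes to the even position 2 i, which carries
    \<open>r (2 * i + 1)\<close> because invariant factors are numbered from 1; it has the larger
    exponents.\<close>
  define \<pi> where "\<pi> = (\<lambda>(i, t). 2 * i + (if t then 1 else 0 :: nat))"
  have "bij_betw \<pi> ({..<M} \<times> UNIV) {..<2 * M}"
    by (rule bij_betwI[of _ _ _ "\<lambda>i. (i div 2, odd i)"]) (auto simp: \<pi>_def split: if_splits)
  from decomp_reindex[OF d1 this]
  have "decomp ({..<M} \<times> UNIV) (\<lambda>p. (case p of (i, t) \<Rightarrow> P1 ^ (if t then A i else A i + a i))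
      * (case p of (i, t) \<Rightarrow> P2 ^ (if t then B i else B i + b i))) (v1 \<circ> \<pi>) UNIV"
    by (rule decomp_cong) (use AB(3,4) in \<open>auto simp: \<pi>_def\<close>)
  from decomp_split[OF this] comaximal_power[OF P1_P2_comaximal]
  obtain v2 where d2: "decomp (({..<M} \<times> UNIV) \<times> UNIV) (\<lambda>(p, s).
      if s then (case p of (i, t) \<Rightarrow> P2 ^ (if t then B i else B i + b i))
      else (case p of (i, t) \<Rightarrow> P1 ^ (if t then A i else A i + a i))) v2 UNIV"
    by (metis (no_types, lifting) case_prod_unfold)
  define \<rho> where "\<rho> = (\<lambda>(j, t :: bool). ((if j < M then j else j - M, t), \<not> j < M))"
  have "bij_betw \<rho> ({..<2 * M} \<times> UNIV) (({..<M} \<times> UNIV) \<times> UNIV)"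
    by (rule bij_betwI[of _ _ _ "\<lambda>((i, t), s). (if s then i + M else i, t)"])
       (auto simp: \<rho>_def split: if_splits)
  from decomp_reindex[OF d2 this]
  have d3: "decomp ({..<2 * M} \<times> UNIV) (\<lambda>(j, t). (if j < M then P1 else P2) ^
      (if t then (if j < M then A j else B (j - M))
       else (if j < M then A j + a j else B (j - M) + b (j - M)))) (v2 \<circ> \<rho>) UNIV"
    by (rule decomp_cong) (auto simp: \<rho>_def)
  have "paired (2 * M) (\<lambda>j. if j < M then P1 else P2) (\<lambda>j. if j < M then A j else B (j - M))
      (\<lambda>j. if j < M then A j + a j else B (j - M) + b (j - M)) (v2 \<circ> \<rho>)"
    unfolding paired_def
  proof (rule conjI[OF d3], intro allI impI)
    fix i assume i: "i < 2 * M"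
    show "(if i < M then P1 else P2) \<in> {P1, P2} \<and>
      (if i < M then A i else B (i - M)) \<le> (if i < M then A i + a i else B (i - M) + b (i - M)) \<and>
      (if i < M then A i + a i else B (i - M) + b (i - M)) \<le> (if i < M then A i else B (i - M)) + 1"
    proof (cases "i < M")
      case False
      then have "i - M < M" using i by simp
      from AB(2)[OF this] show ?thesis using False by auto
    qed (use AB(1)[of i] in auto)
  qed
  then show ?thesis by blast
qed

theorem paired_iff_invariant_factors:
  "(\<exists>l R k e v. paired l R k e v) \<longleftrightarrow>
   (\<exists>m n. is_minimal_polynomial scale u (P1 ^ m * P2 ^ n)) \<and>
   (\<exists>r. is_invariant_factors scale u r \<and>
      (\<forall>k\<ge>1. \<exists>a\<in>{0, 1}. \<exists>b\<in>{0, 1}. r (2 * k - 1) = r (2 * k) * (P1 ^ a * P2 ^ b)))"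
  using paired_imp_invariant_factors invariant_factors_imp_paired by metis

end

section \<open>Eigenvalues in the algebraic closure\<close>

lemma map_poly_to_ac_pCons: "map_poly to_ac (pCons c f) = pCons (to_ac c) (map_poly to_ac f)"
  by (rule poly_eqI) (simp add: coeff_map_poly coeff_pCons split: nat.split)

lemma map_poly_to_ac_add: "map_poly to_ac (f + g) = map_poly to_ac f + map_poly to_ac g"
  by (rule poly_eqI) (simp add: coeff_map_poly)

lemma map_poly_to_ac_smult: "map_poly to_ac (Polynomial.smult c f) = Polynomial.smult (to_ac c) (map_poly to_ac f)"
  by (rule poly_eqI) (simp add: coeff_map_poly)

lemma map_poly_to_ac_mult: "map_poly to_ac (f * g) = map_poly to_ac f * map_poly to_ac g"
  by (induction f) (simp_all add: map_poly_to_ac_add map_poly_to_ac_smult map_poly_to_ac_pCons)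

lemma map_poly_to_ac_power: "map_poly to_ac (f ^ k) = map_poly to_ac f ^ k"
  by (induction k) (simp_all add: map_poly_to_ac_mult)

text \<open>Otherwise a Bezout identity between f and g, evaluated at the common root z, would read
  0 = 1.\<close>

lemma irreducible_dvd_common_root:
  fixes f g :: "'a::field poly"
  assumes "Factorial_Ring.irreducible f"
    "poly (map_poly to_ac f) z = 0" "poly (map_poly to_ac g) z = 0"
  shows "f dvd g"
proof (rule ccontr)
  assume "\<not> f dvd g"
  then obtain a b where "a * f + b * g = 1"
    using irreducible_comaximal[OF assms(1)] unfolding comaximal_def by blast
  then have "poly (map_poly to_ac (a * f + b * g)) z = 1" by simp
  then show False by (simp add: map_poly_to_ac_add map_poly_to_ac_mult assms)
qed

lemma coeff_Poly_map: "Polynomial.coeff (Poly (map c [0..<n])) i = (if i < n then c i else 0)"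
  by (simp add: nth_default_def)

section \<open>Annihilating polynomials, extension of scalars and eigenvalues\<close>

context endo
begin

lemma annihilator_exists_vector:
  assumes fd: "finite_dimensional_vector_space scale Basis"
  shows "\<exists>f. f \<noteq> 0 \<and> act f v = 0"
proof (rule ccontr)
  interpret fd: finite_dimensional_vector_space scale Basis by (rule fd)
  assume *: "\<nexists>f. f \<noteq> 0 \<and> act f v = 0"
  \<comment> \<open>One more iterate of v than the dimension: a linear relation must exist between
    them, and it is an annihilating polynomial.\<close>
  define bs where "bs = map (\<lambda>j. (u ^^ j) v) [0..<Suc (card Basis)]"
  have "basis_list (range (\<lambda>c. comb c bs)) bs"
    unfolding basis_list_def
  proof (intro conjI allI impI refl)
    fix c i assume "comb c bs = 0" and i: "i < length bs"
    then have "Poly (map c [0..<Suc (card Basis)]) = 0" using * unfolding bs_def comb_iterates by blast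
    then have "Polynomial.coeff (Poly (map c [0..<Suc (card Basis)])) i = 0" by simp
    then show "c i = 0" unfolding coeff_Poly_map using i by (simp add: bs_def)
  qed
  then have "distinct bs" "independent (set bs)"
    unfolding ordered_basis_iff_basis_list[symmetric] ordered_basis_def by auto
  moreover from this have "card (set bs) = Suc (card Basis)"
    by (subst distinct_card) (simp_all add: bs_def)
  ultimately show False
    using fd.independent_card_le_dim[of "set bs" UNIV] by simp
qed

lemma annihilator_exists:
  assumes fd: "finite_dimensional_vector_space scale Basis"
  shows "\<exists>f. f \<noteq> 0 \<and> (\<forall>v. act f v = 0)"
proof -
  interpret fd: finite_dimensional_vector_space scale Basis by (rule fd)
  obtain F where F: "\<And>v. F v \<noteq> 0" "\<And>v. act (F v) v = 0"
    using annihilator_exists_vector[OF fd] by metis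
  define f where "f = (\<Prod>b\<in>Basis. F b)"
  have "f \<noteq> 0" using F(1) fd.finite_Basis by (simp add: f_def)
  moreover have "act f v = 0" for v
  proof -
    have "v \<in> span Basis" by (simp add: fd.span_Basis)
    then show ?thesis
    proof (induction rule: span_induct_alt)
      case (step c b y)
      have "F b dvd f" unfolding f_def using step(1) fd.finite_Basis by (rule dvd_prodI[rotated])
      then have "act f b = 0" using F(2) act_dvd by blast
      then show ?case using step by (simp add: act_add act_scale)
    qed simp
  qed
  ultimately show ?thesis by blast
qed

lemma matrix_exists:
  assumes fd: "finite_dimensional_vector_space scale Basis"
  shows "\<exists>A. represented_by scale UNIV u A"
proof -
  interpret fd: finite_dimensional_vector_space scale Basis by (rule fd)
  obtain bs where bs: "set bs = Basis" "distinct bs" using finite_distinct_list[OF fd.finite_Basis] by blast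
  then have b: "basis_list UNIV bs"
    unfolding ordered_basis_iff_basis_list[symmetric] ordered_basis_def
    using fd.independent_Basis fd.span_Basis by simp
  then have "\<forall>x. \<exists>c. x = comb c bs" unfolding basis_list_def by blast
  then obtain c where c: "\<And>x. x = comb (c x) bs" by metis
  let ?A = "mat (length bs) (length bs) (\<lambda>(i, j). c (u (bs ! j)) i)"
  have "u (bs ! j) = comb (\<lambda>i. ?A $$ (i, j)) bs" if "j < length bs" for j
    by (subst c[of "u (bs ! j)"], rule comb_cong) (use that in simp)
  then show ?thesis unfolding represented_by_iff using b by (intro exI[of _ ?A] exI[of _ bs]) simp
qed

text \<open>Polynomials of degree less than \<open>n\<close> serve as coordinate vectors of length \<open>n\<close> over the
  algebraic closure, so that \<open>poly_endo\<close> also applies to the extension of scalars of \<open>u\<close>.\<close>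

lemma scalar_extension:
  assumes A: "represented_by scale UNIV u A"
  obtains U \<Phi> where "endo Polynomial.smult U"
    "\<And>f x. \<Phi> (act f x) = poly_endo Polynomial.smult (map_poly to_ac f) U (\<Phi> x)"
    "\<And>x. \<Phi> x = 0 \<Longrightarrow> x = 0"
    "\<And>x i. i \<ge> dim_row A \<Longrightarrow> Polynomial.coeff (\<Phi> x) i = 0"
    "\<And>w i. Polynomial.coeff (U w) i =
      (if i < dim_row A then \<Sum>j<dim_row A. to_ac (A $$ (i, j)) * Polynomial.coeff w j else 0)"
    "\<And>w. (\<And>i. i \<ge> dim_row A \<Longrightarrow> Polynomial.coeff w i = 0) \<Longrightarrow>
       \<exists>h vs. w = (\<Sum>i<dim_row A. Polynomial.smult (h i) (\<Phi> (vs i)))"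
proof -
  obtain bs where bs: "basis_list UNIV bs" and cA: "A \<in> carrier_mat (length bs) (length bs)"
    and uA: "\<And>j. j < length bs \<Longrightarrow> u (bs ! j) = comb (\<lambda>i. A $$ (i, j)) bs"
    using A unfolding represented_by_iff by blast
  define n where "n = length bs"
  have n: "dim_row A = n" using cA by (simp add: n_def)
  have "\<forall>x. \<exists>c. x = comb c bs" using bs unfolding basis_list_def by blast
  then obtain c where c: "\<And>x. comb (c x) bs = x" by metis
  have uniq: "c x i = d i" if "x = comb d bs" "i < n" for x d i
  proof -
    have "comb (\<lambda>i. c x i - d i) bs = 0" using that c by (simp add: comb_diff)
    then have "\<forall>i<length bs. c x i - d i = 0" using bs unfolding basis_list_def by blast
    then show ?thesis using that(2) by (simp add: n_def)
  qed
  define \<Phi> where "\<Phi> x = Poly (map (\<lambda>i. to_ac (c x i)) [0..<n])" for x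
  define U where "U w = Poly (map (\<lambda>i. \<Sum>j<n. to_ac (A $$ (i, j)) * Polynomial.coeff w j) [0..<n])" for w
  have coeff_\<Phi>: "Polynomial.coeff (\<Phi> x) i = (if i < n then to_ac (c x i) else 0)" for x i
    unfolding \<Phi>_def coeff_Poly_map ..
  have coeff_U: "Polynomial.coeff (U w) i =
      (if i < n then \<Sum>j<n. to_ac (A $$ (i, j)) * Polynomial.coeff w j else 0)" for w i
    unfolding U_def coeff_Poly_map ..
  interpret ac: vector_space "Polynomial.smult :: 'a alg_closure \<Rightarrow> _"
    by unfold_locales (simp_all add: smult_add_right smult_add_left)
  interpret ac: endo "Polynomial.smult :: 'a alg_closure \<Rightarrow> _" U
    by unfold_locales
       (auto intro!: poly_eqI simp: coeff_U distrib_left sum.distrib sum_distrib_left mult_ac)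
  have \<Phi>_add: "\<Phi> (x + y) = \<Phi> x + \<Phi> y" for x y
  proof -
    have "x + y = comb (\<lambda>i. c x i + c y i) bs"
      using c[of x] c[of y] by (simp add: comb_def scale_left_distrib sum.distrib)
    from uniq[OF this] show ?thesis by (intro poly_eqI) (simp add: coeff_\<Phi>)
  qed
  have \<Phi>_scale: "\<Phi> (scale k x) = Polynomial.smult (to_ac k) (\<Phi> x)" for k x
  proof -
    have "scale k x = comb (\<lambda>i. k * c x i) bs"
      by (subst c[of x, symmetric]) (simp add: comb_def scale_sum_right)
    from uniq[OF this] show ?thesis by (intro poly_eqI) (simp add: coeff_\<Phi>)
  qed
  have \<Phi>_u: "\<Phi> (u x) = U (\<Phi> x)" for x
  proof -
    have "u x = (\<Sum>j<n. scale (c x j) (u (bs ! j)))"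
      by (subst c[of x, symmetric]) (simp add: comb_def u.sum u.scale n_def)
    also have "\<dots> = (\<Sum>j<n. \<Sum>i<n. scale (c x j * A $$ (i, j)) (bs ! i))"
      by (simp add: uA comb_def n_def scale_sum_right)
    also have "\<dots> = comb (\<lambda>i. \<Sum>j<n. c x j * A $$ (i, j)) bs"
      by (subst sum.swap) (simp add: comb_def n_def scale_sum_left)
    finally have ux: "u x = comb (\<lambda>i. \<Sum>j<n. c x j * A $$ (i, j)) bs" .
    show ?thesis
      by (rule poly_eqI) (simp add: coeff_\<Phi> coeff_U uniq[OF ux] to_ac_sum mult.commute)
  qed
  have \<Phi>_0: "\<Phi> 0 = 0" using \<Phi>_scale[of 0 0] by simp
  have \<Phi>_act: "\<Phi> (act f x) = ac.act (map_poly to_ac f) (\<Phi> x)" for f x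
    by (induction f) (simp_all add: \<Phi>_0 map_poly_to_ac_pCons \<Phi>_add \<Phi>_scale \<Phi>_u)
  have \<Phi>_inj: "x = 0" if "\<Phi> x = 0" for x
  proof -
    have "c x i = 0" if "i < n" for i
      using coeff_\<Phi>[of x i] \<open>\<Phi> x = 0\<close> that by simp
    then have "comb (c x) bs = comb (\<lambda>_. 0) bs" by (intro comb_cong) (simp add: n_def)
    then show ?thesis using c[of x] by simp
  qed
  have \<Phi>_span: "\<exists>h vs. w = (\<Sum>i<n. Polynomial.smult (h i) (\<Phi> (vs i)))"
    if w: "\<And>i. i \<ge> n \<Longrightarrow> Polynomial.coeff w i = 0" for w
  proof -
    have cb: "c (bs ! i) j = (if j = i then 1 else 0)" if "i < n" "j < n" for i j
      by (rule uniq) (use that in \<open>simp_all add: comb_single n_def\<close>)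
    have e: "Polynomial.coeff w j = (\<Sum>i<n. Polynomial.coeff w i * Polynomial.coeff (\<Phi> (bs ! i)) j)" for j
    proof (cases "j < n")
      case True
      then have "(\<Sum>i<n. Polynomial.coeff w i * Polynomial.coeff (\<Phi> (bs ! i)) j)
        = (\<Sum>i<n. if i = j then Polynomial.coeff w i else 0)"
        by (intro sum.cong) (auto simp: coeff_\<Phi> cb)
      then show ?thesis using True by simp
    qed (simp add: w coeff_\<Phi>)
    have "w = (\<Sum>i<n. Polynomial.smult (Polynomial.coeff w i) (\<Phi> (bs ! i)))"
      by (rule poly_eqI, unfold Polynomial.coeff_sum Polynomial.coeff_smult, rule e)
    then show ?thesis by (intro exI)
  qed
  have \<Phi>_deg: "Polynomial.coeff (\<Phi> x) i = 0" if "i \<ge> n" for x i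
    using that by (simp add: coeff_\<Phi>)
  show ?thesis
    by (rule that[OF ac.endo_axioms \<Phi>_act \<Phi>_inj \<Phi>_deg[folded n] coeff_U[folded n] \<Phi>_span[folded n]])
qed

text \<open>Write H = (t - z) G with z a root. Either G already kills w and induction applies, or G
  w is an eigenvector for z. After extension of scalars the set W serves to keep the eigenvector
  among the coordinate vectors of the right length.\<close>

lemma eigenvector_of_split:
  fixes H :: "'a poly"
  assumes "\<And>g :: 'a poly. Polynomial.degree g > 0 \<Longrightarrow> \<exists>z. poly g z = 0"
    and "closed W" "w \<in> W" "w \<noteq> 0" "act H w = 0" "H \<noteq> 0"
  shows "\<exists>z y. y \<in> W \<and> y \<noteq> 0 \<and> poly H z = 0 \<and> u y = scale z y"
  using assms(5,6)
proof (induction "Polynomial.degree H" arbitrary: H rule: less_induct)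
  case less
  show ?case
  proof (cases "Polynomial.degree H = 0")
    case True
    then obtain k where "H = [:k:]" by (rule degree_eq_zeroE)
    then show ?thesis using less.prems assms(4) by (simp add: u.zero)
  next
    case False
    then obtain z where z: "poly H z = 0" using assms(1) by blast
    then obtain G where G: "H = [:- z, 1:] * G" by (metis dvd_def poly_eq_0_iff_dvd)
    have G0: "G \<noteq> 0" using G less.prems by auto
    show ?thesis
    proof (cases "act G w = 0")
      case True
      have "Polynomial.degree G < Polynomial.degree H"
        using G0 unfolding G by (subst degree_mult_eq) auto
      from less.hyps[OF this True G0] show ?thesis unfolding G by auto
    next
      case False
      have "act [:- z, 1:] (act G w) = 0" using less.prems unfolding G act_mult by simp
      then have "u (act G w) = scale z (act G w)" by (simp add: u.zero)
      then show ?thesis using False z closed_act[OF assms(2,3)] by blast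
    qed
  qed
qed

text \<open>After extension of scalars the image of v is still nonzero and killed by g, and over the
  algebraic closure g splits into linear factors.\<close>

lemma ac_eigenvalue_root:
  assumes A: "represented_by scale UNIV u A" and "g \<noteq> 0" "act g v = 0" "v \<noteq> 0"
  shows "\<exists>z\<in>ac_eigenvalues scale u. poly (map_poly to_ac g) z = 0"
proof -
  obtain U \<Phi> where U: "endo Polynomial.smult U"
    "\<And>f x. \<Phi> (act f x) = poly_endo Polynomial.smult (map_poly to_ac f) U (\<Phi> x)"
    "\<And>x. \<Phi> x = 0 \<Longrightarrow> x = 0"
    "\<And>x i. i \<ge> dim_row A \<Longrightarrow> Polynomial.coeff (\<Phi> x) i = 0"
    "\<And>w i. Polynomial.coeff (U w) i =
      (if i < dim_row A then \<Sum>j<dim_row A. to_ac (A $$ (i, j)) * Polynomial.coeff w j else 0)"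
    by (rule scalar_extension[OF A]) blast
  interpret ac: endo Polynomial.smult U by (rule U(1))
  define W where "W = {w. \<forall>i\<ge>dim_row A. Polynomial.coeff w i = (0 :: 'a alg_closure)}"
  have UW: "U w \<in> W" for w by (simp add: W_def U(5))
  have "ac.act f w \<in> W" if "w \<in> W" for f w
  proof (induction f)
    case (pCons c f)
    then show ?case using UW[of "ac.act f w"] that by (simp add: W_def)
  qed (simp add: W_def)
  then have W: "ac.closed W" by (simp add: ac.closed_def) (simp add: W_def)
  have g0: "map_poly to_ac g \<noteq> 0" using \<open>g \<noteq> 0\<close> by (simp add: map_poly_eq_0_iff)
  have gv: "ac.act (map_poly to_ac g) (\<Phi> v) = 0"
    using U(2)[of g v] U(2)[of 0 0] assms(3) by simp
  have v: "\<Phi> v \<in> W" "\<Phi> v \<noteq> 0" using U(3)[of v] U(4) assms(4) by (auto simp: W_def)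
  obtain z y where zy: "y \<in> W" "y \<noteq> 0" "poly (map_poly to_ac g) z = 0" "U y = Polynomial.smult z y"
    using ac.eigenvector_of_split[OF alg_closed_imp_poly_has_root W v gv g0] by blast
  let ?M = "map_mat to_ac A"
  have dc: "dim_col A = dim_row A"
    using A unfolding represented_by_iff by auto
  have "eigenvector ?M (vec (dim_row A) (Polynomial.coeff y)) z"
    unfolding eigenvector_def
  proof (intro conjI)
    show "vec (dim_row A) (Polynomial.coeff y) \<noteq> 0\<^sub>v (dim_row ?M)"
    proof
      assume *: "vec (dim_row A) (Polynomial.coeff y) = 0\<^sub>v (dim_row ?M)"
      have "Polynomial.coeff y i = 0" for i
      proof (cases "i < dim_row A")
        case True
        then show ?thesis using arg_cong[OF *, of "\<lambda>v. vec_index v i"] by simp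
      qed (use zy(1) in \<open>simp add: W_def\<close>)
      then show False using zy(2) by (simp add: poly_eq_iff)
    qed
    show "?M *\<^sub>v vec (dim_row A) (Polynomial.coeff y) = z \<cdot>\<^sub>v vec (dim_row A) (Polynomial.coeff y)"
    proof (rule eq_vecI)
      fix i assume "i < dim_vec (z \<cdot>\<^sub>v vec (dim_row A) (Polynomial.coeff y))"
      then have i: "i < dim_row A" by simp
      have "(?M *\<^sub>v vec (dim_row A) (Polynomial.coeff y)) $ i
        = (\<Sum>j<dim_row A. to_ac (A $$ (i, j)) * Polynomial.coeff y j)"
        using i dc by (simp add: scalar_prod_def lessThan_atLeast0)
      also have "\<dots> = Polynomial.coeff (U y) i" using i by (simp add: U(5))
      finally show "(?M *\<^sub>v vec (dim_row A) (Polynomial.coeff y)) $ i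
        = (z \<cdot>\<^sub>v vec (dim_row A) (Polynomial.coeff y)) $ i" using i by (simp add: zy(4))
    qed simp
  qed simp
  then have "z \<in> ac_eigenvalues scale u"
    using A by (auto simp: ac_eigenvalues_def eigenvalue_def)
  then show ?thesis using zy(3) by blast
qed

text \<open>On an eigenvector w for z a polynomial f acts as multiplication by f(z). As h kills the
  images of the original vectors, and these span all coordinate vectors, it kills w, whence h(z) =
  0.\<close>

lemma ac_eigenvalue_annihilated:
  assumes z: "z \<in> ac_eigenvalues scale u" and h: "\<And>v. act h v = 0"
  shows "poly (map_poly to_ac h) z = 0"
proof -
  obtain A where A: "represented_by scale UNIV u A" and ev: "eigenvalue (map_mat to_ac A) z"
    using z by (auto simp: ac_eigenvalues_def)
  obtain U \<Phi> where U: "endo Polynomial.smult U"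
    "\<And>f x. \<Phi> (act f x) = poly_endo Polynomial.smult (map_poly to_ac f) U (\<Phi> x)"
    "\<And>w i. Polynomial.coeff (U w) i =
      (if i < dim_row A then \<Sum>j<dim_row A. to_ac (A $$ (i, j)) * Polynomial.coeff w j else 0)"
    "\<And>w. (\<And>i. i \<ge> dim_row A \<Longrightarrow> Polynomial.coeff w i = 0) \<Longrightarrow>
       \<exists>h vs. w = (\<Sum>i<dim_row A. Polynomial.smult (h i) (\<Phi> (vs i)))"
    by (rule scalar_extension[OF A]) blast
  interpret ac: endo Polynomial.smult U by (rule U(1))
  have dc: "dim_col A = dim_row A"
    using A unfolding represented_by_iff by auto
  obtain x where x: "dim_vec x = dim_row A" "x \<noteq> 0\<^sub>v (dim_row A)" "map_mat to_ac A *\<^sub>v x = z \<cdot>\<^sub>v x"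
    using ev by (auto simp: eigenvalue_def eigenvector_def dest!: carrier_vecD)
  define w where "w = Poly (map (\<lambda>i. x $ i) [0..<dim_row A])"
  have cw: "Polynomial.coeff w i = (if i < dim_row A then x $ i else 0)" for i
    unfolding w_def coeff_Poly_map ..
  have "w \<noteq> 0"
  proof
    assume "w = 0"
    then have "x $ i = 0" if "i < dim_row A" for i using cw[of i] that by simp
    then have "x = 0\<^sub>v (dim_row A)" using x(1) by (intro eq_vecI) auto
    then show False using x(2) by simp
  qed
  have Uw: "U w = Polynomial.smult z w"
  proof (rule poly_eqI)
    fix i
    show "Polynomial.coeff (U w) i = Polynomial.coeff (Polynomial.smult z w) i"
    proof (cases "i < dim_row A")
      case True
      have "(map_mat to_ac A *\<^sub>v x) $ i = (\<Sum>j<dim_row A. to_ac (A $$ (i, j)) * x $ j)"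
        using True x(1) dc by (simp add: scalar_prod_def lessThan_atLeast0)
      then show ?thesis using True x(1,3) by (simp add: U(3) cw)
    qed (simp add: U(3) cw)
  qed
  have "ac.act f w = Polynomial.smult (poly f z) w" for f
  proof (induction f)
    case (pCons c f)
    then show ?case by (simp add: ac.u.scale Uw Polynomial.smult_add_left mult.commute)
  qed simp
  moreover have "ac.act (map_poly to_ac h) w = 0"
  proof -
    obtain k vs where w: "w = (\<Sum>i<dim_row A. Polynomial.smult (k i) (\<Phi> (vs i)))"
      using U(4)[of w] cw by auto
    have "\<Phi> 0 = 0" using U(2)[of 0 0] by simp
    then have "ac.act (map_poly to_ac h) (\<Phi> y) = 0" for y using U(2)[of h y] h by simp
    then show ?thesis unfolding w ac.act_sum by (simp add: ac.act_scale)
  qed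
  ultimately show ?thesis using \<open>w \<noteq> 0\<close> by simp
qed

text \<open>With M = P1 * P2 this turns being d-exceptional, which concerns the algebraic closure,
  into a condition over the base field.\<close>

theorem eigenvalues_roots_iff_annihilated:
  assumes fd: "finite_dimensional_vector_space scale Basis"
  shows "(\<forall>z\<in>ac_eigenvalues scale u. poly (map_poly to_ac M) z = 0) \<longleftrightarrow> (\<exists>N. \<forall>v. act (M ^ N) v = 0)"
proof
  assume *: "\<forall>z\<in>ac_eigenvalues scale u. poly (map_poly to_ac M) z = 0"
  obtain A where A: "represented_by scale UNIV u A" using matrix_exists[OF fd] by blast
  \<comment> \<open>Each irreducible factor g of an annihilator f = g h of v costs one factor M: if
    h v is nonzero, some root of g is an eigenvalue, hence a root of M, and so g divides M. The
    exponent depends only on f, which makes it uniform in v.\<close>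
  have key: "act (M ^ Polynomial.degree f) v = 0" if "f \<noteq> 0" "act f v = 0" for f v
    using that
  proof (induction "Polynomial.degree f" arbitrary: f v rule: less_induct)
    case less
    show ?case
    proof (cases "is_unit f")
      case True
      then obtain k where "k * f = 1" by (metis dvd_def mult.commute)
      then have "v = act k (act f v)" by (metis act_1 act_mult)
      then show ?thesis using less.prems by simp
    next
      case False
      then obtain g h where gh: "Factorial_Ring.irreducible g" "f = g * h"
        "Polynomial.degree h < Polynomial.degree f"
        using irreducible_factor_exists less.prems(1) by metis
      have nz: "g \<noteq> 0" "h \<noteq> 0" using gh less.prems by auto
      have "act h (act M v) = 0"
      proof (cases "act h v = 0")
        case True
        then show ?thesis by (metis act_commute act_zero)
      next
        case False
        have "act g (act h v) = 0" using less.prems gh by (simp add: act_mult)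
        then obtain z where "poly (map_poly to_ac g) z = 0" "poly (map_poly to_ac M) z = 0"
          using ac_eigenvalue_root[OF A nz(1) _ False] * by blast
        then have "g dvd M" by (rule irreducible_dvd_common_root[OF gh(1)])
        then have "act M (act h v) = 0" using \<open>act g (act h v) = 0\<close> act_dvd by blast
        then show ?thesis by (simp add: act_commute[of h])
      qed
      from less.hyps[OF gh(3) nz(2) this]
      have "act (M ^ Suc (Polynomial.degree h)) v = 0" by (simp only: power_Suc2 act_mult)
      moreover have "M ^ Suc (Polynomial.degree h) dvd M ^ Polynomial.degree f"
        using gh(3) by (intro le_imp_power_dvd) simp
      ultimately show ?thesis using act_dvd by blast
    qed
  qed
  obtain f where "f \<noteq> 0" "\<forall>v. act f v = 0" using annihilator_exists[OF fd] by blast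
  then show "\<exists>N. \<forall>v. act (M ^ N) v = 0" using key by blast
next
  assume "\<exists>N. \<forall>v. act (M ^ N) v = 0"
  then obtain N where "\<And>v. act (M ^ N) v = 0" by blast
  from ac_eigenvalue_annihilated[OF _ this]
  show "\<forall>z\<in>ac_eigenvalues scale u. poly (map_poly to_ac M) z = 0"
    by (simp add: map_poly_to_ac_power)
qed

end

section \<open>Quadratic extensions and their norm\<close>

text \<open>The generated field behind \<open>splitting_field\<close> refers to the operations of a
  ring record; this lemma and the next identify its inverses with those of the type class.\<close>

lemma inv_ring_of_type_algebra:
  fixes z :: "'k::field"
  assumes "z \<noteq> 0" shows "inv\<^bsub>ring_of_type_algebra\<^esub> z = inverse z"
  unfolding m_inv_def ring_of_type_algebra_def
  by (rule the_equality) (use assms in \<open>auto simp: field_simps\<close>)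

lemma a_inv_ring_of_type_algebra: "\<ominus>\<^bsub>ring_of_type_algebra\<^esub> (z :: 'k::field) = - z"
  unfolding a_inv_def m_inv_def ring_of_type_algebra_def
  by (rule the_equality) (auto simp: eq_neg_iff_add_eq_0)

lemma det_2x2:
  fixes A :: "'k::comm_ring_1 mat"
  assumes A: "A \<in> carrier_mat 2 2"
  shows "Determinant.det A = A $$ (0, 0) * A $$ (1, 1) - A $$ (0, 1) * A $$ (1, 0)"
proof -
  have d: "mat_delete A i 0 \<in> carrier_mat 1 1" for i using A by (simp add: mat_delete_def)
  have "Determinant.det A = (\<Sum>i<2. A $$ (i, 0) * cofactor A i 0)"
    using laplace_expansion_column[OF A, of 0] by simp
  also have "\<dots> = A $$ (0, 0) * cofactor A 0 0 + A $$ (1, 0) * cofactor A 1 0"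
    by (simp add: numeral_2_eq_2)
  also have "\<dots> = A $$ (0, 0) * A $$ (1, 1) - A $$ (0, 1) * A $$ (1, 0)"
    unfolding cofactor_def det_single[OF d] using A by (simp add: mat_delete_def)
  finally show ?thesis .
qed

locale quadratic_element =
  fixes x :: "'a::field alg_closure" and T n :: 'a
  assumes x_square: "x * x = to_ac T * x - to_ac n" and x_not_in: "x \<notin> range to_ac"
begin

definition elt :: "'a \<Rightarrow> 'a \<Rightarrow> 'a alg_closure" where "elt a b = to_ac a + to_ac b * x"

lemma elt_eq_0_iff: "elt a b = 0 \<longleftrightarrow> a = 0 \<and> b = 0"
proof
  assume e: "elt a b = 0"
  have "b = 0"
  proof (rule ccontr)
    assume "b \<noteq> 0"
    then have "x = to_ac (- a / b)" using e by (simp add: elt_def field_simps eq_neg_iff_add_eq_0)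
    then show False using x_not_in by blast
  qed
  then show "a = 0 \<and> b = 0" using e by (simp add: elt_def)
qed (simp add: elt_def)

lemma elt_add: "elt a b + elt c d = elt (a + c) (b + d)"
  and elt_diff: "elt a b - elt c d = elt (a - c) (b - d)"
  and elt_uminus: "- elt a b = elt (- a) (- b)"
  and to_ac_eq_elt: "to_ac a = elt a 0"
  by (simp_all add: elt_def algebra_simps)

lemma elt_mult: "elt a b * elt c d = elt (a * c - b * d * n) (a * d + b * c + b * d * T)"
proof -
  have "elt a b * elt c d = to_ac (a * c) + to_ac (a * d + b * c) * x + to_ac (b * d) * (x * x)"
    by (simp add: elt_def algebra_simps)
  then show ?thesis unfolding x_square by (simp add: elt_def algebra_simps)
qed

lemma elt_eq_iff: "elt a b = elt c d \<longleftrightarrow> a = c \<and> b = d"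
  using elt_eq_0_iff[of "a - c" "b - d"] elt_diff[of a b c d] by auto

lemma elt_not_in: "b \<noteq> 0 \<Longrightarrow> elt a b \<notin> range to_ac"
  by (auto simp: to_ac_eq_elt elt_eq_iff)

text \<open>The product of a + b x with its conjugate a + b (T - x).\<close>

definition norm_form :: "'a \<Rightarrow> 'a \<Rightarrow> 'a" where
  "norm_form a b = a * a + a * b * T + b * b * n"

lemma elt_mult_conjugate: "elt a b * elt (a + b * T) (- b) = to_ac (norm_form a b)"
  unfolding elt_mult to_ac_eq_elt elt_eq_iff norm_form_def by (simp add: algebra_simps)

lemma elt_square: "elt a b * elt a b = to_ac (a + a + b * T) * elt a b - to_ac (norm_form a b)"
  unfolding to_ac_eq_elt elt_mult elt_diff elt_eq_iff norm_form_def by (simp add: algebra_simps)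

text \<open>Rationalizing the denominator: the product with the conjugate is a scalar, and it is
  nonzero because both factors are.\<close>

lemma inverse_elt:
  assumes "elt a b \<noteq> 0" shows "\<exists>c d. inverse (elt a b) = elt c d"
proof -
  have "elt (a + b * T) (- b) \<noteq> 0" using assms by (auto simp: elt_eq_0_iff)
  then have "norm_form a b \<noteq> 0" using assms elt_mult_conjugate[of a b] by auto
  then have "elt a b * (to_ac (1 / norm_form a b) * elt (a + b * T) (- b)) = 1"
    using elt_mult_conjugate[of a b] by (simp add: mult.left_commute[of "elt a b"])
  then have "inverse (elt a b) = to_ac (1 / norm_form a b) * elt (a + b * T) (- b)"
    by (rule inverse_unique)
  then show ?thesis unfolding to_ac_eq_elt[of "1 / norm_form a b"] elt_mult by blast
qed

definition K :: "'a alg_closure set" where "K = {elt a b | a b. True}"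

lemma elt_in_K: "elt a b \<in> K"
  by (auto simp: K_def)

lemma K_cases:
  assumes "z \<in> K" obtains a b where "z = elt a b"
  using assms by (auto simp: K_def)

lemma generate_field_eq_K:
  assumes "x \<in> Y" "Y \<subseteq> K"
  shows "generate_field ring_of_type_algebra (range to_ac \<union> Y) = K"
proof (intro equalityI subsetI)
  fix z assume "z \<in> generate_field ring_of_type_algebra (range to_ac \<union> Y)"
  then show "z \<in> K"
  proof (induction rule: generate_field.induct)
    case one
    have "(1 :: 'a alg_closure) = elt 1 0" by (simp add: elt_def)
    then show ?case by (auto simp: K_def ring_of_type_algebra_def)
  next
    case (incl h)
    then show ?case using assms(2) by (auto simp: K_def to_ac_eq_elt)
  next
    case (a_inv h)
    from a_inv.IH obtain a b where "h = elt a b" by (rule K_cases)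
    then show ?case by (simp add: a_inv_ring_of_type_algebra elt_uminus elt_in_K)
  next
    case (m_inv h)
    then have "h \<noteq> 0" by (simp add: ring_of_type_algebra_def)
    moreover from m_inv.IH obtain a b where "h = elt a b" by (rule K_cases)
    ultimately show ?case
      using inverse_elt[of a b] by (auto simp: inv_ring_of_type_algebra elt_in_K)
  next
    case (eng_add h1 h2)
    from eng_add.IH obtain a b c d where "h1 = elt a b" "h2 = elt c d" by (metis K_cases)
    then show ?case by (simp add: ring_of_type_algebra_def elt_add elt_in_K)
  next
    case (eng_mult h1 h2)
    from eng_mult.IH obtain a b c d where "h1 = elt a b" "h2 = elt c d" by (metis K_cases)
    then show ?case by (simp add: ring_of_type_algebra_def elt_mult elt_in_K)
  qed
next
  let ?G = "generate_field ring_of_type_algebra (range to_ac \<union> Y)"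
  fix z assume "z \<in> K"
  then obtain a b where z: "z = to_ac a + to_ac b * x" by (auto simp: K_def elt_def)
  have "to_ac a \<in> ?G" "to_ac b \<in> ?G" "x \<in> ?G" using assms(1) by (auto intro: generate_field.incl)
  then have "to_ac a \<oplus>\<^bsub>ring_of_type_algebra\<^esub> (to_ac b \<otimes>\<^bsub>ring_of_type_algebra\<^esub> x) \<in> ?G"
    by (intro generate_field.eng_add generate_field.eng_mult)
  then show "z \<in> ?G" by (simp add: z ring_of_type_algebra_def)
qed

text \<open>A generator \<open>z\<close> is a root of \<open>t^2 - tr A t + det A\<close> for every matrix \<open>A\<close> of the multiplication
  by \<open>z\<close>; as \<open>z\<close> does not belong to the base field, this is its minimal polynomial.\<close>

lemma field_norm_elt:
  assumes b: "b \<noteq> 0" shows "field_norm K (elt a b) = norm_form a b"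
proof -
  define z where "z = elt a b"
  interpret vector_space "ac_scale :: 'a \<Rightarrow> _" by (rule vector_space_ac_scale)
  interpret endo "ac_scale :: 'a \<Rightarrow> _" "\<lambda>w. z * w"
    by unfold_locales (simp_all add: ac_scale_def algebra_simps)
  have comb2: "comb c [w1, w2] = to_ac (c 0) * w1 + to_ac (c 1) * w2" for c w1 w2
    by (simp add: comb_def ac_scale_def numeral_2_eq_2 lessThan_Suc add.commute)
  have bl: "basis_list K [1, x]"
    unfolding basis_list_def
  proof (intro conjI allI impI)
    fix c i assume "comb c [1, x] = 0" "i < length [1, x]"
    then have "c 0 = 0" "c 1 = 0" "i = 0 \<or> i = 1"
      using elt_eq_0_iff[of "c 0" "c 1"] unfolding comb2 elt_def by auto
    then show "c i = 0" by auto
  next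
    show "K = range (\<lambda>c. comb c [1, x])"
    proof (intro equalityI subsetI)
      fix w assume "w \<in> K"
      then obtain a b where "w = elt a b" by (auto simp: K_def)
      then have "w = comb (\<lambda>i. if i = 0 then a else b) [1, x]" unfolding comb2 elt_def by simp
      then show "w \<in> range (\<lambda>c. comb c [1, x])" by blast
    next
      fix w assume "w \<in> range (\<lambda>c. comb c [1, x])"
      then show "w \<in> K" unfolding comb2 K_def elt_def by auto
    qed
  qed
  have det: "Determinant.det A = norm_form a b" if "represented_by ac_scale K (\<lambda>w. z * w) A" for A
  proof -
    obtain bs where bs: "basis_list K bs" "A \<in> carrier_mat (length bs) (length bs)"
      "\<And>j. j < length bs \<Longrightarrow> z * bs ! j = comb (\<lambda>i. A $$ (i, j)) bs"
      using \<open>represented_by _ _ _ _\<close> unfolding represented_by_iff by blast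
    \<comment> \<open>The norm refers to a matrix in any basis, so the size of A is not given; it
      follows from the invariance of the dimension.\<close>
    have "length bs = 2"
    proof -
      have o: "ordered_basis ac_scale K bs" "ordered_basis ac_scale K [1, x]"
        using bs(1) bl by (simp_all add: ordered_basis_iff_basis_list)
      then have "card (set bs) = dim K" "card (set [1, x]) = dim K"
        unfolding ordered_basis_def using dim_span_eq_card_independent by metis+
      moreover have "card (set bs) = length bs" "card (set [1, x]) = length [1, x]"
        using o unfolding ordered_basis_def by (simp_all only: distinct_card)
      ultimately show ?thesis by simp
    qed
    then obtain w1 w2 where w: "bs = [w1, w2]"
      by (metis (no_types, lifting) Suc_length_conv length_0_conv numeral_2_eq_2)
    have A2: "A \<in> carrier_mat 2 2" using bs(2) by (simp add: w numeral_2_eq_2)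
    have "w1 \<noteq> 0"
    proof
      assume "w1 = 0"
      then have "comb (\<lambda>i. if i = 0 then 1 else 0) bs = 0" unfolding w comb2 by simp
      then have "\<forall>i<length bs. (if i = 0 then 1 else (0::'a)) = 0"
        using bs(1) unfolding basis_list_def by blast
      then show False by (auto simp: w)
    qed
    have 1: "z * w1 = to_ac (A $$ (0, 0)) * w1 + to_ac (A $$ (1, 0)) * w2"
      and 2: "z * w2 = to_ac (A $$ (0, 1)) * w1 + to_ac (A $$ (1, 1)) * w2"
      using bs(3)[of 0] bs(3)[of 1] unfolding w comb2 by simp_all
    let ?t = "A $$ (0, 0) + A $$ (1, 1)" and ?d = "A $$ (0, 0) * A $$ (1, 1) - A $$ (0, 1) * A $$ (1, 0)"
    \<comment> \<open>Eliminating w2 from the two column relations leaves the Cayley-Hamilton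
      equation of A, applied to w1.\<close>
    have "(z * z - to_ac ?t * z + to_ac ?d) * w1 = 0"
    proof -
      have "(z - to_ac (A $$ (0, 0))) * w1 = to_ac (A $$ (1, 0)) * w2" using 1 by (simp add: algebra_simps)
      moreover have "(z - to_ac (A $$ (1, 1))) * w2 = to_ac (A $$ (0, 1)) * w1" using 2 by (simp add: algebra_simps)
      ultimately have "(z - to_ac (A $$ (1, 1))) * ((z - to_ac (A $$ (0, 0))) * w1)
        = to_ac (A $$ (1, 0)) * (to_ac (A $$ (0, 1)) * w1)" by (metis mult.left_commute)
      then show ?thesis by (simp add: algebra_simps)
    qed
    then have "z * z - to_ac ?t * z + to_ac ?d = 0" using \<open>w1 \<noteq> 0\<close> by simp
    then have "to_ac (a + a + b * T) * z - to_ac (norm_form a b) - to_ac ?t * z + to_ac ?d = 0"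
      using elt_square[of a b] by (simp only: z_def)
    then have "elt (?d - norm_form a b + (a + a + b * T - ?t) * a) ((a + a + b * T - ?t) * b) = 0"
      by (simp add: z_def elt_def algebra_simps)
    then have e: "?d - norm_form a b + (a + a + b * T - ?t) * a = 0" "(a + a + b * T - ?t) * b = 0"
      unfolding elt_eq_0_iff by blast+
    have t: "a + a + b * T - ?t = 0" using e(2) b unfolding mult_eq_0_iff by blast
    have "?d = norm_form a b" using e(1) unfolding t by simp
    then show ?thesis using det_2x2[OF A2] by simp
  qed
  have "\<exists>A. represented_by ac_scale K (\<lambda>w. z * w) A"
  proof -
    have in_K: "\<exists>c. w = comb c [1, x]" if "w \<in> K" for w
      using bl that unfolding basis_list_def by blast
    have "z * x = elt a b * elt 0 1" by (simp add: z_def elt_def)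
    then have "z * 1 \<in> K" "z * x \<in> K"
      by (simp_all add: z_def elt_mult elt_in_K)
    then obtain c0 c1 where c: "z * 1 = comb c0 [1, x]" "z * x = comb c1 [1, x]"
      using in_K by meson
    let ?A = "mat 2 2 (\<lambda>(i, j). if j = 0 then c0 i else c1 i)"
    have "z * [1, x] ! j = comb (\<lambda>i. ?A $$ (i, j)) [1, x]" if "j < 2" for j
    proof -
      have "j = 0 \<or> j = 1" using that by auto
      then show ?thesis using c unfolding comb2 by auto
    qed
    then show ?thesis
      unfolding represented_by_iff using bl by (intro exI[of _ ?A] exI[of _ "[1, x]"]) (simp add: numeral_2_eq_2)
  qed
  then show ?thesis
    unfolding field_norm_def z_def[symmetric] using det by (intro the_equality) auto
qed

end

lemma irreducible_quadratic_iff: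
  fixes b c :: "'a::field"
  shows "Factorial_Ring.irreducible [:c, b, 1:] \<longleftrightarrow> (\<forall>r. poly [:c, b, 1:] r \<noteq> 0)"
proof
  assume irr: "Factorial_Ring.irreducible [:c, b, 1:]"
  show "\<forall>r. poly [:c, b, 1:] r \<noteq> 0"
  proof (intro allI notI)
    fix r assume "poly [:c, b, 1:] r = 0"
    then obtain g where g: "[:c, b, 1:] = [:- r, 1:] * g" by (metis poly_eq_0_iff_dvd dvd_def)
    then have "is_unit [:- r, 1:] \<or> is_unit g" using irr Factorial_Ring.irreducibleD by blast
    moreover have "g \<noteq> 0" using g by auto
    then have "Polynomial.degree [:c, b, 1:] = 1 + Polynomial.degree g"
      unfolding g by (subst degree_mult_eq) auto
    ultimately show False by (auto simp: is_unit_iff_degree \<open>g \<noteq> 0\<close>)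
  qed
next
  assume nr: "\<forall>r. poly [:c, b, 1:] r \<noteq> 0"
  show "Factorial_Ring.irreducible [:c, b, 1:]"
  proof (rule Factorial_Ring.irreducibleI)
    fix f g assume fg: "[:c, b, 1:] = f * g"
    then have nz: "f \<noteq> 0" "g \<noteq> 0" by auto
    have "Polynomial.degree [:c, b, 1:] = Polynomial.degree f + Polynomial.degree g"
      unfolding fg using nz by (rule degree_mult_eq)
    then have deg: "Polynomial.degree f + Polynomial.degree g = 2" by simp
    have no_linear: "Polynomial.degree h \<noteq> 1" if "h dvd [:c, b, 1:]" for h
    proof
      assume "Polynomial.degree h = 1"
      then obtain k0 k1 where h: "h = [:k0, k1:]" "k1 \<noteq> 0" by (metis degree1_coeffs)
      then have "poly h (- k0 / k1) = 0" by simp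
      then have "poly [:c, b, 1:] (- k0 / k1) = 0" using that by (metis poly_eq_0_iff_dvd dvd_trans)
      then show False using nr by blast
    qed
    have "Polynomial.degree f \<noteq> 1" by (rule no_linear) (simp only: fg dvd_triv_left)
    moreover have "Polynomial.degree g \<noteq> 1" by (rule no_linear) (simp only: fg dvd_triv_right)
    ultimately have "Polynomial.degree f = 0 \<or> Polynomial.degree g = 0" using deg by linarith
    then show "is_unit f \<or> is_unit g" using nz by (auto simp: is_unit_iff_degree)
  qed (auto simp: is_unit_iff_degree)
qed

section \<open>The classification\<close>

lemma monic_quadratic_eq:
  assumes "Polynomial.degree p = 2" "Polynomial.lead_coeff p = 1"
  shows "p = [:Polynomial.coeff p 0, - tr p, 1:]"
proof (rule poly_eqI)
  fix i :: nat
  consider "i = 0" | "i = 1" | "i = 2" | "i > 2" by linarith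
  then show "Polynomial.coeff p i = Polynomial.coeff [:Polynomial.coeff p 0, - tr p, 1:] i"
    using assms by cases (auto simp: tr_def numeral_2_eq_2 coeff_pCons Polynomial.coeff_eq_0 split: nat.split)
qed

theorem theorem3p22:
  fixes p q :: "'a::field poly"
    and L :: "'a alg_closure set"
    and x1 x2 y1 y2 :: "'a alg_closure"
    and \<delta> :: 'a
    and P :: "'a alg_closure \<Rightarrow> 'a alg_closure \<Rightarrow> 'a poly"
    and scale :: "'a \<Rightarrow> 'v::ab_group_add \<Rightarrow> 'v"
    and Basis :: "'v set"
    and u :: "'v \<Rightarrow> 'v"
  assumes "irreducible p" "Polynomial.lead_coeff p = 1" "Polynomial.degree p = 2"
    and "irreducible q" "Polynomial.lead_coeff q = 1" "Polynomial.degree q = 2"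
    and "splitting_field p = L" "splitting_field q = L"
    and "\<not> is_translation q p"
    and "separable_poly p"
    and "\<delta> = tr p - tr q"
    and "map_poly to_ac p = [:- x1, 1:] * [:- x2, 1:]"
    and "map_poly to_ac q = [:- y1, 1:] * [:- y2, 1:]"
    and "\<And>x y. P x y = [:field_norm L (x - y), - \<delta>, 1:]"
    and "finite_dimensional_vector_space scale Basis"
    and "Vector_Spaces.linear scale scale u"
  defines "cond_i \<equiv>
      pq_difference scale p q u \<and> d_exceptional scale p q u"
    and "cond_ii \<equiv>
      (\<exists>m n. is_minimal_polynomial scale u (P x1 y1 ^ m * P x1 y2 ^ n)) \<and>
      (\<exists>r. is_invariant_factors scale u r \<and>
         (\<forall>k\<ge>1. \<exists>a\<in>{0, 1}. \<exists>b\<in>{0, 1}.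
            r (2 * k - 1) = r (2 * k) * (P x1 y1 ^ a * P x1 y2 ^ b)))"
    and "cond_iii \<equiv>
      (\<exists>Bs. represented_by scale UNIV u (diag_block_mat Bs) \<and>
         (\<forall>B\<in>set Bs. \<exists>x\<in>Root p. \<exists>y\<in>Root q. \<exists>k. \<exists>e\<in>{0, 1}.
            B = diag_block_mat [companion (P x y ^ (k + e)), companion (P x y ^ k)]))"
  shows "(cond_i \<longleftrightarrow> cond_ii) \<and> (cond_ii \<longleftrightarrow> cond_iii)"
proof -
  define T n S m where "T = tr p" and "n = Polynomial.coeff p 0" and "S = tr q" and "m = Polynomial.coeff q 0"
  have p: "p = [:n, - T, 1:]" and q: "q = [:m, - S, 1:]"
    unfolding T_def n_def S_def m_def
    by (rule monic_quadratic_eq[OF assms(3,2)], rule monic_quadratic_eq[OF assms(6,5)])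
  have vieta: "z1 + z2 = to_ac t \<and> z1 * z2 = to_ac e"
    if "map_poly to_ac [:e, - t, 1:] = [:- z1, 1:] * [:- z2, 1:]" for z1 z2 and t e :: 'a
  proof -
    have "[:- z1, 1:] * [:- z2, 1:] = [:z1 * z2, - (z1 + z2), 1:]" by (simp add: algebra_simps)
    then have "[:to_ac e, - to_ac t, 1:] = [:z1 * z2, - (z1 + z2), 1:]"
      using that by (simp add: map_poly_to_ac_pCons)
    then show ?thesis by (simp only: pCons_eq_iff neg_equal_iff_equal)
  qed
  have x12: "x1 + x2 = to_ac T" "x1 * x2 = to_ac n" and y12: "y1 + y2 = to_ac S" "y1 * y2 = to_ac m"
    using vieta[OF assms(12)[unfolded p]] vieta[OF assms(13)[unfolded q]] by blast+
  have roots: "Root p = {x1, x2}" "Root q = {y1, y2}"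
    by (auto simp: Root_def assms(12,13) simp del: mult_pCons_left mult_pCons_right)
  have not_in: "x1 \<notin> range to_ac" "y1 \<notin> range to_ac"
  proof -
    have no_root: "z \<notin> range to_ac" if "Factorial_Ring.irreducible [:c, b, 1:]"
      "z \<in> Root [:c, b, 1:]" for z and b c :: 'a
    proof
      assume "z \<in> range to_ac"
      then obtain r where "z = to_ac r" by blast
      then have "to_ac (poly [:c, b, 1:] r) = 0"
        using that(2) by (simp add: Root_def map_poly_to_ac_pCons)
      then show False using that(1) unfolding irreducible_quadratic_iff to_ac_eq_0_iff by blast
    qed
    show "x1 \<notin> range to_ac" using no_root[of n "- T" x1] assms(1) roots(1) by (simp add: p)
    show "y1 \<notin> range to_ac" using no_root[of m "- S" y1] assms(4) roots(2) by (simp add: q)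
  qed
  have "x2 = to_ac T - x1" using x12(1) by (simp add: eq_diff_eq add.commute)
  have "x1 * x1 = to_ac T * x1 - to_ac n" by (simp add: x12[symmetric] algebra_simps)
  then interpret quadratic_element x1 T n using not_in(1) by unfold_locales
  have "elt 0 1 = x1" "elt T (- 1) = x2"
    using \<open>x2 = to_ac T - x1\<close> by (simp_all add: elt_def)
  then have "x1 \<in> K" "x2 \<in> K" using elt_in_K by metis+
  have L: "L = K"
    unfolding assms(7)[symmetric] splitting_field_def
    by (rule generate_field_eq_K) (simp_all add: roots \<open>x1 \<in> K\<close> \<open>x2 \<in> K\<close>)
  have "y1 \<in> L"
    unfolding assms(8)[symmetric] splitting_field_def by (rule generate_field.incl) (simp add: roots)
  \<comment> \<open>The common splitting field gives y1 coordinates in the basis 1, x1. The whole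
    situation is then described by c, d, T and n.\<close>
  then obtain c d where y1: "y1 = elt c d" by (auto simp: L K_def)
  have d0: "d \<noteq> 0" using not_in(2) by (auto simp: y1 elt_def)
  have "y2 = to_ac S - y1" using y12(1) by (simp add: eq_diff_eq add.commute)
  have "y1 * y1 = to_ac S * y1 - to_ac m" by (simp add: y12[symmetric] algebra_simps)
  \<comment> \<open>Two expressions for the square of y1, one from the multiplication in K and one
    from q; as d is nonzero, comparing coordinates determines S and m.\<close>
  then have "elt ((c + c + d * T) * c - norm_form c d) ((c + c + d * T) * d) = elt (S * c - m) (S * d)"
    unfolding y1 elt_square to_ac_eq_elt elt_mult elt_diff by simp
  then have S: "S = c + c + d * T" and m: "m = norm_form c d"
    using d0 unfolding elt_eq_iff by auto
  have y2: "y2 = elt (c + d * T) (- d)"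
    using \<open>y2 = to_ac S - y1\<close> unfolding y1 S to_ac_eq_elt elt_diff by simp
  have \<delta>: "\<delta> = T - S" using assms(11) by (simp add: T_def S_def)
  \<comment> \<open>For d = 1 one has y1 = x1 + c, and for d = -1 one has y1 = c - x1 = x2 + c - T.
    In both cases the roots of q are shifted roots of p, by c and by c - T, so q would be a
    translation of p.\<close>
  have d1: "1 - d \<noteq> 0" "1 + d \<noteq> 0"
  proof -
    have translation: "q \<noteq> [:n - T * s + s * s, s + s - T, 1:]" for s
    proof
      assume "q = [:n - T * s + s * s, s + s - T, 1:]"
      also have "\<dots> = pcompose p [:s, 1:]" by (simp add: p pcompose_pCons algebra_simps)
      finally show False using assms(9) by (auto simp: is_translation_def)
    qed
    show "1 - d \<noteq> 0"
    proof
      assume "1 - d = 0"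
      then have "d = 1" by simp
      then show False
        using translation[of "- c"] by (simp add: q S m norm_form_def algebra_simps)
    qed
    show "1 + d \<noteq> 0"
    proof
      assume "1 + d = 0"
      then have "d = - 1" by (simp add: eq_neg_iff_add_eq_0 add.commute)
      then show False
        using translation[of "T - c"] by (simp add: q S m norm_form_def algebra_simps)
    qed
  qed
  \<comment> \<open>This discriminant is (x1 - x2)^2, so separability of p is what makes it
    nonzero.\<close>
  have disc: "T * T - 4 * n \<noteq> 0"
  proof
    assume "T * T - 4 * n = 0"
    then have "to_ac T * to_ac T - 4 * to_ac n = 0" by (metis to_ac_0 to_ac_diff to_ac_mult to_ac_numeral)
    then have "(x1 - x2) * (x1 - x2) = 0"
      unfolding x12[symmetric] by (simp add: algebra_simps)
    then have "x1 = x2" by simp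
    then have "map_poly to_ac p = [:- x1, 1:] ^ 2" using assms(12) by (simp add: power2_eq_square)
    then have "order x1 (map_poly to_ac p) = 2" by (simp add: order_power_n_n)
    then show False
      using assms(10) unfolding separable_poly_def rsquarefree_def by (metis numeral_eq_one_iff numeral_One semiring_norm(85) zero_neq_numeral)
  qed
  define N1 N2 where "N1 = norm_form (- c) (1 - d)" and "N2 = norm_form (- (c + d * T)) (1 + d)"
  \<comment> \<open>The four differences form two conjugate pairs, so only two norms occur. Their
    x1-coordinates are nonzero because d is neither 1 nor -1; thus they lie outside the base field,
    which serves both the norms and the irreducibility.\<close>
  have diffs: "x1 - y1 = elt (- c) (1 - d)" "x2 - y2 = elt (- c + (1 - d) * T) (- (1 - d))"
    "x1 - y2 = elt (- (c + d * T)) (1 + d)" "x2 - y1 = elt (- (c + d * T) + (1 + d) * T) (- (1 + d))"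
    by (simp_all add: y1 y2 \<open>x2 = to_ac T - x1\<close> elt_def algebra_simps)
  have conj: "norm_form (a + b * T) (- b) = norm_form a b" for a b
    by (simp add: norm_form_def algebra_simps)
  have neg: "- (1 - d) \<noteq> 0" "- (1 + d) \<noteq> 0" using d1 by (simp_all only: neg_equal_0_iff_equal not_False_eq_True)
  have norms: "field_norm L (x1 - y1) = N1" "field_norm L (x2 - y2) = N1"
    "field_norm L (x1 - y2) = N2" "field_norm L (x2 - y1) = N2"
    unfolding L diffs field_norm_elt[OF d1(1)] field_norm_elt[OF d1(2)]
      field_norm_elt[OF neg(1)] field_norm_elt[OF neg(2)] conj N1_def N2_def by simp_all
  interpret fd: finite_dimensional_vector_space scale Basis by (rule assms(15))
  interpret endo scale u 
    by (intro endo.intro endo_axioms.intro assms(16) fd.vector_space_axioms)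
  interpret quadratic_pair scale u \<delta> T n S m N1 N2
    by unfold_locales (simp_all add: \<delta> S m N1_def N2_def norm_form_def algebra_simps)
  have P: "P x1 y1 = P1" "P x2 y2 = P1" "P x1 y2 = P2" "P x2 y1 = P2"
    by (simp_all add: assms(14) norms P1_def P2_def)
  \<comment> \<open>The pairing of the roots is dictated by their sum: x1 - y1 and x2 - y2 add up to
    \<delta>, and so do x1 - y2 and x2 - y1.\<close>
  have factor: "map_poly to_ac P1 = [:- (x1 - y1), 1:] * [:- (x2 - y2), 1:]"
    "map_poly to_ac P2 = [:- (x1 - y2), 1:] * [:- (x2 - y1), 1:]"
  proof -
    have s: "to_ac \<delta> = x1 + x2 - (y1 + y2)" by (simp add: \<delta> x12 y12)
    have "(x1 - y1) * (x2 - y2) = to_ac N1" "(x1 - y2) * (x2 - y1) = to_ac N2"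
      unfolding diffs elt_mult_conjugate N1_def N2_def by simp_all
    then show "map_poly to_ac P1 = [:- (x1 - y1), 1:] * [:- (x2 - y2), 1:]"
      "map_poly to_ac P2 = [:- (x1 - y2), 1:] * [:- (x2 - y1), 1:]"
      unfolding P1_def P2_def map_poly_to_ac_pCons to_ac_minus s by (simp_all add: algebra_simps)
  qed
  have linear_root: "poly [:- a, 1:] z = 0 \<longleftrightarrow> z = a" for a z :: "'a alg_closure"
    by (simp add: add.commute[of "- a"])
  have no_root: "poly P1 r \<noteq> 0" "poly P2 r \<noteq> 0" for r
  proof -
    have tp: "to_ac (poly f r) = poly (map_poly to_ac f) (to_ac r)" for f
      by (induction f) (simp_all add: map_poly_to_ac_pCons)
    have notin: "x1 - y1 \<noteq> to_ac r" "x2 - y2 \<noteq> to_ac r" "x1 - y2 \<noteq> to_ac r" "x2 - y1 \<noteq> to_ac r"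
      unfolding diffs using elt_not_in[OF d1(1)] elt_not_in[OF d1(2)]
        elt_not_in[OF neg(1)] elt_not_in[OF neg(2)] by blast+
    have "poly (map_poly to_ac P1) (to_ac r) \<noteq> 0" "poly (map_poly to_ac P2) (to_ac r) \<noteq> 0"
      unfolding factor poly_mult mult_eq_0_iff linear_root using notin by metis+
    then show "poly P1 r \<noteq> 0" "poly P2 r \<noteq> 0" unfolding tp[symmetric] by auto
  qed
  interpret irreducible_pair scale u \<delta> T n S m N1 N2
  proof unfold_locales
    show "Factorial_Ring.irreducible P1" "Factorial_Ring.irreducible P2"
      using no_root unfolding P1_def P2_def irreducible_quadratic_iff by blast+
    have "N1 - N2 = d * (T * T - 4 * n)"
      by (simp add: N1_def N2_def norm_form_def algebra_simps)
    then show "N1 \<noteq> N2" using d0 disc by auto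
    have "\<delta> * \<delta> - 4 * N1 = (1 - d) * (1 - d) * (T * T - 4 * n)"
      "\<delta> * \<delta> - 4 * N2 = (1 + d) * (1 + d) * (T * T - 4 * n)"
      by (simp_all add: N1_def N2_def norm_form_def \<delta> S algebra_simps)
    then show "\<delta> * \<delta> - 4 * N1 \<noteq> 0" "\<delta> * \<delta> - 4 * N2 \<noteq> 0"
      using d1 disc by simp_all
  qed
  have "poly (map_poly to_ac (P1 * P2)) z = 0 \<longleftrightarrow> z \<in> {x - y | x y. x \<in> Root p \<and> y \<in> Root q}" for z
    unfolding map_poly_to_ac_mult factor roots poly_mult mult_eq_0_iff linear_root by blast
  then have "d_exceptional scale p q u \<longleftrightarrow> (\<forall>z\<in>ac_eigenvalues scale u. poly (map_poly to_ac (P1 * P2)) z = 0)"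
    unfolding d_exceptional_def by blast
  then have i: "cond_i \<longleftrightarrow> (\<exists>l R k e v. paired l R k e v)"
    unfolding cond_i_def eigenvalues_roots_iff_annihilated[OF assms(15)]
      difference_iff_paired[OF assms(15), symmetric] p[symmetric] q[symmetric] by blast
  have ii: "cond_ii \<longleftrightarrow> (\<exists>l R k e v. paired l R k e v)"
    unfolding cond_ii_def P paired_iff_invariant_factors ..
  \<comment> \<open>The four choices of roots produce only P1 and P2, so quantifying over roots
    amounts to quantifying over the two quadratics.\<close>
  have choice: "(\<exists>x\<in>Root p. \<exists>y\<in>Root q. Q (P x y)) \<longleftrightarrow> (\<exists>R\<in>{P1, P2}. Q R)" for Q
    unfolding roots by (auto simp: P)
  have "(\<exists>x\<in>Root p. \<exists>y\<in>Root q. \<exists>k. \<exists>e\<in>{0, 1}.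
      B = diag_block_mat [companion (P x y ^ (k + e)), companion (P x y ^ k)])
    \<longleftrightarrow> (\<exists>R\<in>{P1, P2}. \<exists>k. \<exists>e\<in>{0, 1}.
      B = diag_block_mat [companion (R ^ (k + e)), companion (R ^ k)])" for B
    by (rule choice)
  then have iii: "cond_iii \<longleftrightarrow> (\<exists>l R k e v. paired l R k e v)"
    unfolding cond_iii_def paired_iff_blocks by (simp only:)
  show ?thesis unfolding i ii iii by simp
qed

end
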